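(* There exist universal constants $C,c,\alpha_2>0$ such that the following holds. Let $n\ge2$, $d\ge2$, $\overline r\ge1$, $Q\ge1$ and $1\le K\le d^n$ be integers. Let $[\phi_{i,1}\ \cdots\ \phi_{i,d^n}]\in\mathbb{C}^{d^n\times d^n}$, $i=1,\dots,Q$, be independent Haar-distributed random unitary matrices, and let $\mathcal{A}^Q$ be the linear map that sends $\rho\in\mathbb{C}^{d^n\times d^n}$ to the vector of length $KQ$ with entries $\langle\phi_{i,k}\phi_{i,k}^\dagger,\rho\rangle$, $i=1,\dots,Q$, $k=1,\dots,K$. If $$Q\ \ge\ C\, n d^2\overline r^2\log n,$$ then, with probability at least $1-e^{-\alpha_2Q}$, $$\|\mathcal{A}^Q(\rho)\|_2=\Big(\sum_{i=1}^Q\sum_{k=1}^K|\langle\phi_{i,k}\phi_{i,k}^\dagger,\rho\rangle|^2\Big)^{1/2}\ \ge\ c\,\frac{\sqrt{QK}}{d^n}\qquad\text{for all }\rho\in\overline{\mathbb{X}}_{\overline r}.$$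
   Context: $\langle A,B\rangle=\operatorname{trace}(A^\dagger B)$. Rows (columns) of a $d^n\times d^n$ matrix are indexed by arrays $i_1\cdots i_n$ (resp. $j_1\cdots j_n$) with entries in $\{1,\dots,d\}$, where $i_1\cdots i_n$ denotes row number $i_1+\sum_{\ell=2}^n d^{\ell-1}(i_\ell-1)$. $\overline{\mathbb{X}}_{\overline r}$ is the set of unit-Frobenius-norm Hermitian matrix product operators with maximal rank $\overline r$: the set of all $\rho\in\mathbb{C}^{d^n\times d^n}$ with $\rho=\rho^\dagger$ for which there are $r_0=r_n=1$, positive integers $r_1,\dots,r_{n-1}$ with $\max_\ell r_\ell=\overline r$, and matrices $X_\ell^{i_\ell,j_\ell}\in\mathbb{C}^{r_{\ell-1}\times r_\ell}$ such that $\rho(i_1\cdots i_n,j_1\cdots j_n)=X_1^{i_1,j_1}\cdots X_n^{i_n,j_n}$ and $\sum_{i_\ell,j_\ell}(X_\ell^{i_\ell,j_\ell})^\dagger X_\ell^{i_\ell,j_\ell}=I_{r_\ell}$ for all $\ell=1,\dots,n$ (the case $\ell=n$ says $\|\rho\|_F=1$). *)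

theory Defs
  imports
    "HOL-Probability.Probability"
    "Jordan_Normal_Form.Schur_Decomposition"
begin

section \<open>Matrices\<close>

definition mat_trace :: "complex mat \<Rightarrow> complex" where
  "mat_trace A = (\<Sum>p<dim_row A. A $$ (p, p))"

definition mat_inner :: "complex mat \<Rightarrow> complex mat \<Rightarrow> complex" where
  "mat_inner A B = mat_trace (mat_adjoint A * B)"

definition hermitian :: "complex mat \<Rightarrow> bool" where
  "hermitian A \<longleftrightarrow> mat_adjoint A = A"

definition unitary_group :: "nat \<Rightarrow> complex mat set" where
  "unitary_group N =
    {U \<in> carrier_mat N N. mat_adjoint U * U = 1\<^sub>m N \<and> U * mat_adjoint U = 1\<^sub>m N}"

definition col_proj :: "complex mat \<Rightarrow> nat \<Rightarrow> complex mat" where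
  "col_proj U k =
    mat_of_cols (dim_row U) [col U k] * mat_adjoint (mat_of_cols (dim_row U) [col U k])"


section \<open>Haar-distributed unitary matrices\<close>

text \<open>The Borel sigma-algebra of \<open>U(N)\<close>: the one induced by the embedding of \<open>U(N)\<close>
  into \<open>\<complex>\<^bsup>N\<times>N\<^esup>\<close> that reads off the entries.\<close>

definition unitary_borel :: "nat \<Rightarrow> complex mat measure" where
  "unitary_borel N = vimage_algebra (unitary_group N)
     (\<lambda>U. \<lambda>pq\<in>{..<N} \<times> {..<N}. U $$ pq) (\<Pi>\<^sub>M pq\<in>{..<N} \<times> {..<N}. borel)"

text \<open>The group is compact, so a left-invariant Borel probability measure is the Haar
  probability measure. \<open>Q\<close> independent Haar-distributed matrices are represented by their joint
  law \<open>\<Pi>\<^sub>M i\<in>{..<Q}. \<mu>\<close>; the general case of random variables on some probability space is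
  the transport of this one along their distribution. Fixing the sample space this way keeps
  universal constants independent of a type of outcomes.\<close>

definition haar_unitary :: "nat \<Rightarrow> complex mat measure \<Rightarrow> bool" where
  "haar_unitary N \<mu> \<longleftrightarrow>
     prob_space \<mu> \<and> sets \<mu> = sets (unitary_borel N) \<and>
     (\<forall>V\<in>unitary_group N. distr \<mu> \<mu> (\<lambda>U. V * U) = \<mu>)"


section \<open>Hermitian matrix product operators\<close>

text \<open>Indices of matrices start at \<open>0\<close>: the digits \<open>i l\<close>, \<open>1 \<le> l \<le> n\<close>, range over
  \<open>{0..<d}\<close> and stand for the entries \<open>i l + 1\<close> of the array; likewise the row number
  below is the one-based row number minus one.\<close>

definition multi_index :: "nat \<Rightarrow> nat \<Rightarrow> (nat \<Rightarrow> nat) \<Rightarrow> nat" where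
  "multi_index d n i = (\<Sum>l=1..n. d ^ (l - 1) * i l)"

text \<open>The core matrix of site \<open>l\<close> for the digits \<open>a, b\<close> is \<open>X l a b\<close>. The product starts
  with the identity of size \<open>r 0 = 1\<close>.\<close>

fun core_product ::
    "(nat \<Rightarrow> nat \<Rightarrow> nat \<Rightarrow> complex mat) \<Rightarrow> (nat \<Rightarrow> nat) \<Rightarrow> (nat \<Rightarrow> nat) \<Rightarrow> nat \<Rightarrow> complex mat" where
  "core_product X i j 0 = 1\<^sub>m 1"
| "core_product X i j (Suc l) = core_product X i j l * X (Suc l) (i (Suc l)) (j (Suc l))"

text \<open>The sum of matrices in the left-orthogonality condition is written entrywise, because
  the matrix type has no global zero.\<close>

definition left_orthogonal :: "nat \<Rightarrow> nat \<Rightarrow> (nat \<Rightarrow> nat \<Rightarrow> complex mat) \<Rightarrow> bool" where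
  "left_orthogonal d r Y \<longleftrightarrow>
     mat r r (\<lambda>pq. \<Sum>a<d. \<Sum>b<d. (mat_adjoint (Y a b) * Y a b) $$ pq) = 1\<^sub>m r"

definition mpo_set :: "nat \<Rightarrow> nat \<Rightarrow> nat \<Rightarrow> complex mat set" where
  "mpo_set d n rbar = {\<rho> \<in> carrier_mat (d ^ n) (d ^ n). hermitian \<rho> \<and>
     (\<exists>r X. r 0 = 1 \<and> r n = 1 \<and> (\<forall>l\<in>{1..n - 1}. 0 < r l) \<and> Max (r ` {1..n - 1}) = rbar \<and>
       (\<forall>l\<in>{1..n}. \<forall>a<d. \<forall>b<d. X l a b \<in> carrier_mat (r (l - 1)) (r l)) \<and>
       (\<forall>i j. (\<forall>l\<in>{1..n}. i l < d \<and> j l < d) \<longrightarrow>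
          \<rho> $$ (multi_index d n i, multi_index d n j) = core_product X i j n $$ (0, 0)) \<and>
       (\<forall>l\<in>{1..n}. left_orthogonal d (r l) (X l)))}"


section \<open>The measurement map\<close>

definition vec_l2_norm :: "complex Matrix.vec \<Rightarrow> real" where
  "vec_l2_norm v = L2_set (\<lambda>m. cmod (vec_index v m)) {..<dim_vec v}"

text \<open>Entry number \<open>i * K + k\<close> belongs to column \<open>k\<close> of the unitary matrix \<open>\<Phi> i\<close>.\<close>

definition measurement :: "(nat \<Rightarrow> complex mat) \<Rightarrow> nat \<Rightarrow> nat \<Rightarrow> complex mat \<Rightarrow> complex Matrix.vec" where
  "measurement \<Phi> Q K \<rho> =
     Matrix.vec (K * Q) (\<lambda>m. mat_inner (col_proj (\<Phi> (m div K)) (m mod K)) \<rho>)"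

lemma vec_l2_norm_measurement:
  assumes "0 < K"
  shows "vec_l2_norm (measurement \<Phi> Q K \<rho>) =
    sqrt (\<Sum>i<Q. \<Sum>k<K. (cmod (mat_inner (col_proj (\<Phi> i) k) \<rho>))\<^sup>2)"
proof -
  let ?g = "\<lambda>i k. (cmod (mat_inner (col_proj (\<Phi> i) k) \<rho>))\<^sup>2"
  have "(\<Sum>m<Q * K. ?g (m div K) (m mod K)) = (\<Sum>i<Q. \<Sum>k<K. ?g i k)"
  proof (induction Q)
    case (Suc Q)
    have "{..<Suc Q * K} = {..<Q * K} \<union> {Q * K..<Q * K + K}" by auto
    then have "(\<Sum>m<Suc Q * K. ?g (m div K) (m mod K)) =
        (\<Sum>m<Q * K. ?g (m div K) (m mod K)) + (\<Sum>m=Q * K..<Q * K + K. ?g (m div K) (m mod K))"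
      by (simp add: sum.union_disjoint ivl_disj_int)
    also have "(\<Sum>m=Q * K..<Q * K + K. ?g (m div K) (m mod K)) = (\<Sum>k<K. ?g Q k)"
      by (rule sum.reindex_bij_witness[of _ "\<lambda>k. Q * K + k" "\<lambda>m. m - Q * K"])
        (use assms in \<open>auto simp: div_nat_eqI modulo_nat_def mult.commute\<close>)
    finally show ?case using Suc.IH by simp
  qed simp
  then show ?thesis
    by (simp add: vec_l2_norm_def measurement_def L2_set_def mult.commute)
qed

lemma measurable_left_mult:
  assumes V: "V \<in> unitary_group N"
  shows "(\<lambda>U. V * U) \<in> measurable (unitary_borel N) (unitary_borel N)"
proof -
  have Vc: "V \<in> carrier_mat N N" using V by (simp add: unitary_group_def)
  let ?I = "{..<N} \<times> {..<N}"
  let ?P = "\<Pi>\<^sub>M pq\<in>?I. (borel :: complex measure)"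
  let ?e = "\<lambda>U :: complex mat. \<lambda>pq\<in>?I. U $$ pq"
  have e: "?e \<in> measurable (unitary_borel N) ?P"
    unfolding unitary_borel_def by (rule measurable_vimage_algebra1) (auto simp: space_PiM)
  have ent: "(\<lambda>U. U $$ pq) \<in> borel_measurable (unitary_borel N)" if "pq \<in> ?I" for pq
    using measurable_compose[OF e measurable_component_singleton[OF that]] that by simp
  have sp: "space (unitary_borel N) = unitary_group N"
    by (simp add: unitary_borel_def)
  have closed: "V * U \<in> unitary_group N" if U: "U \<in> unitary_group N" for U
  proof -
    have Uc: "U \<in> carrier_mat N N" using U by (simp add: unitary_group_def)
    have ac: "mat_adjoint A \<in> carrier_mat N N" if "A \<in> carrier_mat N N" for A :: "complex mat"
      using that by (auto simp: mat_adjoint_def)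
    have adj: "mat_adjoint (V * U) = mat_adjoint U * mat_adjoint V"
      using Vc Uc by (intro eq_matI)
        (auto simp: mat_adjoint_def mat_of_rows_def scalar_prod_def conjugate_vec_def mult.commute
          intro!: sum.cong)
    have "mat_adjoint (V * U) * (V * U) = mat_adjoint U * (mat_adjoint V * V) * U"
      using Vc Uc ac[OF Vc] ac[OF Uc] by (simp add: adj assoc_mult_mat[of _ N N _ N _ N])
    moreover have "(V * U) * mat_adjoint (V * U) = V * (U * mat_adjoint U) * mat_adjoint V"
      using Vc Uc ac[OF Vc] ac[OF Uc] by (simp add: adj assoc_mult_mat[of _ N N _ N _ N])
    ultimately show ?thesis
      using U V Vc Uc ac[OF Vc] ac[OF Uc] by (simp add: unitary_group_def)
  qed
  have "(\<lambda>U. ?e (V * U)) \<in> measurable (unitary_borel N) ?P"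
  proof (rule measurable_restrict)
    fix pq assume pq: "pq \<in> ?I"
    have "(\<lambda>U. \<Sum>s<N. V $$ (fst pq, s) * U $$ (s, snd pq)) \<in> borel_measurable (unitary_borel N)"
      using pq by (intro borel_measurable_sum borel_measurable_times borel_measurable_const ent) auto
    then show "(\<lambda>U. (V * U) $$ pq) \<in> borel_measurable (unitary_borel N)"
      by (rule measurable_cong[THEN iffD1, rotated])
        (use pq Vc sp in \<open>auto simp: unitary_group_def scalar_prod_def lessThan_atLeast0\<close>)
  qed
  then have "(\<lambda>U. V * U) \<in> measurable (unitary_borel N)
      (vimage_algebra (unitary_group N) ?e ?P)"
    by (intro measurable_vimage_algebra2) (auto simp: sp closed)
  then show ?thesis by (simp add: unitary_borel_def)
qed

end

theory Submission
  imports Defs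
begin

text \<open>A unit vector \<open>u\<close> with unitarily invariant law satisfies a Stein identity: invariance under
  the plane rotations makes the expectation of the derivative of any function along a rotation
  vanish, and summing over all planes gives
  \<open>E[(trace B - N \<langle>u, B u\<rangle>) G(X) + (\<langle>H u, B u\<rangle> - \<langle>u, B u\<rangle> X) G'(X)] = 0\<close> for \<open>X = \<langle>u, H u\<rangle>\<close>.
  With \<open>B = H\<close> and \<open>B = H\<^sup>2\<close> it yields the second moment of \<open>X\<close> and a differential inequality for
  its moment generating function, so \<open>N X\<close> is subexponential at the scale
  \<open>max \<parallel>H\<parallel>\<^sub>F \<bar>trace H\<bar>\<close> and has a first absolute moment of that order. Averaging \<open>\<bar>X\<bar>\<close> over the
  \<open>K\<close> columns (Jensen, no independence needed) and the \<open>Q\<close> independent matrices (Chernoff) gives,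
  for fixed \<open>\<rho>\<close>, a lower bound that fails with probability \<open>exp (- c Q)\<close>, and upper tails for
  differences.

  Left-orthogonality makes \<open>\<rho>\<close> a Lipschitz function of its cores in operator norm, so a volume
  comparison in operator norm bounds packings of the matrix product operators at scale \<open>\<epsilon>\<close> by
  \<open>(1 + 2 n / \<epsilon>)\<close> to the power \<open>2 n d\<^sup>2 r\<^sup>2\<close>, without the factor \<open>log r\<close> an entrywise net would cost.
  Dyadic chaining of the averaged \<open>\<ell>\<^sub>1\<close> norm from a net of constant scale then makes the lower bound
  uniform, and Cauchy-Schwarz passes from \<open>\<ell>\<^sub>1\<close> to \<open>\<ell>\<^sub>2\<close>.\<close>

section \<open>Differentiation under the expectation\<close>

text \<open>Why absolute values: the scaled forms \<open>N * X\<close> may have merely exponential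
  tails, so their squares have no exponential moments uniform in \<open>N\<close>, while the
  absolute values do and obey the triangle inequality without loss. Why chaining: without
  randomness, the averaged measurement of a difference is bounded only by \<open>N\<close> times its
  Frobenius norm, so a single net would need a scale of order \<open>1 / N\<close>, and its
  log-cardinality would carry the factor \<open>ln N = n * ln d\<close>. In the chain, an allowance
  proportional to \<open>j + 4\<close> at scale \<open>2 ^ (- j)\<close> makes a failing link as
  rare as \<open>exp (- (j + 2) * Q)\<close>, whereas the log-cardinality of the nets grows only
  linearly in \<open>j\<close>. A number \<open>Q\<close> of the order of the first net's
  log-cardinality therefore pays for all scales at once. Why the trace does no harm: a matrix of
  unit Frobenius norm can have a trace of order \<open>sqrt N\<close>, and then its forms are large.
  Cutting the range of the trace into pieces of length \<epsilon> multiplies the size of a net by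
  about \<open>sqrt N / \<epsilon>\<close>, once and not per parameter, and the resulting
  \<open>n * ln d\<close> in the exponent is below \<open>n * d\<^sup>2\<close>.\<close>

lemma (in prob_space) has_real_derivative_expectation:
  fixes h :: "real \<Rightarrow> 'a \<Rightarrow> real"
  assumes meas: "\<And>s. h s \<in> borel_measurable M" and meas': "h' s\<^sub>0 \<in> borel_measurable M"
    and int: "\<And>s. integrable M (h s)"
    and deriv: "\<And>s x. x \<in> space M \<Longrightarrow> ((\<lambda>s. h s x) has_real_derivative h' s x) (at s)"
    and bound: "\<And>s x. x \<in> space M \<Longrightarrow> \<bar>s - s\<^sub>0\<bar> \<le> 1 \<Longrightarrow> norm (h' s x) \<le> C"
  shows "((\<lambda>s. expectation (h s)) has_real_derivative expectation (h' s\<^sub>0)) (at s\<^sub>0)"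
proof -
  let ?S = "{s\<^sub>0 - 1..s\<^sub>0 + 1}"
  \<comment> \<open>The mean value inequality bounds every difference quotient on this interval by
    \<open>C\<close>, which serves as the dominating function below.\<close>
  have lip: "norm (h s x - h s\<^sub>0 x) \<le> C * \<bar>s - s\<^sub>0\<bar>" if "x \<in> space M" "s \<in> ?S" for s x
  proof -
    have "norm (h s x - h s\<^sub>0 x) \<le> C * norm (s - s\<^sub>0)"
      by (rule field_differentiable_bound[of ?S "\<lambda>s. h s x" "\<lambda>s. h' s x"])
        (use deriv bound that in \<open>auto simp: has_field_derivative_at_within abs_le_iff\<close>)
    then show ?thesis by simp
  qed
  have "((\<lambda>s. (expectation (h s) - expectation (h s\<^sub>0)) / (s - s\<^sub>0))
      \<longlongrightarrow> expectation (h' s\<^sub>0)) (at s\<^sub>0 within ?S)"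
    unfolding tendsto_at_iff_sequentially comp_def
  proof (intro allI impI)
    fix X :: "nat \<Rightarrow> real" assume X: "\<forall>i. X i \<in> ?S - {s\<^sub>0}" and lim: "X \<longlonglongrightarrow> s\<^sub>0"
    have "(\<lambda>n. expectation (\<lambda>x. (h (X n) x - h s\<^sub>0 x) / (X n - s\<^sub>0))) \<longlonglongrightarrow> expectation (h' s\<^sub>0)"
    proof (rule integral_dominated_convergence[where w = "\<lambda>_. C"])
      show "AE x in M. (\<lambda>n. (h (X n) x - h s\<^sub>0 x) / (X n - s\<^sub>0)) \<longlonglongrightarrow> h' s\<^sub>0 x"
      proof (rule AE_I2)
        fix x assume x: "x \<in> space M"
        have "((\<lambda>s. h s x) has_real_derivative h' s\<^sub>0 x) (at s\<^sub>0 within ?S)"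
          using deriv[OF x] by (rule has_field_derivative_at_within)
        then have "((\<lambda>s. (h s x - h s\<^sub>0 x) / (s - s\<^sub>0)) \<longlongrightarrow> h' s\<^sub>0 x) (at s\<^sub>0 within ?S)"
          by (simp add: has_field_derivative_iff)
        then show "(\<lambda>n. (h (X n) x - h s\<^sub>0 x) / (X n - s\<^sub>0)) \<longlonglongrightarrow> h' s\<^sub>0 x"
          unfolding tendsto_at_iff_sequentially comp_def using X lim by blast
      qed
      show "AE x in M. norm ((h (X n) x - h s\<^sub>0 x) / (X n - s\<^sub>0)) \<le> C" for n
      proof (rule AE_I2)
        fix x assume x: "x \<in> space M"
        have "X n \<in> ?S" "X n \<noteq> s\<^sub>0" using X by auto
        then show "norm ((h (X n) x - h s\<^sub>0 x) / (X n - s\<^sub>0)) \<le> C"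
          using lip[OF x, of "X n"] by (simp add: field_simps)
      qed
    qed (use meas meas' in \<open>auto intro!: borel_measurable_scaleR borel_measurable_diff\<close>)
    then show "(\<lambda>n. (expectation (h (X n)) - expectation (h s\<^sub>0)) / (X n - s\<^sub>0)) \<longlonglongrightarrow> expectation (h' s\<^sub>0)"
      by (simp add: Bochner_Integration.integral_diff[OF int int])
  qed
  then have "((\<lambda>s. expectation (h s)) has_real_derivative expectation (h' s\<^sub>0)) (at s\<^sub>0 within ?S)"
    by (simp add: has_field_derivative_iff)
  moreover have "at s\<^sub>0 within ?S = at s\<^sub>0" by (rule at_within_interior) simp
  ultimately show ?thesis by simp
qed

text \<open>Differentiation under the expectation asks only that some dominating constant exists. A
  predicate closed under sums, products, conjugation and continuous functions provides one without
  explicit estimates.\<close>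

definition bdd_fun :: "'a set \<Rightarrow> ('a \<Rightarrow> 'b::real_normed_vector) \<Rightarrow> bool" where
  "bdd_fun S f \<longleftrightarrow> bounded (f ` S)"

lemma bdd_funD: "bdd_fun S f \<Longrightarrow> \<exists>C. \<forall>z\<in>S. norm (f z) \<le> C"
  by (auto simp: bdd_fun_def bounded_iff)

lemma bdd_funI: "(\<And>z. z \<in> S \<Longrightarrow> norm (f z) \<le> C) \<Longrightarrow> bdd_fun S f"
  by (auto simp: bdd_fun_def bounded_iff)

lemma bdd_fun_const: "bdd_fun S (\<lambda>_. c)"
  by (rule bdd_funI[of _ _ "norm c"]) simp

lemma bdd_fun_add: "bdd_fun S f \<Longrightarrow> bdd_fun S g \<Longrightarrow> bdd_fun S (\<lambda>z. f z + g z)"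
  unfolding bdd_fun_def by (rule bounded_plus_comp)

lemma bdd_fun_mult:
  fixes f g :: "'a \<Rightarrow> 'b::real_normed_algebra"
  assumes "bdd_fun S f" "bdd_fun S g" shows "bdd_fun S (\<lambda>z. f z * g z)"
proof -
  obtain C D where "\<forall>z\<in>S. norm (f z) \<le> C" "\<forall>z\<in>S. norm (g z) \<le> D"
    using assms[THEN bdd_funD] by blast
  then have "norm (f z * g z) \<le> C * D" if "z \<in> S" for z
    by (intro order_trans[OF norm_mult_ineq] mult_mono) (use that in \<open>auto intro: order_trans[OF norm_ge_zero]\<close>)
  then show ?thesis by (rule bdd_funI)
qed

lemma bdd_fun_sum: "(\<And>i. i \<in> I \<Longrightarrow> bdd_fun S (f i)) \<Longrightarrow> bdd_fun S (\<lambda>z. \<Sum>i\<in>I. f i z)"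
  by (induction I rule: infinite_finite_induct) (auto intro: bdd_fun_const bdd_fun_add)

lemma bdd_fun_cnj: "bdd_fun S f \<Longrightarrow> bdd_fun S (\<lambda>z. cnj (f z))"
  by (auto simp: bdd_fun_def bounded_iff)

lemma bdd_fun_Re: "bdd_fun S f \<Longrightarrow> bdd_fun S (\<lambda>z. Re (f z))"
proof -
  assume "bdd_fun S f"
  then obtain C where "\<forall>z\<in>S. norm (f z) \<le> C" using bdd_funD by blast
  then show ?thesis by (intro bdd_funI[of _ _ C]) (metis abs_Re_le_cmod order_trans real_norm_def)
qed

text \<open>The closure of a bounded set of reals is compact, so a continuous function is bounded on
  it.\<close>

lemma bdd_fun_compose:
  fixes f :: "'a \<Rightarrow> real" and g :: "real \<Rightarrow> real"
  assumes "bdd_fun S f" "continuous_on UNIV g" shows "bdd_fun S (\<lambda>z. g (f z))"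
proof -
  have "compact (closure (f ` S))" using assms(1) by (simp add: bdd_fun_def compact_closure)
  then have "compact (g ` closure (f ` S))"
    using assms(2) compact_continuous_image continuous_on_subset by blast
  moreover have "(\<lambda>z. g (f z)) ` S \<subseteq> g ` closure (f ` S)"
    using closure_subset[of "f ` S"] by auto
  ultimately show ?thesis
    unfolding bdd_fun_def by (blast intro: bounded_subset compact_imp_bounded)
qed

section \<open>Vectors with a unitarily invariant law\<close>

text \<open>Up to the final transfer, matrices and vectors are plain index functions with the
  dimension as a parameter. Only indices below \<open>N\<close> are read, so no carrier conditions
  have to be propagated.\<close>

definition mat_app :: "nat \<Rightarrow> (nat \<Rightarrow> nat \<Rightarrow> complex) \<Rightarrow> (nat \<Rightarrow> complex) \<Rightarrow> nat \<Rightarrow> complex" where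
  "mat_app N B v i = (\<Sum>k<N. B i k * v k)"

definition qform :: "nat \<Rightarrow> (nat \<Rightarrow> nat \<Rightarrow> complex) \<Rightarrow> (nat \<Rightarrow> complex) \<Rightarrow> real" where
  "qform N B v = Re (\<Sum>i<N. cnj (v i) * mat_app N B v i)"

definition hermitian_on :: "nat \<Rightarrow> (nat \<Rightarrow> nat \<Rightarrow> complex) \<Rightarrow> bool" where
  "hermitian_on N H \<longleftrightarrow> (\<forall>i<N. \<forall>j<N. H j i = cnj (H i j))"

definition unitary_on :: "nat \<Rightarrow> (nat \<Rightarrow> nat \<Rightarrow> complex) \<Rightarrow> bool" where
  "unitary_on N V \<longleftrightarrow>
    (\<forall>a<N. \<forall>b<N. (\<Sum>k<N. cnj (V k a) * V k b) = (if a = b then 1 else 0))"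

lemma mat_app_cong: "(\<And>k. k < N \<Longrightarrow> v k = w k) \<Longrightarrow> mat_app N B v i = mat_app N B w i"
  by (simp add: mat_app_def)

lemma qform_cong: "(\<And>k. k < N \<Longrightarrow> v k = w k) \<Longrightarrow> qform N B v = qform N B w"
  by (simp add: qform_def cong: mat_app_cong)

lemma hermitian_mat_app_swap:
  assumes "hermitian_on N H"
  shows "(\<Sum>i<N. cnj (v i) * mat_app N H w i) = cnj (\<Sum>i<N. cnj (w i) * mat_app N H v i)"
proof -
  have "(\<Sum>i<N. cnj (v i) * mat_app N H w i) = (\<Sum>i<N. \<Sum>k<N. cnj (v i) * H i k * w k)"
    by (simp add: mat_app_def sum_distrib_left mult.assoc)
  also have "\<dots> = (\<Sum>k<N. \<Sum>i<N. cnj (v i) * H i k * w k)" by (rule sum.swap)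
  also have "\<dots> = (\<Sum>k<N. \<Sum>i<N. w k * (cnj (H k i) * cnj (v i)))"
  proof (intro sum.cong refl)
    fix k i assume "k \<in> {..<N}" "i \<in> {..<N}"
    then have "H i k = cnj (H k i)" using assms unfolding hermitian_on_def by blast
    then show "cnj (v i) * H i k * w k = w k * (cnj (H k i) * cnj (v i))" by (simp only: mult_ac)
  qed
  also have "\<dots> = cnj (\<Sum>i<N. cnj (w i) * mat_app N H v i)"
    by (simp add: mat_app_def sum_distrib_left)
  finally show ?thesis .
qed

lemma borel_measurable_cnj [measurable (raw)]:
  "f \<in> borel_measurable M \<Longrightarrow> (\<lambda>x. cnj (f x)) \<in> borel_measurable M"
  by (rule measurable_compose[OF _ borel_measurable_continuous_onI])
    (auto intro: continuous_on_cnj continuous_on_id)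

lemma borel_measurable_mat_app:
  "(\<And>k. k < N \<Longrightarrow> (\<lambda>x. v x k) \<in> borel_measurable M) \<Longrightarrow> (\<lambda>x. mat_app N B (v x) i) \<in> borel_measurable M"
  unfolding mat_app_def by (intro borel_measurable_sum borel_measurable_times) auto

lemma borel_measurable_qform:
  "(\<And>k. k < N \<Longrightarrow> (\<lambda>x. v x k) \<in> borel_measurable M) \<Longrightarrow> (\<lambda>x. qform N B (v x)) \<in> borel_measurable M"
proof -
  assume [measurable]: "\<And>k. k < N \<Longrightarrow> (\<lambda>x. v x k) \<in> borel_measurable M"
  show ?thesis unfolding qform_def mat_app_def by measurable
qed

text \<open>What a single column of a Haar matrix inherits from left invariance; all moment bounds
  are proved from this.\<close>

locale unitary_invariant_vector = prob_space M for M :: "'a measure" +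
  fixes N :: nat and u :: "'a \<Rightarrow> nat \<Rightarrow> complex"
  assumes measurable_u: "k < N \<Longrightarrow> (\<lambda>x. u x k) \<in> borel_measurable M"
    and unit_u: "x \<in> space M \<Longrightarrow> (\<Sum>k<N. (cmod (u x k))\<^sup>2) = 1"
    and invariant_u: "unitary_on N V \<Longrightarrow>
      distr M (\<Pi>\<^sub>M k\<in>{..<N}. borel) (\<lambda>x. \<lambda>k\<in>{..<N}. mat_app N V (u x) k) =
      distr M (\<Pi>\<^sub>M k\<in>{..<N}. borel) (\<lambda>x. \<lambda>k\<in>{..<N}. u x k)"
begin

lemma norm_u_le_1: assumes "x \<in> space M" "k < N" shows "cmod (u x k) \<le> 1"
proof -
  have "(cmod (u x k))\<^sup>2 \<le> (\<Sum>k<N. (cmod (u x k))\<^sup>2)"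
    using assms by (intro member_le_sum) auto
  then show ?thesis using unit_u[OF assms(1)] by (simp add: power2_le_imp_le)
qed

lemma expectation_mat_app_eq:
  fixes f :: "(nat \<Rightarrow> complex) \<Rightarrow> real"
  assumes V: "unitary_on N V" and f: "f \<in> borel_measurable (\<Pi>\<^sub>M k\<in>{..<N}. borel)"
    and f_cong: "\<And>v w. (\<And>k. k < N \<Longrightarrow> v k = w k) \<Longrightarrow> f v = f w"
  shows "expectation (\<lambda>x. f (mat_app N V (u x))) = expectation (\<lambda>x. f (u x))"
proof -
  let ?P = "\<Pi>\<^sub>M k\<in>{..<N}. (borel :: complex measure)"
  have m: "(\<lambda>x. \<lambda>k\<in>{..<N}. mat_app N V (u x) k) \<in> measurable M ?P" "(\<lambda>x. \<lambda>k\<in>{..<N}. u x k) \<in> measurable M ?P"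
    by (auto intro!: measurable_restrict borel_measurable_mat_app measurable_u)
  have "expectation (\<lambda>x. f (mat_app N V (u x))) = expectation (\<lambda>x. f (\<lambda>k\<in>{..<N}. mat_app N V (u x) k))"
    by (intro Bochner_Integration.integral_cong refl f_cong) auto
  also have "\<dots> = expectation (\<lambda>x. f (\<lambda>k\<in>{..<N}. u x k))"
    using integral_distr[OF m(1) f] integral_distr[OF m(2) f] invariant_u[OF V] by simp
  also have "\<dots> = expectation (\<lambda>x. f (u x))"
    by (intro Bochner_Integration.integral_cong refl f_cong) auto
  finally show ?thesis .
qed

end

lemma has_vector_derivative_cnj' [derivative_intros]:
  "(f has_vector_derivative f') F \<Longrightarrow> ((\<lambda>x. cnj (f x)) has_vector_derivative cnj f') F"
  by (rule bounded_linear.has_vector_derivative[OF bounded_linear_cnj])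

lemma has_real_derivative_Re':
  "(f has_vector_derivative f') (at x) \<Longrightarrow> ((\<lambda>x. Re (f x)) has_real_derivative Re f') (at x)"
  unfolding has_real_derivative_iff_has_vector_derivative
  by (rule bounded_linear.has_vector_derivative[OF bounded_linear_Re])

text \<open>The family \<open>V s\<close> solves \<open>V' = A V\<close> with \<open>V 0\<close> the
  identity, so \<open>V s\<close> applied to \<open>u\<close> moves along the linear vector field
  \<open>A\<close> while its law stays that of \<open>u\<close>. The expectation of the test
  function \<open>F\<close> is thus constant in \<open>s\<close>, and \<open>D\<close> is the
  derivative of \<open>F\<close> along the field. The phase \<open>c\<close> is later matched to the
  generator.\<close>

lemma (in unitary_invariant_vector) generator_identity:
  fixes V :: "real \<Rightarrow> nat \<Rightarrow> nat \<Rightarrow> complex" and A B H :: "nat \<Rightarrow> nat \<Rightarrow> complex" and c :: complex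
  assumes V: "\<And>s. unitary_on N (V s)" and V_0: "\<And>i k. V 0 i k = (if i = k then 1 else 0)"
    and V_deriv: "\<And>s i k. i < N \<Longrightarrow> k < N \<Longrightarrow>
      ((\<lambda>s. V s i k) has_vector_derivative (\<Sum>m<N. A i m * V s m k)) (at s)"
    and V_le: "\<And>s i k. cmod (V s i k) \<le> 1"
    and H: "hermitian_on N H"
    and G: "\<And>x. (G has_real_derivative G' x) (at x)" and G'_cont: "continuous_on UNIV G'"
    and ij: "i < N" "j < N"
  defines "D \<equiv> \<lambda>v. Re (c * (mat_app N B (mat_app N A v) i * cnj (v j) + mat_app N B v i * cnj (mat_app N A v j))) * G (qform N H v)
      + Re (c * (mat_app N B v i * cnj (v j))) *
        (G' (qform N H v) * (2 * Re (\<Sum>k<N. cnj (mat_app N A v k) * mat_app N H v k)))"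
  shows "integrable M (\<lambda>x. D (u x))" and "expectation (\<lambda>x. D (u x)) = 0"
proof -
  define F where "F v = Re (c * (mat_app N B v i * cnj (v j))) * G (qform N H v)" for v
  define w where "w s x = mat_app N (V s) (u x)" for s x
  have G_cont: "continuous_on UNIV G" using G by (meson DERIV_isCont continuous_at_imp_continuous_on)
  have [measurable]: "G \<in> borel_measurable borel" "G' \<in> borel_measurable borel"
    using G_cont G'_cont by (auto intro: borel_measurable_continuous_onI)
  have F_cong: "F v = F w'" if "\<And>k. k < N \<Longrightarrow> v k = w' k" for v w'
    unfolding F_def using qform_cong[of N v w' H] mat_app_cong[of N v w' B] that ij by simp
  have D_cong: "D v = D w'" if "\<And>k. k < N \<Longrightarrow> v k = w' k" for v w'
  proof -
    have "mat_app N B' v = mat_app N B' w'" for B' by (intro ext mat_app_cong that)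
    moreover have "qform N H v = qform N H w'" using that by (rule qform_cong)
    ultimately show ?thesis unfolding D_def using that[OF ij(2)] by (simp only:)
  qed
  have F_meas: "(\<lambda>x. F (v x)) \<in> borel_measurable M'" if "\<And>k. k < N \<Longrightarrow> (\<lambda>x. v x k) \<in> borel_measurable M'" for v M'
  proof -
    note [measurable] = that
    have [measurable]: "(\<lambda>x. v x i) \<in> borel_measurable M'" "(\<lambda>x. v x j) \<in> borel_measurable M'" using that ij by auto
    have [measurable]: "(\<lambda>x. qform N H (v x)) \<in> borel_measurable M'" by (rule borel_measurable_qform) (rule that)
    have [measurable]: "(\<lambda>x. mat_app N B' (v x) k) \<in> borel_measurable M'" for B' k by (rule borel_measurable_mat_app) (rule that)
    show ?thesis unfolding F_def by measurable
  qed
  have D_meas: "(\<lambda>x. D (v x)) \<in> borel_measurable M'" if "\<And>k. k < N \<Longrightarrow> (\<lambda>x. v x k) \<in> borel_measurable M'" for v M'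
  proof -
    note [measurable] = that
    have [measurable]: "(\<lambda>x. v x i) \<in> borel_measurable M'" "(\<lambda>x. v x j) \<in> borel_measurable M'" using that ij by auto
    have [measurable]: "(\<lambda>x. qform N H (v x)) \<in> borel_measurable M'" by (rule borel_measurable_qform) (rule that)
    have mvm [measurable]: "(\<lambda>x. mat_app N B' (v x) k) \<in> borel_measurable M'" for B' k by (rule borel_measurable_mat_app) (rule that)
    have [measurable]: "(\<lambda>x. mat_app N B' (mat_app N A (v x)) k) \<in> borel_measurable M'" for B' k by (rule borel_measurable_mat_app) (rule mvm)
    show ?thesis unfolding D_def by measurable
  qed
  have w_meas: "(\<lambda>x. w s x k) \<in> borel_measurable M" for s k
    unfolding w_def by (intro borel_measurable_mat_app measurable_u)
  have w_deriv: "((\<lambda>s. w s x k) has_vector_derivative mat_app N A (w s x) k) (at s)" if "k < N" for s x k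
  proof -
    have "((\<lambda>s. \<Sum>l<N. V s k l * u x l) has_vector_derivative (\<Sum>l<N. (\<Sum>m<N. A k m * V s m l) * u x l)) (at s)"
      using V_deriv[OF that] by (intro has_vector_derivative_sum has_vector_derivative_mult_left) auto
    also have "(\<Sum>l<N. (\<Sum>m<N. A k m * V s m l) * u x l) = mat_app N A (w s x) k"
      unfolding w_def mat_app_def sum_distrib_left sum_distrib_right by (subst sum.swap) (simp add: mult_ac)
    finally show ?thesis by (simp add: w_def mat_app_def)
  qed
  have mat_app_deriv: "((\<lambda>s. mat_app N B' (w s x) k) has_vector_derivative mat_app N B' (mat_app N A (w s x)) k) (at s)" for B' s x k
    unfolding mat_app_def[of N B'] using w_deriv by (intro has_vector_derivative_sum has_vector_derivative_mult_right) auto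
  have q_deriv: "((\<lambda>s. qform N H (w s x)) has_real_derivative
      2 * Re (\<Sum>k<N. cnj (mat_app N A (w s x) k) * mat_app N H (w s x) k)) (at s)" for s x
  proof -
    have "((\<lambda>s. \<Sum>k<N. cnj (w s x k) * mat_app N H (w s x) k) has_vector_derivative
        (\<Sum>k<N. cnj (w s x k) * mat_app N H (mat_app N A (w s x)) k + cnj (mat_app N A (w s x) k) * mat_app N H (w s x) k)) (at s)"
      using w_deriv mat_app_deriv
      by (intro has_vector_derivative_sum has_vector_derivative_mult has_vector_derivative_cnj') auto
    then have "((\<lambda>s. qform N H (w s x)) has_real_derivative
        Re (\<Sum>k<N. cnj (w s x k) * mat_app N H (mat_app N A (w s x)) k + cnj (mat_app N A (w s x) k) * mat_app N H (w s x) k)) (at s)"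
      unfolding qform_def by (rule has_real_derivative_Re')
    then show ?thesis
      using hermitian_mat_app_swap[OF H, of "w s x" "mat_app N A (w s x)"] by (simp add: sum.distrib)
  qed
  have F_deriv: "((\<lambda>s. F (w s x)) has_real_derivative D (w s x)) (at s)" for s x
  proof -
    have "((\<lambda>s. c * (mat_app N B (w s x) i * cnj (w s x j))) has_vector_derivative
        c * (mat_app N B (w s x) i * cnj (mat_app N A (w s x) j) + mat_app N B (mat_app N A (w s x)) i * cnj (w s x j))) (at s)"
      using w_deriv[OF ij(2)] mat_app_deriv
      by (intro has_vector_derivative_mult_right has_vector_derivative_mult has_vector_derivative_cnj') auto
    note 1 = has_real_derivative_Re'[OF this]
    have 2: "((\<lambda>s. G (qform N H (w s x))) has_real_derivative
        G' (qform N H (w s x)) * (2 * Re (\<Sum>k<N. cnj (mat_app N A (w s x) k) * mat_app N H (w s x) k))) (at s)"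
      using DERIV_chain2[OF G q_deriv] by simp
    show ?thesis
      using DERIV_mult[OF 1 2] unfolding F_def D_def by (simp add: algebra_simps)
  qed
  \<comment> \<open>The bounds hold for all \<open>s\<close> at once, because
    \<open>cmod (V s i k) \<le> 1\<close> bounds the moved vector independently of
    \<open>s\<close>.\<close>
  let ?S = "(UNIV :: real set) \<times> space M"
  note bi = bdd_fun_add bdd_fun_mult bdd_fun_sum bdd_fun_cnj bdd_fun_Re bdd_fun_const
    bdd_fun_compose[OF _ G_cont] bdd_fun_compose[OF _ G'_cont]
  have w_bdd: "bdd_fun ?S (\<lambda>z. w (fst z) (snd z) k)" for k
  proof (rule bdd_funI)
    fix z assume "z \<in> ?S"
    then show "norm (w (fst z) (snd z) k) \<le> (\<Sum>l<N. 1 * 1)"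
      unfolding w_def mat_app_def using V_le norm_u_le_1
      by (intro sum_norm_le) (auto simp: norm_mult intro!: mult_le_one)
  qed
  have mat_app_bdd: "bdd_fun ?S (\<lambda>z. mat_app N B' (f z) k)" if "\<And>k. bdd_fun ?S (\<lambda>z. f z k)" for B' f k
    unfolding mat_app_def by (intro bdd_fun_sum bdd_fun_mult bdd_fun_const that)
  have q_bdd: "bdd_fun ?S (\<lambda>z. qform N H (w (fst z) (snd z)))"
    unfolding qform_def by (intro bdd_fun_Re bdd_fun_sum bdd_fun_mult bdd_fun_cnj mat_app_bdd w_bdd)
  note G_bdd = bdd_fun_compose[OF q_bdd G_cont] bdd_fun_compose[OF q_bdd G'_cont]
  note A_bdd = mat_app_bdd[of "\<lambda>z. mat_app N A (w (fst z) (snd z))", OF mat_app_bdd[of "\<lambda>z. w (fst z) (snd z)", OF w_bdd]]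
    mat_app_bdd[of "\<lambda>z. w (fst z) (snd z)", OF w_bdd]
  have D_bdd: "bdd_fun ?S (\<lambda>z. D (w (fst z) (snd z)))"
    unfolding D_def
    by (intro bdd_fun_add bdd_fun_mult bdd_fun_Re bdd_fun_sum bdd_fun_cnj A_bdd G_bdd w_bdd bdd_fun_const)
  have F_bdd: "bdd_fun ?S (\<lambda>z. F (w (fst z) (snd z)))"
    unfolding F_def
    by (intro bdd_fun_mult bdd_fun_Re bdd_fun_cnj A_bdd G_bdd w_bdd bdd_fun_const)
  obtain CD where CD: "\<And>s x. x \<in> space M \<Longrightarrow> norm (D (w s x)) \<le> CD"
    using bdd_funD[OF D_bdd] by auto
  obtain CF where CF: "\<And>s x. x \<in> space M \<Longrightarrow> norm (F (w s x)) \<le> CF"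
    using bdd_funD[OF F_bdd] by auto
  have w_0: "w 0 x k = u x k" if "k < N" for x k
    using that by (simp add: w_def mat_app_def V_0 if_distrib[of "\<lambda>a. a * _"] cong: if_cong)
  have D_0: "D (w 0 x) = D (u x)" for x using w_0 by (intro D_cong)
  have int: "integrable M (\<lambda>x. D (w 0 x))"
    using CD by (intro integrable_const_bound[of _ CD] D_meas w_meas) auto
  have "((\<lambda>s. expectation (\<lambda>x. F (w s x))) has_real_derivative expectation (\<lambda>x. D (w 0 x))) (at 0)"
  proof (rule has_real_derivative_expectation[where C = CD])
    show "integrable M (\<lambda>x. F (w s x))" for s
      using CF by (intro integrable_const_bound[of _ CF] F_meas w_meas) auto
    show "(\<lambda>x. F (w s x)) \<in> borel_measurable M" "(\<lambda>x. D (w 0 x)) \<in> borel_measurable M" for s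
      by (intro F_meas D_meas w_meas)+
    show "((\<lambda>s. F (w s x)) has_real_derivative D (w s x)) (at s)" for s x by (rule F_deriv)
    show "norm (D (w s x)) \<le> CD" if "x \<in> space M" for s x using that by (rule CD)
  qed
  moreover have "expectation (\<lambda>x. F (w s x)) = expectation (\<lambda>x. F (u x))" for s
    unfolding w_def
  proof (rule expectation_mat_app_eq[OF V _ F_cong])
    show "F \<in> borel_measurable (\<Pi>\<^sub>M k\<in>{..<N}. borel)"
      by (intro F_meas[of "\<lambda>v. v"] measurable_component_singleton) auto
  qed
  ultimately have "expectation (\<lambda>x. D (u x)) = 0"
    using DERIV_unique[OF _ DERIV_const] by (simp add: D_0)
  with int show "integrable M (\<lambda>x. D (u x))" "expectation (\<lambda>x. D (u x)) = 0"
    by (simp_all add: D_0)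
qed

section \<open>One-parameter groups: rotations in a coordinate plane and phase rotations of one
  coordinate\<close>

definition plane_generator :: "nat \<Rightarrow> nat \<Rightarrow> complex \<Rightarrow> nat \<Rightarrow> nat \<Rightarrow> complex" where
  "plane_generator i j \<omega> a b = (if a = i \<and> b = j then \<omega> else if a = j \<and> b = i then - cnj \<omega> else 0)"

text \<open>For \<omega> of modulus one and distinct \<open>i\<close>, \<open>j\<close> this is the
  exponential of \<open>s\<close> times \<open>plane_generator i j \<omega>\<close>.\<close>

definition plane_rotation :: "nat \<Rightarrow> nat \<Rightarrow> complex \<Rightarrow> real \<Rightarrow> nat \<Rightarrow> nat \<Rightarrow> complex" where
  "plane_rotation i j \<omega> s a b =
    (if a = i then if b = i then of_real (cos s) else if b = j then \<omega> * of_real (sin s) else 0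
     else if a = j then if b = i then - cnj \<omega> * of_real (sin s) else if b = j then of_real (cos s) else 0
     else if a = b then 1 else 0)"

text \<open>Supplies the diagonal case \<open>i = j\<close>, for which there is no coordinate plane
  to rotate.\<close>

definition phase_rotation :: "nat \<Rightarrow> real \<Rightarrow> nat \<Rightarrow> nat \<Rightarrow> complex" where
  "phase_rotation i s a b = (if a = b then if a = i then cis s else 1 else 0)"

lemma sum_two_points:
  fixes f :: "nat \<Rightarrow> 'a::comm_monoid_add"
  assumes "i < N" "j < N" "i \<noteq> j" "\<And>k. k < N \<Longrightarrow> k \<noteq> i \<Longrightarrow> k \<noteq> j \<Longrightarrow> f k = 0"
  shows "(\<Sum>k<N. f k) = f i + f j"
proof -
  have "(\<Sum>k<N. f k) = (\<Sum>k\<in>{i, j}. f k)"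
    using assms by (intro sum.mono_neutral_right) auto
  then show ?thesis using assms by simp
qed

lemma sum_one_point:
  fixes f :: "nat \<Rightarrow> 'a::comm_monoid_add"
  assumes "i < N" "\<And>k. k < N \<Longrightarrow> k \<noteq> i \<Longrightarrow> f k = 0"
  shows "(\<Sum>k<N. f k) = f i"
proof -
  have "(\<Sum>k<N. f k) = (\<Sum>k\<in>{i}. f k)"
    using assms by (intro sum.mono_neutral_right) auto
  then show ?thesis by simp
qed

lemma unitary_plane_rotation:
  assumes "i < N" "j < N" "i \<noteq> j" "cmod \<omega> = 1"
  shows "unitary_on N (plane_rotation i j \<omega> s)"
  unfolding unitary_on_def
proof (intro allI impI)
  fix a b assume ab: "a < N" "b < N"
  have w: "\<omega> * cnj \<omega> = 1" "cnj \<omega> * \<omega> = 1"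
    using assms(4) by (simp_all add: complex_norm_square[symmetric] mult.commute[of "cnj \<omega>"])
  have cs: "complex_of_real (cos s) * complex_of_real (cos s) + complex_of_real (sin s) * complex_of_real (sin s) = 1"
    by (metis of_real_add of_real_mult of_real_1 sin_cos_squared_add3)
  let ?R = "plane_rotation i j \<omega> s"
  let ?f = "\<lambda>k. cnj (?R k a) * ?R k b"
  show "(\<Sum>k<N. ?f k) = (if a = b then 1 else 0)"
  proof (cases "a = i \<or> a = j")
    case True
    have "(\<Sum>k<N. ?f k) = ?f i + ?f j"
      using assms True by (intro sum_two_points) (auto simp: plane_rotation_def)
    also have "\<dots> = (if a = b then 1 else 0)"
    proof -
      have 1: "\<omega> * (cnj \<omega> * z) = z" for z using w by (simp flip: mult.assoc)
      show ?thesis using True assms(3) cs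
        by (auto simp: plane_rotation_def algebra_simps 1)
    qed
    finally show ?thesis .
  next
    case False
    then have "(\<Sum>k<N. ?f k) = ?f a"
      using assms ab by (intro sum_one_point) (auto simp: plane_rotation_def)
    then show ?thesis using False by (auto simp: plane_rotation_def)
  qed
qed

lemma unitary_phase_rotation: "unitary_on N (phase_rotation i s)"
  unfolding unitary_on_def
proof (intro allI impI)
  fix a b assume ab: "a < N" "b < N"
  have "(\<Sum>k<N. cnj (phase_rotation i s k a) * phase_rotation i s k b) =
      cnj (phase_rotation i s a a) * phase_rotation i s a b"
    using ab by (intro sum_one_point) (auto simp: phase_rotation_def)
  then show "(\<Sum>k<N. cnj (phase_rotation i s k a) * phase_rotation i s k b) = (if a = b then 1 else 0)"
    by (auto simp: phase_rotation_def cis_cnj cis_mult)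
qed

lemma mat_app_plane_generator:
  assumes "i < N" "j < N" "i \<noteq> j"
  shows "mat_app N (plane_generator i j \<omega>) v k =
    (if k = i then \<omega> * v j else if k = j then - cnj \<omega> * v i else 0)"
  unfolding mat_app_def using assms
  by (subst sum_two_points[of i N j]) (auto simp: plane_generator_def)

context unitary_invariant_vector
begin

text \<open>Off the diagonal, \<open>T\<close> is the average of the derivatives \<open>D\<close>
  for \<open>\<omega> = 1\<close> and \<open>\<omega> = \<i>\<close>, each with weight
  \<open>c = cnj \<omega>\<close>: the terms with the factor \<open>(cnj \<omega>)\<^sup>2\<close>
  cancel, and those in which \<omega> meets its conjugate remain. On the diagonal a single phase
  rotation gives \<open>T\<close> directly.\<close>

lemma pair_identity:
  fixes B H :: "nat \<Rightarrow> nat \<Rightarrow> complex"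
  assumes H: "hermitian_on N H"
    and G: "\<And>x. (G has_real_derivative G' x) (at x)" and G'_cont: "continuous_on UNIV G'"
    and ij: "i < N" "j < N"
  defines "T \<equiv> \<lambda>v. Re (B i i * of_real ((cmod (v j))\<^sup>2) - mat_app N B v i * cnj (v i)) * G (qform N H v)
      + Re (mat_app N B v i * cnj (v j) * (cnj (mat_app N H v i) * v j - cnj (v i) * mat_app N H v j)) * G' (qform N H v)"
  shows "integrable M (\<lambda>x. T (u x))" and "expectation (\<lambda>x. T (u x)) = 0"
proof -
  define D where "D A c v = Re (c * (mat_app N B (mat_app N A v) i * cnj (v j) + mat_app N B v i * cnj (mat_app N A v j))) * G (qform N H v)
      + Re (c * (mat_app N B v i * cnj (v j))) *
        (G' (qform N H v) * (2 * Re (\<Sum>k<N. cnj (mat_app N A v k) * mat_app N H v k)))" for A c v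
  have "integrable M (\<lambda>x. T (u x)) \<and> expectation (\<lambda>x. T (u x)) = 0"
  proof (cases "i = j")
    case True
    define A where "A = (\<lambda>a b. if a = i \<and> b = i then \<i> else 0)"
    have mvA: "mat_app N A v k = (if k = i then \<i> * v i else 0)" for v k
      unfolding mat_app_def using ij by (subst sum_one_point[of i N]) (auto simp: A_def)
    have der: "((\<lambda>s. phase_rotation i s a b) has_vector_derivative (\<Sum>m<N. A a m * phase_rotation i s m b)) (at s)"
      if "a < N" "b < N" for s a b
    proof -
      have "(\<Sum>m<N. A a m * phase_rotation i s m b) = (if a = i \<and> b = i then \<i> * cis s else 0)"
        using ij by (subst sum_one_point[of i N]) (auto simp: A_def phase_rotation_def)
      moreover have "(cis has_vector_derivative \<i> * cis s) (at s)"
        unfolding cis_conv_exp[abs_def] by (auto intro!: derivative_eq_intros has_vector_derivative_real_field)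
      ultimately show ?thesis
        by (cases "a = b"; cases "a = i") (auto simp: phase_rotation_def[abs_def])
    qed
    have *: "integrable M (\<lambda>x. D A (-\<i>) (u x)) \<and> expectation (\<lambda>x. D A (-\<i>) (u x)) = 0"
      unfolding D_def
      using generator_identity[OF unitary_phase_rotation _ der _ H G G'_cont ij, where c = "-\<i>" and B = B]
      by (auto simp: phase_rotation_def)
    have "T v = D A (-\<i>) v" for v
    proof -
      have 1: "mat_app N B (mat_app N A v) i = B i i * \<i> * v i"
        unfolding mat_app_def[of N B] mvA using ij by (subst sum_one_point[of i N]) auto
      have 2: "(\<Sum>k<N. cnj (mat_app N A v k) * mat_app N H v k) = - \<i> * cnj (v i) * mat_app N H v i"
        unfolding mvA using ij by (subst sum_one_point[of i N]) auto
      show ?thesis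
        unfolding T_def D_def 1 2 cmod_power2 unfolding mvA True[symmetric]
        by (simp add: algebra_simps power2_eq_square)
    qed
    then show ?thesis using * by simp
  next
    case False
    have mvA: "mat_app N (plane_generator i j \<omega>) v k =
        (if k = i then \<omega> * v j else if k = j then - cnj \<omega> * v i else 0)" for \<omega> v k
      by (rule mat_app_plane_generator[OF ij False])
    have *: "integrable M (\<lambda>x. D (plane_generator i j \<omega>) (cnj \<omega>) (u x)) \<and>
        expectation (\<lambda>x. D (plane_generator i j \<omega>) (cnj \<omega>) (u x)) = 0" if w: "cmod \<omega> = 1" for \<omega>
    proof -
      have ww: "\<omega> * cnj \<omega> = 1" "cnj \<omega> * \<omega> = 1"
        using w by (simp_all add: complex_norm_square[symmetric] mult.commute[of "cnj \<omega>"])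
      have der: "((\<lambda>s. plane_rotation i j \<omega> s a b) has_vector_derivative
          (\<Sum>m<N. plane_generator i j \<omega> a m * plane_rotation i j \<omega> s m b)) (at s)" if "a < N" "b < N" for s a b
      proof -
        have c: "((\<lambda>s. complex_of_real (cos s)) has_vector_derivative - complex_of_real (sin s)) (at s)"
          and s: "((\<lambda>s. complex_of_real (sin s)) has_vector_derivative complex_of_real (cos s)) (at s)"
          by (auto intro!: derivative_eq_intros has_vector_derivative_of_real
              simp flip: has_real_derivative_iff_has_vector_derivative of_real_minus)
        have eq: "(\<Sum>m<N. plane_generator i j \<omega> a m * plane_rotation i j \<omega> s m b) =
            (if a = i then \<omega> * plane_rotation i j \<omega> s j b
             else if a = j then - cnj \<omega> * plane_rotation i j \<omega> s i b else 0)"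
          using mvA[of \<omega> "\<lambda>m. plane_rotation i j \<omega> s m b" a] by (simp add: mat_app_def)
        show ?thesis
          unfolding eq using False ww
          by (auto simp: plane_rotation_def[abs_def] mult.assoc[symmetric]
              intro!: derivative_eq_intros has_vector_derivative_mult_right[OF c] has_vector_derivative_mult_right[OF s] c s)
      qed
      have le: "cmod (plane_rotation i j \<omega> s a b) \<le> 1" for s a b
        using w by (auto simp: plane_rotation_def norm_mult)
      show ?thesis
        unfolding D_def
        using generator_identity[OF unitary_plane_rotation[OF ij False w] _ der le H G G'_cont ij,
            where c = "cnj \<omega>" and B = B]
        using False by (auto simp: plane_rotation_def)
    qed
    have "T v = (D (plane_generator i j 1) 1 v + D (plane_generator i j \<i>) (- \<i>) v) / 2" for v
    proof -
      have 1: "mat_app N B (mat_app N (plane_generator i j \<omega>) v) i = B i i * \<omega> * v j - B i j * cnj \<omega> * v i" for \<omega>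
        unfolding mat_app_def[of N B] mvA using ij False by (subst sum_two_points[of i N j]) auto
      have 2: "(\<Sum>k<N. cnj (mat_app N (plane_generator i j \<omega>) v k) * mat_app N H v k) =
          cnj (\<omega> * v j) * mat_app N H v i - \<omega> * cnj (v i) * mat_app N H v j" for \<omega>
        unfolding mvA using ij False by (subst sum_two_points[of i N j]) auto
      show ?thesis
        unfolding T_def D_def 1 2 cmod_power2 unfolding mvA using False
        by (simp add: algebra_simps power2_eq_square)
    qed
    then have "(\<lambda>x. T (u x)) =
        (\<lambda>x. (D (plane_generator i j 1) 1 (u x) + D (plane_generator i j \<i>) (- \<i>) (u x)) / 2)" by (rule ext)
    then show ?thesis
      using *[of 1] *[of \<i>] by (simp only: integral_divide_zero) (simp add: Bochner_Integration.integral_add)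
  qed
  then show "integrable M (\<lambda>x. T (u x))" "expectation (\<lambda>x. T (u x)) = 0" by auto
qed

text \<open>Summing \<open>pair_identity\<close> over all \<open>i\<close> and \<open>j\<close>
  contracts the free index: the squared moduli of the entries of \<open>u\<close> add up to one, and
  the products of \<open>cnj (u x j)\<close> with the entries of \<open>H u\<close> add up to the
  form of \<open>H\<close>. Every term becomes a quadratic form.\<close>

lemma stein_identity:
  fixes B H :: "nat \<Rightarrow> nat \<Rightarrow> complex"
  assumes H: "hermitian_on N H"
    and G: "\<And>x. (G has_real_derivative G' x) (at x)" and G'_cont: "continuous_on UNIV G'"
  shows "expectation (\<lambda>x. (Re (\<Sum>i<N. B i i) - real N * qform N B (u x)) * G (qform N H (u x))
      + (Re (\<Sum>i<N. cnj (mat_app N H (u x) i) * mat_app N B (u x) i) - qform N B (u x) * qform N H (u x))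
        * G' (qform N H (u x))) = 0"
proof -
  define T where "T i j v = Re (B i i * of_real ((cmod (v j))\<^sup>2) - mat_app N B v i * cnj (v i)) * G (qform N H v)
      + Re (mat_app N B v i * cnj (v j) * (cnj (mat_app N H v i) * v j - cnj (v i) * mat_app N H v j)) * G' (qform N H v)" for i j v
  have T: "integrable M (\<lambda>x. T i j (u x))" "expectation (\<lambda>x. T i j (u x)) = 0" if "i < N" "j < N" for i j
    using pair_identity[OF H G G'_cont that, of B] unfolding T_def by auto
  have "(Re (\<Sum>i<N. B i i) - real N * qform N B (u x)) * G (qform N H (u x))
      + (Re (\<Sum>i<N. cnj (mat_app N H (u x) i) * mat_app N B (u x) i) - qform N B (u x) * qform N H (u x))
        * G' (qform N H (u x)) = (\<Sum>i<N. \<Sum>j<N. T i j (u x))" if x: "x \<in> space M" for x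
  proof -
    let ?v = "u x"
    have unit: "(\<Sum>j<N. complex_of_real ((cmod (?v j))\<^sup>2)) = 1"
      using arg_cong[OF unit_u[OF x], of complex_of_real] by simp
    have "(\<Sum>i<N. \<Sum>j<N. B i i * of_real ((cmod (?v j))\<^sup>2) - mat_app N B ?v i * cnj (?v i)) =
        (\<Sum>i<N. B i i * (\<Sum>j<N. of_real ((cmod (?v j))\<^sup>2)) - of_nat N * (cnj (?v i) * mat_app N B ?v i))"
      by (simp add: sum_subtractf sum_distrib_left mult.commute)
    also have "\<dots> = (\<Sum>i<N. B i i) - of_nat N * (\<Sum>i<N. cnj (?v i) * mat_app N B ?v i)"
      unfolding unit by (simp add: sum_subtractf sum_distrib_left)
    finally have "Re (\<Sum>i<N. \<Sum>j<N. B i i * of_real ((cmod (?v j))\<^sup>2) - mat_app N B ?v i * cnj (?v i)) =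
        Re ((\<Sum>i<N. B i i) - of_nat N * (\<Sum>i<N. cnj (?v i) * mat_app N B ?v i))" by (rule arg_cong)
    then have 1: "(\<Sum>i<N. \<Sum>j<N. Re (B i i * of_real ((cmod (?v j))\<^sup>2) - mat_app N B ?v i * cnj (?v i))) =
        Re (\<Sum>i<N. B i i) - real N * qform N B ?v"
      unfolding Re_sum[symmetric] qform_def by (simp del: Re_sum)
    \<comment> \<open>The form of \<open>H\<close> has to be real as a complex number: then it can
      be pulled out of the real part of the product below.\<close>
    have real: "(\<Sum>i<N. cnj (?v i) * mat_app N H ?v i) = of_real (qform N H ?v)"
    proof -
      have "z = cnj z \<Longrightarrow> z = of_real (Re z)" for z by (simp add: complex_eq_iff)
      then show ?thesis unfolding qform_def using hermitian_mat_app_swap[OF H, of ?v ?v] by blast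
    qed
    have "(\<Sum>i<N. \<Sum>j<N. mat_app N B ?v i * cnj (?v j) * (cnj (mat_app N H ?v i) * ?v j - cnj (?v i) * mat_app N H ?v j)) =
        (\<Sum>i<N. (cnj (mat_app N H ?v i) * mat_app N B ?v i) * (\<Sum>j<N. of_real ((cmod (?v j))\<^sup>2)))
        - (\<Sum>i<N. cnj (?v i) * mat_app N B ?v i) * (\<Sum>j<N. cnj (?v j) * mat_app N H ?v j)"
    proof -
      have "mat_app N B ?v i * cnj (?v j) * (cnj (mat_app N H ?v i) * ?v j - cnj (?v i) * mat_app N H ?v j) =
          (cnj (mat_app N H ?v i) * mat_app N B ?v i) * of_real ((cmod (?v j))\<^sup>2)
          - (cnj (?v i) * mat_app N B ?v i) * (cnj (?v j) * mat_app N H ?v j)" for i j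
        unfolding complex_norm_square by (simp only: algebra_simps)
      then show ?thesis by (simp only: sum_subtractf sum_product) (simp only: sum_distrib_left)
    qed
    also have "\<dots> = (\<Sum>i<N. cnj (mat_app N H ?v i) * mat_app N B ?v i)
        - (\<Sum>i<N. cnj (?v i) * mat_app N B ?v i) * of_real (qform N H ?v)"
      unfolding unit real by simp
    finally have "Re (\<Sum>i<N. \<Sum>j<N. mat_app N B ?v i * cnj (?v j) * (cnj (mat_app N H ?v i) * ?v j - cnj (?v i) * mat_app N H ?v j)) =
        Re ((\<Sum>i<N. cnj (mat_app N H ?v i) * mat_app N B ?v i)
        - (\<Sum>i<N. cnj (?v i) * mat_app N B ?v i) * of_real (qform N H ?v))" by (rule arg_cong)
    then have 2: "(\<Sum>i<N. \<Sum>j<N. Re (mat_app N B ?v i * cnj (?v j) * (cnj (mat_app N H ?v i) * ?v j - cnj (?v i) * mat_app N H ?v j))) =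
        Re (\<Sum>i<N. cnj (mat_app N H ?v i) * mat_app N B ?v i) - qform N B ?v * qform N H ?v"
      unfolding Re_sum[symmetric] qform_def[of N B] by (simp del: Re_sum)
    show ?thesis
      unfolding T_def sum.distrib sum_distrib_right[symmetric] 1 2 by simp
  qed
  then have "expectation (\<lambda>x. (Re (\<Sum>i<N. B i i) - real N * qform N B (u x)) * G (qform N H (u x))
      + (Re (\<Sum>i<N. cnj (mat_app N H (u x) i) * mat_app N B (u x) i) - qform N B (u x) * qform N H (u x))
        * G' (qform N H (u x))) = expectation (\<lambda>x. \<Sum>i<N. \<Sum>j<N. T i j (u x))"
    by (intro Bochner_Integration.integral_cong) auto
  also have "\<dots> = (\<Sum>i<N. expectation (\<lambda>x. \<Sum>j<N. T i j (u x)))"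
    by (rule Bochner_Integration.integral_sum) (auto intro!: Bochner_Integration.integrable_sum T)
  also have "\<dots> = (\<Sum>i<N. \<Sum>j<N. expectation (\<lambda>x. T i j (u x)))"
    by (intro sum.cong refl Bochner_Integration.integral_sum) (auto intro!: T)
  also have "\<dots> = 0"
    by (intro sum.neutral ballI) (auto simp: T)
  finally show ?thesis .
qed

end

section \<open>Moments of Hermitian quadratic forms\<close>

definition frob_sq :: "nat \<Rightarrow> (nat \<Rightarrow> nat \<Rightarrow> complex) \<Rightarrow> real" where
  "frob_sq N H = (\<Sum>i<N. \<Sum>j<N. (cmod (H i j))\<^sup>2)"

definition re_trace :: "nat \<Rightarrow> (nat \<Rightarrow> nat \<Rightarrow> complex) \<Rightarrow> real" where
  "re_trace N H = Re (\<Sum>i<N. H i i)"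

lemma frob_sq_nonneg: "0 \<le> frob_sq N H"
  unfolding frob_sq_def by (intro sum_nonneg) auto

lemma cmod_sum_mult_squared_le:
  "(cmod (\<Sum>i\<in>I. a i * b i))\<^sup>2 \<le> (\<Sum>i\<in>I. (cmod (a i))\<^sup>2) * (\<Sum>i\<in>I. (cmod (b i))\<^sup>2)"
proof -
  have "cmod (\<Sum>i\<in>I. a i * b i) \<le> (\<Sum>i\<in>I. cmod (a i) * cmod (b i))"
    by (rule order_trans[OF norm_sum]) (simp add: norm_mult)
  then have "(cmod (\<Sum>i\<in>I. a i * b i))\<^sup>2 \<le> (\<Sum>i\<in>I. cmod (a i) * cmod (b i))\<^sup>2"
    by (intro power_mono) auto
  also have "\<dots> \<le> (\<Sum>i\<in>I. (cmod (a i))\<^sup>2) * (\<Sum>i\<in>I. (cmod (b i))\<^sup>2)"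
    by (rule Cauchy_Schwarz_ineq_sum)
  finally show ?thesis .
qed

lemma norm_mat_app_squared_le:
  "(\<Sum>i<N. (cmod (mat_app N H v i))\<^sup>2) \<le> frob_sq N H * (\<Sum>i<N. (cmod (v i))\<^sup>2)"
  unfolding mat_app_def frob_sq_def sum_distrib_right
  by (intro sum_mono order_trans[OF cmod_sum_mult_squared_le]) (simp add: sum_distrib_right)

lemma qform_squared_le:
  "(qform N H v)\<^sup>2 \<le> (\<Sum>i<N. (cmod (v i))\<^sup>2) * (\<Sum>i<N. (cmod (mat_app N H v i))\<^sup>2)"
proof -
  have "(qform N H v)\<^sup>2 \<le> (cmod (\<Sum>i<N. cnj (v i) * mat_app N H v i))\<^sup>2"
    unfolding qform_def using abs_Re_le_cmod by (simp add: abs_le_square_iff[symmetric] del: Re_sum)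
  also have "\<dots> \<le> (\<Sum>i<N. (cmod (cnj (v i)))\<^sup>2) * (\<Sum>i<N. (cmod (mat_app N H v i))\<^sup>2)"
    by (rule cmod_sum_mult_squared_le)
  finally show ?thesis by simp
qed

lemma abs_qform_le: "\<bar>qform N H v\<bar> \<le> sqrt (frob_sq N H) * (\<Sum>i<N. (cmod (v i))\<^sup>2)"
proof -
  have "(qform N H v)\<^sup>2 \<le> (\<Sum>i<N. (cmod (v i))\<^sup>2) * (frob_sq N H * (\<Sum>i<N. (cmod (v i))\<^sup>2))"
    by (intro order_trans[OF qform_squared_le] mult_left_mono norm_mat_app_squared_le sum_nonneg) auto
  also have "\<dots> = (sqrt (frob_sq N H) * (\<Sum>i<N. (cmod (v i))\<^sup>2))\<^sup>2"
    by (simp add: power_mult_distrib frob_sq_nonneg power2_eq_square mult_ac)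
  finally have "\<bar>qform N H v\<bar> \<le> \<bar>sqrt (frob_sq N H) * (\<Sum>i<N. (cmod (v i))\<^sup>2)\<bar>"
    by (simp only: abs_le_square_iff)
  also have "\<dots> = sqrt (frob_sq N H) * (\<Sum>i<N. (cmod (v i))\<^sup>2)"
    by (intro abs_of_nonneg mult_nonneg_nonneg sum_nonneg) (auto simp: frob_sq_nonneg)
  finally show ?thesis .
qed

context unitary_invariant_vector
begin

context
  fixes H :: "nat \<Rightarrow> nat \<Rightarrow> complex"
  assumes H: "hermitian_on N H"
begin

abbreviation X where "X x \<equiv> qform N H (u x)"
text \<open>As \<open>H\<close> is Hermitian, \<open>S\<close> is the form of its square at
  \<open>u\<close>. The pair \<open>X\<close>, \<open>S\<close> closes the system of identities: the
  one for \<open>H\<close> produces \<open>S\<close>, and the one for its square bounds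
  \<open>S\<close>.\<close>

abbreviation S where "S x \<equiv> (\<Sum>i<N. (cmod (mat_app N H (u x) i))\<^sup>2)"

lemma borel_measurable_X [measurable]: "X \<in> borel_measurable M"
  by (intro borel_measurable_qform measurable_u)

lemma borel_measurable_S [measurable]: "S \<in> borel_measurable M"
proof -
  have [measurable]: "(\<lambda>x. mat_app N H (u x) i) \<in> borel_measurable M" for i
    by (intro borel_measurable_mat_app measurable_u)
  show ?thesis by measurable
qed

lemma abs_X_le: "x \<in> space M \<Longrightarrow> \<bar>X x\<bar> \<le> sqrt (frob_sq N H)"
  using abs_qform_le[of N H "u x"] unit_u by simp

lemma S_le: "x \<in> space M \<Longrightarrow> S x \<le> frob_sq N H"
  using norm_mat_app_squared_le[of N H "u x"] unit_u by simp

lemma X_squared_le: "x \<in> space M \<Longrightarrow> (X x)\<^sup>2 \<le> S x"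
  using qform_squared_le[of N H "u x"] unit_u by simp

lemma S_nonneg: "0 \<le> S x" by (intro sum_nonneg) auto

lemma stein_X:
  assumes "\<And>x. (G has_real_derivative G' x) (at x)" "continuous_on UNIV G'"
  shows "expectation (\<lambda>x. (re_trace N H - real N * X x) * G (X x) + (S x - (X x)\<^sup>2) * G' (X x)) = 0"
proof -
  have "Re (\<Sum>i<N. cnj (mat_app N H (u x) i) * mat_app N H (u x) i) = S x" for x
    by (simp add: complex_norm_square[symmetric] mult.commute[of "cnj _"] del: of_real_power flip: Re_sum of_real_sum)
  then show ?thesis
    using stein_identity[OF H assms, of H] by (simp add: re_trace_def power2_eq_square del: Re_sum)
qed

text \<open>The instance in which \<open>B\<close> is the square of \<open>H\<close>: its trace is
  \<open>frob_sq N H\<close>, its form at \<open>u\<close> is \<open>S\<close>, and the mixed term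
  is the form of \<open>H\<close> at the vector \<open>H u\<close>.\<close>

lemma stein_S:
  assumes "\<And>x. (G has_real_derivative G' x) (at x)" "continuous_on UNIV G'"
  shows "expectation (\<lambda>x. (frob_sq N H - real N * S x) * G (X x)
    + (qform N H (mat_app N H (u x)) - S x * X x) * G' (X x)) = 0"
proof -
  define B where "B i k = (\<Sum>m<N. H i m * H m k)" for i k
  have mvB: "mat_app N B v i = mat_app N H (mat_app N H v) i" for v i
    unfolding mat_app_def B_def sum_distrib_left sum_distrib_right by (subst sum.swap) (simp add: mult_ac)
  have norm_sq: "Re (\<Sum>i<N. cnj (w i) * w i) = (\<Sum>i<N. (cmod (w i))\<^sup>2)" for w
    by (simp add: complex_norm_square[symmetric] mult.commute[of "cnj _"] del: of_real_power flip: Re_sum of_real_sum)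
  have "qform N B v = (\<Sum>i<N. (cmod (mat_app N H v i))\<^sup>2)" for v
    unfolding qform_def mvB using arg_cong[OF hermitian_mat_app_swap[OF H, of v "mat_app N H v"], of Re]
    by (simp only: norm_sq cnj.sel)
  moreover have "Re (\<Sum>i<N. B i i) = frob_sq N H"
  proof -
    have "B i i = of_real (\<Sum>m<N. (cmod (H i m))\<^sup>2)" if "i < N" for i
    proof -
      have "H i m * H m i = of_real ((cmod (H i m))\<^sup>2)" if "m < N" for m
      proof -
        have "H m i = cnj (H i m)" using H \<open>i < N\<close> that unfolding hermitian_on_def by blast
        then show ?thesis by (simp only: complex_norm_square)
      qed
      then show ?thesis unfolding B_def of_real_sum by (intro sum.cong) auto
    qed
    then show ?thesis by (simp add: frob_sq_def)
  qed
  moreover have "Re (\<Sum>i<N. cnj (mat_app N H (u x) i) * mat_app N B (u x) i) = qform N H (mat_app N H (u x))" for x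
    unfolding mvB qform_def ..
  ultimately show ?thesis
    using stein_identity[OF H assms, of B] by (simp del: Re_sum)
qed

lemma integrable_bounded: "f \<in> borel_measurable M \<Longrightarrow> (\<And>x. x \<in> space M \<Longrightarrow> \<bar>f x\<bar> \<le> C) \<Longrightarrow> integrable M f"
  for f :: "'a \<Rightarrow> real"
  by (rule integrable_const_bound[of f C]) auto

lemma exp_X_le: "x \<in> space M \<Longrightarrow> exp (t * X x) \<le> exp (\<bar>t\<bar> * sqrt (frob_sq N H))"
proof -
  assume "x \<in> space M"
  then have "\<bar>t\<bar> * \<bar>X x\<bar> \<le> \<bar>t\<bar> * sqrt (frob_sq N H)" by (intro mult_left_mono abs_X_le) auto
  then have "\<bar>t * X x\<bar> \<le> \<bar>t\<bar> * sqrt (frob_sq N H)" by (simp only: abs_mult)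
  then show ?thesis by simp
qed

lemma integrable_exp_X [intro]:
  shows "integrable M (\<lambda>x. exp (t * X x))" "integrable M (\<lambda>x. X x * exp (t * X x))"
    "integrable M (\<lambda>x. S x * exp (t * X x))" "integrable M (\<lambda>x. (X x)\<^sup>2 * exp (t * X x))"
    "integrable M (\<lambda>x. qform N H (mat_app N H (u x)) * exp (t * X x))" "integrable M (\<lambda>x. S x * X x * exp (t * X x))"
proof -
  let ?f = "sqrt (frob_sq N H)" let ?E = "exp (\<bar>t\<bar> * ?f)"
  have [measurable]: "(\<lambda>x. qform N H (mat_app N H (u x))) \<in> borel_measurable M"
    by (intro borel_measurable_qform borel_measurable_mat_app measurable_u)
  show "integrable M (\<lambda>x. exp (t * X x))"
    by (rule integrable_bounded[of _ ?E]) (use exp_X_le[of _ t] in auto)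
  have bound: "integrable M (\<lambda>x. f x * exp (t * X x))"
    if [measurable]: "f \<in> borel_measurable M" and C: "\<And>x. x \<in> space M \<Longrightarrow> \<bar>f x\<bar> \<le> C" for f C
  proof (rule integrable_bounded[of _ "C * ?E"])
    fix x assume x: "x \<in> space M"
    show "\<bar>f x * exp (t * X x)\<bar> \<le> C * ?E"
      using C[OF x] exp_X_le[OF x, of t] by (simp add: abs_mult mult_mono')
  qed measurable
  have S: "\<bar>S x\<bar> \<le> frob_sq N H" if "x \<in> space M" for x using S_le[OF that] S_nonneg by simp
  show "integrable M (\<lambda>x. X x * exp (t * X x))" by (rule bound[OF _ abs_X_le]) auto
  show "integrable M (\<lambda>x. S x * exp (t * X x))" by (rule bound[OF _ S]) auto
  show "integrable M (\<lambda>x. (X x)\<^sup>2 * exp (t * X x))"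
  proof (rule bound)
    show "\<bar>(X x)\<^sup>2\<bar> \<le> frob_sq N H" if "x \<in> space M" for x
      using X_squared_le[OF that] S_le[OF that] by simp
  qed measurable
  show "integrable M (\<lambda>x. S x * X x * exp (t * X x))"
  proof (rule bound)
    show "\<bar>S x * X x\<bar> \<le> frob_sq N H * ?f" if "x \<in> space M" for x
      using S[OF that] abs_X_le[OF that] by (simp add: abs_mult mult_mono' del: abs_sum_abs)
  qed measurable
  show "integrable M (\<lambda>x. qform N H (mat_app N H (u x)) * exp (t * X x))"
  proof (rule bound)
    show "\<bar>qform N H (mat_app N H (u x))\<bar> \<le> ?f * frob_sq N H" if "x \<in> space M" for x
      by (rule order_trans[OF abs_qform_le mult_left_mono[OF S_le[OF that]]]) (simp add: frob_sq_nonneg)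
  qed measurable
qed

text \<open>Take \<open>G\<close> to be \<open>exp (t * x)\<close>. Dropping the negative term with
  the square of \<open>X\<close> from \<open>stein_X\<close> leaves the exponentially weighted mean
  of \<open>S\<close>, which \<open>stein_S\<close> controls: its two cubic terms are each at most
  \<open>sqrt (frob_sq N H)\<close> times \<open>S\<close>, small enough to be absorbed when
  \<open>t\<close> is restricted.\<close>

lemma expectation_X_exp_le:
  assumes "0 \<le> t" "4 * t * sqrt (frob_sq N H) \<le> real N" "0 < N"
  shows "expectation (\<lambda>x. X x * exp (t * X x)) \<le>
    (re_trace N H / real N + 2 * t * frob_sq N H / (real N)\<^sup>2) * expectation (\<lambda>x. exp (t * X x))"
proof -
  let ?f = "sqrt (frob_sq N H)"
  define \<phi> where "\<phi> = expectation (\<lambda>x. exp (t * X x))"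
  define s where "s = expectation (\<lambda>x. S x * exp (t * X x))"
  have G: "((\<lambda>x. exp (t * x)) has_real_derivative t * exp (t * x)) (at x)" for x
    by (auto intro!: derivative_eq_intros)
  have G': "continuous_on UNIV (\<lambda>x. t * exp (t * x))" by (intro continuous_intros)
  note I = integrable_exp_X[of t]
  have 1: "real N * expectation (\<lambda>x. X x * exp (t * X x)) =
      re_trace N H * \<phi> + t * s - t * expectation (\<lambda>x. (X x)\<^sup>2 * exp (t * X x))"
  proof -
    have "0 = expectation (\<lambda>x. re_trace N H * exp (t * X x) - real N * (X x * exp (t * X x))
        + t * (S x * exp (t * X x)) - t * ((X x)\<^sup>2 * exp (t * X x)))"
      using stein_X[OF G G'] by (simp add: algebra_simps)
    also have "\<dots> = re_trace N H * \<phi> - real N * expectation (\<lambda>x. X x * exp (t * X x))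
        + t * s - t * expectation (\<lambda>x. (X x)\<^sup>2 * exp (t * X x))"
      unfolding \<phi>_def s_def using I by simp
    finally show ?thesis by simp
  qed
  have 2: "real N * s = frob_sq N H * \<phi> + t * expectation (\<lambda>x. qform N H (mat_app N H (u x)) * exp (t * X x))
      - t * expectation (\<lambda>x. S x * X x * exp (t * X x))"
  proof -
    have "0 = expectation (\<lambda>x. frob_sq N H * exp (t * X x) - real N * (S x * exp (t * X x))
        + t * (qform N H (mat_app N H (u x)) * exp (t * X x)) - t * (S x * X x * exp (t * X x)))"
      using stein_S[OF G G'] by (simp add: algebra_simps)
    also have "\<dots> = frob_sq N H * \<phi> - real N * s
        + t * expectation (\<lambda>x. qform N H (mat_app N H (u x)) * exp (t * X x))
        - t * expectation (\<lambda>x. S x * X x * exp (t * X x))"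
      unfolding \<phi>_def s_def using I by simp
    finally show ?thesis by simp
  qed
  have 3: "expectation (\<lambda>x. qform N H (mat_app N H (u x)) * exp (t * X x)) \<le> ?f * s"
  proof -
    have "expectation (\<lambda>x. qform N H (mat_app N H (u x)) * exp (t * X x)) \<le> expectation (\<lambda>x. ?f * (S x * exp (t * X x)))"
    proof (rule integral_mono)
      fix x assume "x \<in> space M"
      have "qform N H (mat_app N H (u x)) \<le> ?f * S x"
        using abs_qform_le[of N H "mat_app N H (u x)"] by linarith
      then show "qform N H (mat_app N H (u x)) * exp (t * X x) \<le> ?f * (S x * exp (t * X x))"
        by (metis exp_ge_zero mult.assoc mult_right_mono)
    qed (use I in auto)
    then show ?thesis by (simp add: s_def)
  qed
  have 4: "- expectation (\<lambda>x. S x * X x * exp (t * X x)) \<le> ?f * s"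
  proof -
    have "expectation (\<lambda>x. - (S x * X x * exp (t * X x))) \<le> expectation (\<lambda>x. ?f * (S x * exp (t * X x)))"
    proof (rule integral_mono)
      fix x assume x: "x \<in> space M"
      have "- X x \<le> ?f" using abs_X_le[OF x] by linarith
      then have "- X x * (S x * exp (t * X x)) \<le> ?f * (S x * exp (t * X x))"
        by (intro mult_right_mono mult_nonneg_nonneg S_nonneg) auto
      then show "- (S x * X x * exp (t * X x)) \<le> ?f * (S x * exp (t * X x))"
        by (simp only: mult_ac mult_minus_left mult_minus_right)
    qed (use I in auto)
    then show ?thesis by (simp add: s_def)
  qed
  have s0: "0 \<le> s" unfolding s_def by (intro integral_nonneg_AE AE_I2 mult_nonneg_nonneg S_nonneg) auto
  have "real N * s \<le> frob_sq N H * \<phi> + t * (?f * s) + t * (?f * s)"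
    using 2 mult_left_mono[OF 3 assms(1)] mult_left_mono[OF 4 assms(1)]
    by (simp only: mult_minus_right)
  \<comment> \<open>The factor 4 in the restriction on \<open>t\<close> makes both cubic terms
    together at most half of the left side.\<close>
  moreover have "t * (?f * s) + t * (?f * s) \<le> real N * s / 2"
    using mult_right_mono[OF assms(2) s0] by (simp add: algebra_simps)
  ultimately have "real N * s \<le> 2 * frob_sq N H * \<phi>" by linarith
  then have 5: "s \<le> 2 * frob_sq N H * \<phi> / real N" using assms(3) by (simp add: field_simps)
  have "0 \<le> expectation (\<lambda>x. (X x)\<^sup>2 * exp (t * X x))"
    by (intro integral_nonneg_AE AE_I2) auto
  then have "real N * expectation (\<lambda>x. X x * exp (t * X x)) \<le> re_trace N H * \<phi> + t * s"
    using 1 assms(1) by simp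
  also have "\<dots> \<le> re_trace N H * \<phi> + t * (2 * frob_sq N H * \<phi> / real N)"
    using mult_left_mono[OF 5 assms(1)] by simp
  finally show ?thesis
    unfolding \<phi>_def[symmetric] using assms(3) by (simp add: field_simps power2_eq_square)
qed

text \<open>Gronwall's argument: by \<open>expectation_X_exp_le\<close> the moment generating
  function times the exponential of minus the claimed exponent is nonincreasing, and it starts at
  one.\<close>

lemma expectation_exp_X_le:
  assumes "0 \<le> t" "4 * t * sqrt (frob_sq N H) \<le> real N" "0 < N"
  shows "expectation (\<lambda>x. exp (t * X x)) \<le> exp (t * re_trace N H / real N + t\<^sup>2 * frob_sq N H / (real N)\<^sup>2)"
proof -
  let ?f = "sqrt (frob_sq N H)"
  define \<phi> where "\<phi> t = expectation (\<lambda>x. exp (t * X x))" for t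
  define g where "g t = t * re_trace N H / real N + t\<^sup>2 * frob_sq N H / (real N)\<^sup>2" for t
  have \<phi>': "(\<phi> has_real_derivative expectation (\<lambda>x. X x * exp (s * X x))) (at s)" for s
    unfolding \<phi>_def
  proof (rule has_real_derivative_expectation[where C = "?f * exp ((\<bar>s\<bar> + 1) * ?f)"])
    show "((\<lambda>s. exp (s * X x)) has_real_derivative X x * exp (r * X x)) (at r)" for r x
      by (auto intro!: derivative_eq_intros)
    show "norm (X x * exp (r * X x)) \<le> ?f * exp ((\<bar>s\<bar> + 1) * ?f)"
      if "x \<in> space M" "\<bar>r - s\<bar> \<le> 1" for r x
    proof -
      have "\<bar>r\<bar> * ?f \<le> (\<bar>s\<bar> + 1) * ?f" using that(2) by (intro mult_right_mono) (auto simp: frob_sq_nonneg)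
      then have "exp (r * X x) \<le> exp ((\<bar>s\<bar> + 1) * ?f)"
        using exp_X_le[OF that(1), of r] by (meson exp_le_cancel_iff order_trans)
      then show ?thesis using abs_X_le[OF that(1)] by (simp add: abs_mult mult_mono')
    qed
  qed (auto intro: integrable_exp_X)
  have g': "(g has_real_derivative (re_trace N H / real N + 2 * s * frob_sq N H / (real N)\<^sup>2)) (at s)" for s
    unfolding g_def using assms(3) by (auto intro!: derivative_eq_intros simp: field_simps)
  have "\<phi> t * exp (- g t) \<le> \<phi> 0 * exp (- g 0)"
  proof (rule DERIV_nonpos_imp_nonincreasing[OF assms(1)])
    fix s assume s: "0 \<le> s" "s \<le> t"
    let ?d = "re_trace N H / real N + 2 * s * frob_sq N H / (real N)\<^sup>2"
    have "4 * s * ?f \<le> 4 * t * ?f" using s by (intro mult_right_mono) (auto simp: frob_sq_nonneg)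
    then have "expectation (\<lambda>x. X x * exp (s * X x)) \<le> ?d * \<phi> s"
      unfolding \<phi>_def using s assms by (intro expectation_X_exp_le) auto
    then have "(expectation (\<lambda>x. X x * exp (s * X x)) - ?d * \<phi> s) * exp (- g s) \<le> 0"
      by (intro mult_nonpos_nonneg) auto
    moreover have "((\<lambda>s. \<phi> s * exp (- g s)) has_real_derivative
        (expectation (\<lambda>x. X x * exp (s * X x)) - ?d * \<phi> s) * exp (- g s)) (at s)"
      by (auto intro!: derivative_eq_intros \<phi>' g' simp: algebra_simps)
    ultimately show "\<exists>y. ((\<lambda>s. \<phi> s * exp (- g s)) has_real_derivative y) (at s) \<and> y \<le> 0" by blast
  qed
  then have "\<phi> t * exp (- g t) \<le> 1" by (simp add: \<phi>_def g_def prob_space)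
  then show ?thesis unfolding \<phi>_def g_def exp_minus by (simp add: field_simps)
qed

text \<open>The choice \<open>G x = x\<close> expresses the second moment of \<open>X\<close> by the
  means of \<open>X\<close> and \<open>S\<close>; the constant choice \<open>G x = 1\<close>
  evaluates both means.\<close>

lemma second_moment: "real N * (real N + 1) * expectation (\<lambda>x. (X x)\<^sup>2) = (re_trace N H)\<^sup>2 + frob_sq N H"
proof -
  have I: "integrable M X" "integrable M (\<lambda>x. (X x)\<^sup>2)" "integrable M S"
    using integrable_exp_X[of 0] by simp_all
  have d1: "((\<lambda>x::real. x) has_real_derivative 1) (at x)" "((\<lambda>x::real. 1) has_real_derivative 0) (at x)" for x by auto
  have c: "continuous_on UNIV (\<lambda>x::real. 1::real)" "continuous_on UNIV (\<lambda>x::real. 0::real)" by auto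
  have "0 = expectation (\<lambda>x. re_trace N H * X x + S x - (real N + 1) * (X x)\<^sup>2)"
    using stein_X[OF d1(1) c(1)] by (simp add: algebra_simps power2_eq_square)
  then have 1: "0 = re_trace N H * expectation X + expectation S - (real N + 1) * expectation (\<lambda>x. (X x)\<^sup>2)"
    using I by simp
  have 2: "real N * expectation X = re_trace N H"
    using stein_X[OF d1(2) c(2)] I by (simp add: prob_space)
  have 3: "real N * expectation S = frob_sq N H"
    using stein_S[OF d1(2) c(2)] I by (simp add: prob_space)
  have "real N * ((real N + 1) * expectation (\<lambda>x. (X x)\<^sup>2)) = re_trace N H * (real N * expectation X) + real N * expectation S"
    using 1 by (simp add: algebra_simps)
  then show ?thesis unfolding 2 3 by (simp add: power2_eq_square mult.assoc)
qed

end

text \<open>The value \<open>t = N / (4 * \<kappa>)\<close> satisfies the restriction of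
  \<open>expectation_exp_X_le\<close> because \<kappa> dominates the Frobenius norm, and it makes
  the exponent at most \<open>1 / 4 + 1 / 16\<close>. The absolute value costs a second application,
  to \<open>- H\<close>.\<close>

lemma expectation_exp_abs_le:
  assumes H: "hermitian_on N H" and N: "0 < N"
    and \<kappa>: "0 < \<kappa>" "frob_sq N H \<le> \<kappa>\<^sup>2" "\<bar>re_trace N H\<bar> \<le> \<kappa>"
  shows "integrable M (\<lambda>x. exp (real N * \<bar>qform N H (u x)\<bar> / (4 * \<kappa>)))"
    and "expectation (\<lambda>x. exp (real N * \<bar>qform N H (u x)\<bar> / (4 * \<kappa>))) \<le> 3"
proof -
  let ?t = "real N / (4 * \<kappa>)"
  define H' where "H' i j = - H i j" for i j
  have H': "hermitian_on N H'"
    unfolding hermitian_on_def H'_def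
  proof (intro allI impI)
    fix i j assume "i < N" "j < N"
    then have "H j i = cnj (H i j)" using H unfolding hermitian_on_def by blast
    then show "- H j i = cnj (- H i j)" by simp
  qed
  have mat_app_neg: "mat_app N H' v i = - mat_app N H v i" for v i by (simp add: H'_def mat_app_def sum_negf)
  have neg: "qform N H' v = - qform N H v" "frob_sq N H' = frob_sq N H" "re_trace N H' = - re_trace N H" for v
    unfolding qform_def mat_app_neg frob_sq_def re_trace_def H'_def
    by (simp_all only: mult_minus_right sum_negf uminus_complex.sel norm_minus_cancel)
  have bound: "integrable M (\<lambda>x. exp (?t * qform N K (u x))) \<and> expectation (\<lambda>x. exp (?t * qform N K (u x))) \<le> 3/2"
    if K: "hermitian_on N K" and K1: "frob_sq N K \<le> \<kappa>\<^sup>2" and K2: "\<bar>re_trace N K\<bar> \<le> \<kappa>" for K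
  proof
    show "integrable M (\<lambda>x. exp (?t * qform N K (u x)))" by (rule integrable_exp_X[OF K])
    have "sqrt (frob_sq N K) \<le> \<kappa>" using K1 \<kappa>(1) by (intro real_le_lsqrt) auto
    then have "expectation (\<lambda>x. exp (?t * qform N K (u x))) \<le> exp (?t * re_trace N K / real N + ?t\<^sup>2 * frob_sq N K / (real N)\<^sup>2)"
      using \<kappa> N by (intro expectation_exp_X_le[OF K]) (auto simp: field_simps)
    also have "?t * re_trace N K / real N \<le> 1/4" using K2 \<kappa> N by (simp add: field_simps)
    also have "?t\<^sup>2 * frob_sq N K / (real N)\<^sup>2 \<le> 1/16" using K1 \<kappa> N by (simp add: field_simps power2_eq_square)
    also have "exp (1/4 + 1/16 :: real) \<le> 3/2"
      using exp_bound[of "5/16"] by (simp add: power2_eq_square)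
    finally show "expectation (\<lambda>x. exp (?t * qform N K (u x))) \<le> 3/2" by simp
  qed
  note b1 = bound[OF H \<kappa>(2,3)]
  have b2: "integrable M (\<lambda>x. exp (- (?t * qform N H (u x)))) \<and> expectation (\<lambda>x. exp (- (?t * qform N H (u x)))) \<le> 3/2"
    using bound[OF H'] \<kappa> by (simp add: neg)
  have m: "(\<lambda>x. qform N H (u x)) \<in> borel_measurable M" by (intro borel_measurable_qform measurable_u)
  have le: "exp (real N * \<bar>y\<bar> / (4 * \<kappa>)) \<le> exp (?t * y) + exp (- (?t * y))" for y
    by (cases "0 \<le> y") (auto simp: abs_if)
  show i: "integrable M (\<lambda>x. exp (real N * \<bar>qform N H (u x)\<bar> / (4 * \<kappa>)))"
    using b1 b2 m le by (intro Bochner_Integration.integrable_bound[OF Bochner_Integration.integrable_add[OF conjunct1[OF b1] conjunct1[OF b2]]]) auto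
  have "expectation (\<lambda>x. exp (real N * \<bar>qform N H (u x)\<bar> / (4 * \<kappa>))) \<le>
      expectation (\<lambda>x. exp (?t * qform N H (u x)) + exp (- (?t * qform N H (u x))))"
    using i b1 b2 le by (intro integral_mono) auto
  then show "expectation (\<lambda>x. exp (real N * \<bar>qform N H (u x)\<bar> / (4 * \<kappa>))) \<le> 3"
    using b1 b2 by simp
qed

text \<open>The scale \<open>sqrt (1 + (re_trace N H)\<^sup>2)\<close> is the one of the exact
  second moment, so \<open>z\<close> has second moment between \<open>1 / 32\<close> and
  \<open>1 / 16\<close> whatever the trace is. The fourth moment, available from the exponential
  one, then excludes that this mass sits in rare large values.\<close>

lemma expectation_abs_qform_bounds:
  assumes H: "hermitian_on N H" and N: "0 < N" and fro: "frob_sq N H = 1"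
  defines "z \<equiv> \<lambda>x. real N * \<bar>qform N H (u x)\<bar> / (4 * sqrt (1 + (re_trace N H)\<^sup>2))"
  shows "integrable M z" "integrable M (\<lambda>x. (z x)\<^sup>2)" "1 / 16384 \<le> expectation z" "expectation (\<lambda>x. (z x)\<^sup>2) \<le> 1"
proof -
  let ?\<sigma> = "sqrt (1 + (re_trace N H)\<^sup>2)"
  have \<sigma>: "0 < ?\<sigma>" "?\<sigma>\<^sup>2 = 1 + (re_trace N H)\<^sup>2" "\<bar>re_trace N H\<bar> \<le> ?\<sigma>"
    by (auto simp: add_pos_nonneg intro: real_le_rsqrt)
  have fro_le: "frob_sq N H \<le> ?\<sigma>\<^sup>2" unfolding \<sigma>(2) fro by simp
  have E: "integrable M (\<lambda>x. exp (z x))" "expectation (\<lambda>x. exp (z x)) \<le> 3"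
    unfolding z_def by (rule expectation_exp_abs_le[OF H N \<sigma>(1) fro_le \<sigma>(3)])+
  have z0: "0 \<le> z x" for x using \<sigma>(1) by (simp add: z_def)
  have [measurable]: "z \<in> borel_measurable M"
    unfolding z_def using borel_measurable_X[OF H] by measurable
  have z4: "(z x) ^ 4 \<le> 256 * exp (z x)" for x
  proof -
    have "(1 + z x / real 4) ^ 4 \<le> exp (z x)"
      using z0[of x] by (intro exp_ge_one_plus_x_over_n_power_n) auto
    moreover have "(z x / 4) ^ 4 \<le> (1 + z x / 4) ^ 4" using z0[of x] by (intro power_mono) auto
    ultimately show ?thesis by (simp add: power_divide)
  qed
  have z_le: "z x \<le> exp (z x)" for x using exp_ge_add_one_self[of "z x"] by linarith
  have z2_le: "(z x)\<^sup>2 \<le> 2 * exp (z x)" for x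
    using exp_lower_Taylor_quadratic[OF z0[of x]] z0[of x] by simp
  show I1: "integrable M z"
    using z_le z0 by (intro Bochner_Integration.integrable_bound[OF E(1)]) auto
  show I2: "integrable M (\<lambda>x. (z x)\<^sup>2)"
    using z2_le z0 by (intro Bochner_Integration.integrable_bound[OF integrable_mult_right[OF E(1), of 2]]) auto
  have I4: "integrable M (\<lambda>x. (z x) ^ 4)"
    using z4 z0 by (intro Bochner_Integration.integrable_bound[OF integrable_mult_right[OF E(1), of 256]]) auto
  have "expectation (\<lambda>x. (z x) ^ 4) \<le> expectation (\<lambda>x. 256 * exp (z x))"
    using I4 E(1) z4 by (intro integral_mono) auto
  then have E4: "expectation (\<lambda>x. (z x) ^ 4) \<le> 768" using E(2) by simp
  have "expectation (\<lambda>x. (z x)\<^sup>2) = (real N)\<^sup>2 / (16 * ?\<sigma>\<^sup>2) * expectation (\<lambda>x. (qform N H (u x))\<^sup>2)"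
    unfolding z_def by (simp add: power_divide power_mult_distrib)
  also have "expectation (\<lambda>x. (qform N H (u x))\<^sup>2) = ?\<sigma>\<^sup>2 / (real N * (real N + 1))"
    using second_moment[OF H] N unfolding fro \<sigma>(2) by (subst eq_divide_eq) (auto simp: mult_ac add.commute)
  also have "(real N)\<^sup>2 / (16 * ?\<sigma>\<^sup>2) * (?\<sigma>\<^sup>2 / (real N * (real N + 1))) = real N / (16 * (real N + 1))"
  proof -
    have key: "(real N)\<^sup>2 / (16 * s) * (s / (real N * (real N + 1))) = real N / (16 * (real N + 1))" if "s \<noteq> 0" for s
      using N that by (simp add: divide_simps power2_eq_square)
    show ?thesis by (rule key) (use \<sigma>(1) in simp)
  qed
  finally have E2: "expectation (\<lambda>x. (z x)\<^sup>2) = real N / (16 * (real N + 1))" .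
  show "expectation (\<lambda>x. (z x)\<^sup>2) \<le> 1" unfolding E2 by (simp add: field_simps)
  have E2': "1/32 \<le> expectation (\<lambda>x. (z x)\<^sup>2)" unfolding E2 using N by (simp add: field_simps)
  \<comment> \<open>The fourth moment turns the second moment into a first moment: \<open>y \<ge> y\<^sup>2 - y\<^sup>4\<close> for \<open>y = z / 256\<close>.\<close>
  have "(z x)\<^sup>2 / 256 - (z x) ^ 4 / 256 ^ 3 \<le> z x" for x
  proof -
    define y where "y = z x / 256"
    have y: "0 \<le> y" using z0[of x] by (simp add: y_def)
    have "y\<^sup>2 - y ^ 4 \<le> y"
    proof (cases "y \<le> 1")
      case True
      then have "y\<^sup>2 \<le> y" using y by (simp add: power2_eq_square mult_left_le)
      moreover have "0 \<le> y ^ 4" by simp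
      ultimately show ?thesis by linarith
    next
      case False
      then have "y\<^sup>2 \<le> y ^ 4" by (intro power_increasing) auto
      then show ?thesis using y by linarith
    qed
    then show ?thesis by (simp add: y_def power_divide field_simps)
  qed
  then have "expectation (\<lambda>x. (z x)\<^sup>2 / 256 - (z x) ^ 4 / 256 ^ 3) \<le> expectation z"
    using I1 I2 I4 by (intro integral_mono) auto
  moreover have "expectation (\<lambda>x. (z x)\<^sup>2 / 256 - (z x) ^ 4 / 256 ^ 3) =
      expectation (\<lambda>x. (z x)\<^sup>2) / 256 - expectation (\<lambda>x. (z x) ^ 4) / 256 ^ 3"
    using I2 I4 by simp
  \<comment> \<open>Numerically \<open>8 / 65536 - 3 / 65536\<close>, which exceeds
    \<open>4 / 65536 = 1 / 16384\<close>.\<close>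
  moreover have "\<dots> \<ge> 1/32/256 - 768/256^3" using E2' E4 by (intro diff_mono divide_right_mono) auto
  ultimately show "1 / 16384 \<le> expectation z" by simp
qed

end

section \<open>Tail bounds for Haar columns\<close>

lemma (in prob_space) product_chernoff:
  fixes f :: "'a \<Rightarrow> real"
  assumes int: "integrable M (\<lambda>x. exp (f x))" and le: "expectation (\<lambda>x. exp (f x)) \<le> B"
    and [measurable]: "f \<in> borel_measurable M"
  shows "measure (\<Pi>\<^sub>M i\<in>{..<Q}. M) {\<Phi> \<in> space (\<Pi>\<^sub>M i\<in>{..<Q}. M). real Q * s \<le> (\<Sum>i<Q. f (\<Phi> i))}
    \<le> (B * exp (- s)) ^ Q"
proof -
  let ?P = "\<Pi>\<^sub>M i\<in>{..<Q}. M"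
  interpret product_sigma_finite "\<lambda>_::nat. M" by unfold_locales
  let ?g = "\<lambda>\<Phi>. \<Prod>i<Q. exp (f (\<Phi> i))"
  have g: "?g \<Phi> = exp (\<Sum>i<Q. f (\<Phi> i))" for \<Phi> by (simp add: exp_sum)
  have "measure ?P {\<Phi> \<in> space ?P. exp (real Q * s) \<le> ?g \<Phi>} \<le> (\<integral>\<Phi>. ?g \<Phi> \<partial>?P) / exp (real Q * s)"
    by (rule integral_Markov_inequality_measure[where A = "{}"])
      (auto intro!: product_integrable_prod int prod_nonneg)
  also have "(\<integral>\<Phi>. ?g \<Phi> \<partial>?P) = (expectation (\<lambda>x. exp (f x))) ^ Q"
    by (subst product_integral_prod) (auto simp: int)
  also have "\<dots> \<le> B ^ Q" by (intro power_mono le integral_nonneg_AE) auto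
  also have "B ^ Q / exp (real Q * s) = (B * exp (- s)) ^ Q"
    by (simp add: power_mult_distrib exp_minus exp_of_nat_mult[symmetric] field_simps)
  finally show ?thesis by (simp add: g divide_right_mono)
qed

text \<open>The product of this quadratic with \<open>1 + x + x\<^sup>2 / 2\<close>, a lower bound
  of \<open>exp x\<close>, is \<open>1 + x ^ 4 / 4\<close> and so at least one.\<close>

lemma exp_minus_le_quadratic:
  fixes x :: real assumes "0 \<le> x" shows "exp (- x) \<le> 1 - x + x\<^sup>2 / 2"
proof -
  let ?p = "1 + x + x\<^sup>2 / 2" and ?m = "1 - x + x\<^sup>2 / 2"
  have p: "0 < ?p" using assms by (simp add: add_pos_nonneg)
  have "?m * ?p = 1 + (x\<^sup>2)\<^sup>2 / 4" by (simp add: power2_eq_square field_simps)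
  then have "1 \<le> ?m * ?p" by simp
  then have "1 / ?p \<le> ?m" using p by (simp add: divide_le_eq)
  moreover have "exp (- x) \<le> 1 / ?p"
    using exp_lower_Taylor_quadratic[OF assms] p by (simp add: exp_minus inverse_eq_divide frac_le)
  ultimately show ?thesis by linarith
qed

lemma exp_mean_le_mean_exp:
  fixes z :: "nat \<Rightarrow> real" assumes "0 < K"
  shows "exp ((\<Sum>k<K. z k) / real K) \<le> (\<Sum>k<K. exp (z k)) / real K"
proof -
  have "exp (\<Sum>k<K. (1 / real K) *\<^sub>R z k) \<le> (\<Sum>k<K. (1 / real K) * exp (z k))"
    by (rule convex_on_sum[OF _ _ exp_convex]) (use assms in auto)
  then show ?thesis by (simp add: sum_divide_distrib)
qed

lemma mean_squared_le:
  fixes z :: "nat \<Rightarrow> real" assumes "0 < K"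
  shows "((\<Sum>k<K. z k) / real K)\<^sup>2 \<le> (\<Sum>k<K. (z k)\<^sup>2) / real K"
proof -
  have "(\<Sum>k<K. 1 * z k)\<^sup>2 \<le> (\<Sum>k<K. 1\<^sup>2) * (\<Sum>k<K. (z k)\<^sup>2)" by (rule Cauchy_Schwarz_ineq_sum)
  then show ?thesis using assms by (simp add: power_divide divide_simps power2_eq_square mult.commute)
qed

section \<open>Columns of Haar unitary matrices\<close>

definition col_fun :: "nat \<Rightarrow> complex mat \<Rightarrow> nat \<Rightarrow> complex" where
  "col_fun k U p = U $$ (p, k)"

lemma unitary_group_norm:
  assumes U: "U \<in> unitary_group N" and k: "k < N"
  shows "(\<Sum>p<N. (cmod (U $$ (p, k)))\<^sup>2) = 1"
proof -
  have Uc: "U \<in> carrier_mat N N" and "mat_adjoint U * U = 1\<^sub>m N" using U by (auto simp: unitary_group_def)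
  then have "(mat_adjoint U * U) $$ (k, k) = 1" using k by simp
  moreover have "(mat_adjoint U * U) $$ (k, k) = (\<Sum>p<N. cnj (U $$ (p, k)) * U $$ (p, k))"
    using Uc k by (simp add: mat_adjoint_def mat_of_rows_def scalar_prod_def lessThan_atLeast0)
  ultimately have "(\<Sum>p<N. complex_of_real ((cmod (U $$ (p, k)))\<^sup>2)) = 1"
    by (simp only: complex_norm_square mult.commute)
  then show ?thesis by (metis of_real_eq_1_iff of_real_sum)
qed

lemma unitary_on_imp_unitary_group:
  assumes "unitary_on N V" shows "mat N N (\<lambda>(a, b). V a b) \<in> unitary_group N"
proof -
  let ?V = "mat N N (\<lambda>(a, b). V a b)"
  have ad: "mat_adjoint ?V \<in> carrier_mat N N" by (auto simp: mat_adjoint_def)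
  have "mat_adjoint ?V * ?V = 1\<^sub>m N"
  proof (rule eq_matI)
    fix a b assume "a < dim_row (1\<^sub>m N :: complex mat)" "b < dim_col (1\<^sub>m N :: complex mat)"
    then have ab: "a < N" "b < N" by auto
    then have "(mat_adjoint ?V * ?V) $$ (a, b) = (\<Sum>k<N. cnj (V k a) * V k b)"
      by (simp add: mat_adjoint_def mat_of_rows_def scalar_prod_def lessThan_atLeast0)
    then show "(mat_adjoint ?V * ?V) $$ (a, b) = 1\<^sub>m N $$ (a, b)"
      using assms ab by (simp add: unitary_on_def)
  qed (auto simp: mat_adjoint_def)
  moreover from this have "?V * mat_adjoint ?V = 1\<^sub>m N"
    by (intro mat_mult_left_right_inverse[OF ad]) auto
  ultimately show ?thesis by (simp add: unitary_group_def)
qed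

lemma space_unitary_borel: "space (unitary_borel N) = unitary_group N"
  by (simp add: unitary_borel_def)

lemma measurable_entry_unitary_borel:
  assumes "p < N" "q < N" shows "(\<lambda>U. U $$ (p, q)) \<in> borel_measurable (unitary_borel N)"
proof -
  have "(\<lambda>U. \<lambda>pq\<in>{..<N} \<times> {..<N}. U $$ pq) \<in> measurable (unitary_borel N) (\<Pi>\<^sub>M pq\<in>{..<N} \<times> {..<N}. borel)"
    unfolding unitary_borel_def by (rule measurable_vimage_algebra1) (auto simp: space_PiM)
  from measurable_compose[OF this measurable_component_singleton[of "(p, q)"]]
  show ?thesis using assms by simp
qed

locale haar =
  fixes N :: nat and \<mu> :: "complex mat measure"
  assumes haar: "haar_unitary N \<mu>"
begin

sublocale prob_space \<mu> using haar by (simp add: haar_unitary_def)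

lemma sets_haar: "sets \<mu> = sets (unitary_borel N)" using haar by (simp add: haar_unitary_def)

lemma space_haar: "space \<mu> = unitary_group N"
  using sets_eq_imp_space_eq[OF sets_haar] by (simp add: space_unitary_borel)

lemma measurable_haar: "measurable \<mu> M' = measurable (unitary_borel N) M'"
  by (rule measurable_cong_sets[OF sets_haar refl])

lemma measurable_entry [measurable]:
  "p < N \<Longrightarrow> q < N \<Longrightarrow> (\<lambda>U. U $$ (p, q)) \<in> borel_measurable \<mu>"
  unfolding measurable_haar by (rule measurable_entry_unitary_borel)

text \<open>Left multiplication by \<open>V\<close> acts on every column separately, so left
  invariance of the matrix law passes to the law of each column.\<close>

lemma column_invariant:
  assumes k: "k < N" shows "unitary_invariant_vector \<mu> N (col_fun k)"
proof
  show "(\<lambda>U. col_fun k U p) \<in> borel_measurable \<mu>" if "p < N" for p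
    unfolding col_fun_def using that k by (rule measurable_entry)
  show "(\<Sum>p<N. (cmod (col_fun k U p))\<^sup>2) = 1" if "U \<in> space \<mu>" for U
    unfolding col_fun_def using unitary_group_norm[of U N k] that k by (simp add: space_haar)
  fix V assume "unitary_on N V"
  let ?V = "mat N N (\<lambda>(a, b). V a b)"
  let ?P = "\<Pi>\<^sub>M k\<in>{..<N}. (borel :: complex measure)"
  let ?r = "\<lambda>U. \<lambda>p\<in>{..<N}. col_fun k U p"
  have V: "?V \<in> unitary_group N" using \<open>unitary_on N V\<close> by (rule unitary_on_imp_unitary_group)
  have r: "?r \<in> measurable \<mu> ?P"
    unfolding col_fun_def using k by (intro measurable_restrict measurable_entry) auto
  have VU: "(\<lambda>U. ?V * U) \<in> measurable \<mu> \<mu>"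
    using measurable_left_mult[OF V] by (simp add: measurable_cong_sets[OF sets_haar sets_haar])
  have "distr \<mu> ?P (\<lambda>U. \<lambda>p\<in>{..<N}. mat_app N V (col_fun k U) p) = distr \<mu> ?P (?r \<circ> (\<lambda>U. ?V * U))"
  proof (rule distr_cong[OF refl refl])
    fix U assume "U \<in> space \<mu>"
    then have "U \<in> carrier_mat N N" by (simp add: space_haar unitary_group_def)
    then show "(\<lambda>p\<in>{..<N}. mat_app N V (col_fun k U) p) = (?r \<circ> (\<lambda>U. ?V * U)) U"
      using k by (auto simp: fun_eq_iff restrict_def mat_app_def col_fun_def scalar_prod_def lessThan_atLeast0)
  qed
  also have "\<dots> = distr (distr \<mu> \<mu> (\<lambda>U. ?V * U)) ?P ?r"
    by (rule distr_distr[OF r VU, symmetric])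
  also have "distr \<mu> \<mu> (\<lambda>U. ?V * U) = \<mu>" using haar V by (simp add: haar_unitary_def)
  finally show "distr \<mu> ?P (\<lambda>U. \<lambda>p\<in>{..<N}. mat_app N V (col_fun k U) p) = distr \<mu> ?P ?r" .
qed

lemma measurable_qform_col [measurable]:
  "k < N \<Longrightarrow> (\<lambda>U. qform N H (col_fun k U)) \<in> borel_measurable \<mu>"
  unfolding col_fun_def by (intro borel_measurable_qform measurable_entry)

end

text \<open>The averaged \<open>\<ell>\<^sub>1\<close> norm of the measurements. The factor
  \<open>N\<close> compensates the size of the forms, whose second moment for unit Frobenius norm is
  \<open>(1 + trace\<^sup>2) / (N * (N + 1))\<close>.\<close>

definition mean_abs :: "nat \<Rightarrow> nat \<Rightarrow> nat \<Rightarrow> (nat \<Rightarrow> nat \<Rightarrow> complex) \<Rightarrow> (nat \<Rightarrow> complex mat) \<Rightarrow> real" where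
  "mean_abs N K Q H \<Phi> = real N / (real K * real Q) * (\<Sum>i<Q. \<Sum>k<K. \<bar>qform N H (col_fun k (\<Phi> i))\<bar>)"

context haar
begin

context
  fixes K Q :: nat
  assumes K: "0 < K" "K \<le> N" and Q: "0 < Q"
begin

lemma N_pos: "0 < N" using K by simp

lemma measurable_mean_abs [measurable]:
  "mean_abs N K Q H \<in> borel_measurable (\<Pi>\<^sub>M i\<in>{..<Q}. \<mu>)"
proof -
  have "(\<lambda>\<Phi>. qform N H (col_fun k (\<Phi> i))) \<in> borel_measurable (\<Pi>\<^sub>M i\<in>{..<Q}. \<mu>)" if "i < Q" "k < K" for i k
    using measurable_compose[OF measurable_component_singleton[of i "{..<Q}" "\<lambda>_. \<mu>"] measurable_qform_col[of k H]] that K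
    by simp
  then show ?thesis
    unfolding mean_abs_def[abs_def] by (intro borel_measurable_times borel_measurable_sum borel_measurable_abs) auto
qed

lemma mean_abs_eq:
  assumes "0 < c"
  shows "mean_abs N K Q H \<Phi> = c / real Q * (\<Sum>i<Q. (\<Sum>k<K. real N * \<bar>qform N H (col_fun k (\<Phi> i))\<bar> / c) / real K)"
  unfolding mean_abs_def using assms K Q
  by (simp add: sum_divide_distrib[symmetric] sum_distrib_left[symmetric] field_simps)

text \<open>Here \<kappa> is any common bound for the two sizes of \<open>H\<close>; for a
  difference of net points such a bound is what \<open>close\<close> supplies. The factor 4 in the
  threshold is the one in the exponential moment.\<close>

lemma mean_abs_upper_tail:
  assumes H: "hermitian_on N H" and \<kappa>: "0 < \<kappa>" "frob_sq N H \<le> \<kappa>\<^sup>2" "\<bar>re_trace N H\<bar> \<le> \<kappa>"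
  shows "measure (\<Pi>\<^sub>M i\<in>{..<Q}. \<mu>) {\<Phi> \<in> space (\<Pi>\<^sub>M i\<in>{..<Q}. \<mu>). 4 * \<kappa> * s \<le> mean_abs N K Q H \<Phi>}
    \<le> (3 * exp (- s)) ^ Q"
proof -
  define z where "z k U = real N * \<bar>qform N H (col_fun k U)\<bar> / (4 * \<kappa>)" for k U
  define Z where "Z U = (\<Sum>k<K. z k U) / real K" for U
  have z: "integrable \<mu> (\<lambda>U. exp (z k U))" "expectation (\<lambda>U. exp (z k U)) \<le> 3" if "k < K" for k
    unfolding z_def
    using unitary_invariant_vector.expectation_exp_abs_le[OF column_invariant H N_pos \<kappa>] that K by auto
  have zm [measurable]: "z k \<in> borel_measurable \<mu>" if "k < K" for k
    unfolding z_def using that K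
    by (intro borel_measurable_divide borel_measurable_times borel_measurable_abs measurable_qform_col borel_measurable_const) auto
  have Zm [measurable]: "Z \<in> borel_measurable \<mu>" unfolding Z_def by measurable
  have int: "integrable \<mu> (\<lambda>U. (\<Sum>k<K. exp (z k U)) / real K)"
    by (intro integrable_divide_zero Bochner_Integration.integrable_sum z) auto
  have Zint: "integrable \<mu> (\<lambda>U. exp (Z U))"
    using exp_mean_le_mean_exp[OF K(1)]
    by (intro Bochner_Integration.integrable_bound[OF int]) (auto simp: Z_def sum_nonneg)
  have "expectation (\<lambda>U. exp (Z U)) \<le> expectation (\<lambda>U. (\<Sum>k<K. exp (z k U)) / real K)"
    unfolding Z_def using exp_mean_le_mean_exp[OF K(1)] Zint int by (intro integral_mono) (auto simp: Z_def)
  also have "\<dots> = (\<Sum>k<K. expectation (\<lambda>U. exp (z k U))) / real K" using z by simp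
  also have "\<dots> \<le> (\<Sum>k<K. 3) / real K" using z by (intro divide_right_mono sum_mono) auto
  also have "\<dots> = 3" using K by simp
  finally have "expectation (\<lambda>U. exp (Z U)) \<le> 3" .
  from product_chernoff[OF Zint this Zm, of Q s]
  have "measure (\<Pi>\<^sub>M i\<in>{..<Q}. \<mu>) {\<Phi> \<in> space (\<Pi>\<^sub>M i\<in>{..<Q}. \<mu>). real Q * s \<le> (\<Sum>i<Q. Z (\<Phi> i))} \<le> (3 * exp (- s)) ^ Q" .
  moreover have "4 * \<kappa> * s \<le> mean_abs N K Q H \<Phi> \<longleftrightarrow> real Q * s \<le> (\<Sum>i<Q. Z (\<Phi> i))" for \<Phi>
  proof -
    have eq: "mean_abs N K Q H \<Phi> = 4 * \<kappa> / real Q * (\<Sum>i<Q. Z (\<Phi> i))"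
      unfolding Z_def z_def by (rule mean_abs_eq) (use \<kappa> in simp)
    show ?thesis unfolding eq using \<kappa>(1) Q by (simp add: field_simps)
  qed
  ultimately show ?thesis by simp
qed

text \<open>A nonnegative variable is small on average only with exponentially small probability:
  its Laplace transform at a small argument is bounded through the first two moments, here uniformly
  in the trace.\<close>

lemma mean_abs_lower_tail:
  assumes H: "hermitian_on N H" and fro: "frob_sq N H = 1"
  shows "measure (\<Pi>\<^sub>M i\<in>{..<Q}. \<mu>) {\<Phi> \<in> space (\<Pi>\<^sub>M i\<in>{..<Q}. \<mu>). mean_abs N K Q H \<Phi> \<le> 1 / 16384}
    \<le> exp (- (1 / 16384)\<^sup>2 / 4 * real Q)"
proof -
  let ?P = "\<Pi>\<^sub>M i\<in>{..<Q}. \<mu>"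
  define \<sigma> where "\<sigma> = sqrt (1 + (re_trace N H)\<^sup>2)"
  \<comment> \<open>\<open>c\<close> is the lower bound for the mean of \<open>Z\<close> and also
    the argument of the Laplace transform. As the second moment is at most one, this choice balances
    the gain \<open>c * c\<close> against the loss \<open>c\<^sup>2 / 2\<close>.\<close>
  define c :: real where "c = 1 / 16384"
  have \<sigma>: "1 \<le> \<sigma>" unfolding \<sigma>_def by simp
  have c: "0 < c" by (simp add: c_def)
  define z where "z k U = real N * \<bar>qform N H (col_fun k U)\<bar> / (4 * \<sigma>)" for k U
  define Z where "Z U = (\<Sum>k<K. z k U) / real K" for U
  have z: "integrable \<mu> (z k)" "integrable \<mu> (\<lambda>U. (z k U)\<^sup>2)" "c \<le> expectation (z k)"
    "expectation (\<lambda>U. (z k U)\<^sup>2) \<le> 1" if "k < K" for k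
    unfolding z_def[abs_def] \<sigma>_def c_def
    using unitary_invariant_vector.expectation_abs_qform_bounds[OF column_invariant H N_pos fro] that K by auto
  have zm [measurable]: "z k \<in> borel_measurable \<mu>" if "k < K" for k
    unfolding z_def using that K
    by (intro borel_measurable_divide borel_measurable_times borel_measurable_abs measurable_qform_col borel_measurable_const) auto
  have Zm [measurable]: "Z \<in> borel_measurable \<mu>" unfolding Z_def by measurable
  have Z0: "0 \<le> Z U" for U using \<sigma> unfolding Z_def z_def by (intro divide_nonneg_nonneg sum_nonneg) auto
  have Zi: "integrable \<mu> Z" unfolding Z_def[abs_def]
    by (intro integrable_divide_zero Bochner_Integration.integrable_sum z) auto
  have int2: "integrable \<mu> (\<lambda>U. (\<Sum>k<K. (z k U)\<^sup>2) / real K)"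
    by (intro integrable_divide_zero Bochner_Integration.integrable_sum z) auto
  have Zi2: "integrable \<mu> (\<lambda>U. (Z U)\<^sup>2)"
    using mean_squared_le[OF K(1)]
    by (intro Bochner_Integration.integrable_bound[OF int2]) (auto simp: Z_def sum_nonneg)
  have EZ: "c \<le> expectation Z"
  proof -
    have "c = (\<Sum>k<K. c) / real K" using K by simp
    also have "\<dots> \<le> (\<Sum>k<K. expectation (z k)) / real K" using z by (intro divide_right_mono sum_mono) auto
    also have "\<dots> = expectation Z" unfolding Z_def[abs_def] using z by simp
    finally show ?thesis .
  qed
  have EZ2: "expectation (\<lambda>U. (Z U)\<^sup>2) \<le> 1"
  proof -
    have "expectation (\<lambda>U. (Z U)\<^sup>2) \<le> expectation (\<lambda>U. (\<Sum>k<K. (z k U)\<^sup>2) / real K)"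
      using mean_squared_le[OF K(1)] Zi2 int2 by (intro integral_mono) (auto simp: Z_def)
    also have "\<dots> = (\<Sum>k<K. expectation (\<lambda>U. (z k U)\<^sup>2)) / real K" using z by simp
    also have "\<dots> \<le> (\<Sum>k<K. 1) / real K" using z by (intro divide_right_mono sum_mono) auto
    finally show ?thesis using K by simp
  qed
  have ei: "integrable \<mu> (\<lambda>U. exp (- (c * Z U)))"
    using Z0 c by (intro integrable_const_bound[of _ 1]) (auto simp: mult_nonneg_nonneg)
  have "expectation (\<lambda>U. exp (- (c * Z U))) \<le> expectation (\<lambda>U. 1 - c * Z U + c\<^sup>2 / 2 * (Z U)\<^sup>2)"
    using ei Zi Zi2 exp_minus_le_quadratic[of "c * Z _"] Z0 c
    by (intro integral_mono) (auto simp: power_mult_distrib mult_nonneg_nonneg)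
  also have "\<dots> = 1 - c * expectation Z + c\<^sup>2 / 2 * expectation (\<lambda>U. (Z U)\<^sup>2)"
    using Zi Zi2 by (simp add: prob_space)
  also have "\<dots> \<le> 1 - c * c + c\<^sup>2 / 2 * 1"
    using EZ EZ2 c by (intro add_mono diff_mono mult_left_mono) auto
  also have "\<dots> = 1 + (- (c\<^sup>2 / 2))" by (simp add: power2_eq_square)
  also have "\<dots> \<le> exp (- (c\<^sup>2 / 2))" by (rule exp_ge_add_one_self)
  finally have e: "expectation (\<lambda>U. exp (- (c * Z U))) \<le> exp (- (c\<^sup>2 / 2))" .
  \<comment> \<open>The level \<open>c / 4\<close> for the average of \<open>Z\<close> gives back
    \<open>c\<^sup>2 / 4\<close> of the exponent \<open>c\<^sup>2 / 2\<close>. The 4 is the one in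
    the scale of \<open>z\<close>.\<close>
  have "measure ?P {\<Phi> \<in> space ?P. real Q * (- (c\<^sup>2 / 4)) \<le> (\<Sum>i<Q. - (c * Z (\<Phi> i)))}
      \<le> (exp (- (c\<^sup>2 / 2)) * exp (- (- (c\<^sup>2 / 4)))) ^ Q"
    by (rule product_chernoff[OF ei e]) measurable
  also have "\<dots> = exp (- c\<^sup>2 / 4 * real Q)"
    by (simp add: exp_add[symmetric] exp_of_nat2_mult[symmetric])
  finally have 1: "measure ?P {\<Phi> \<in> space ?P. real Q * (- (c\<^sup>2 / 4)) \<le> (\<Sum>i<Q. - (c * Z (\<Phi> i)))}
      \<le> exp (- c\<^sup>2 / 4 * real Q)" .
  interpret P: prob_space ?P by (intro prob_space_PiM prob_space_axioms)
  have "measure ?P {\<Phi> \<in> space ?P. mean_abs N K Q H \<Phi> \<le> c} \<le>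
      measure ?P {\<Phi> \<in> space ?P. real Q * (- (c\<^sup>2 / 4)) \<le> (\<Sum>i<Q. - (c * Z (\<Phi> i)))}"
  proof (rule P.finite_measure_mono)
    show "{\<Phi> \<in> space ?P. mean_abs N K Q H \<Phi> \<le> c} \<subseteq> {\<Phi> \<in> space ?P. real Q * (- (c\<^sup>2 / 4)) \<le> (\<Sum>i<Q. - (c * Z (\<Phi> i)))}"
    proof (intro Collect_mono impI conjI; elim conjE)
      fix \<Phi> assume "mean_abs N K Q H \<Phi> \<le> c"
      then have "4 * \<sigma> / real Q * (\<Sum>i<Q. Z (\<Phi> i)) \<le> c"
        using mean_abs_eq[of "4 * \<sigma>" H \<Phi>] \<sigma> unfolding Z_def z_def by simp
      \<comment> \<open>Weakening the threshold by the factor \<sigma>, which is at least one,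
        cancels the trace-dependent scale.\<close>
      also have "c \<le> \<sigma> * c" using \<sigma> c by simp
      finally have "(\<Sum>i<Q. Z (\<Phi> i)) \<le> real Q * c / 4" using \<sigma> Q by (simp add: field_simps)
      then have "c * (\<Sum>i<Q. Z (\<Phi> i)) \<le> c * (real Q * c / 4)" using c by (intro mult_left_mono) auto
      then show "real Q * (- (c\<^sup>2 / 4)) \<le> (\<Sum>i<Q. - (c * Z (\<Phi> i)))"
        by (simp add: sum_negf sum_distrib_left[symmetric] power2_eq_square mult_ac)
    qed
    show "{\<Phi> \<in> space ?P. real Q * (- (c\<^sup>2 / 4)) \<le> (\<Sum>i<Q. - (c * Z (\<Phi> i)))} \<in> sets ?P" by measurable
  qed
  then show ?thesis using 1 unfolding c_def by linarith
qed

end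

end

section \<open>Matrix product operators\<close>

definition sum_cmod_sq :: "nat \<Rightarrow> (nat \<Rightarrow> complex) \<Rightarrow> real" where
  "sum_cmod_sq R v = (\<Sum>q<R. (cmod (v q))\<^sup>2)"

lemma sum_cmod_sq_nonneg: "0 \<le> sum_cmod_sq R v" unfolding sum_cmod_sq_def by (intro sum_nonneg) auto

lemma sum_radix:
  fixes f :: "nat \<Rightarrow> 'b::comm_monoid_add"
  shows "(\<Sum>x<k * d. f x) = (\<Sum>a<d. \<Sum>x<k. f (x + k * a))"
proof -
  have "(\<Sum>x<d * k. f x) = (\<Sum>a<d. sum f {a * k..<a * k + k})" by (rule sum.nat_group[symmetric])
  also have "\<dots> = (\<Sum>a<d. \<Sum>x<k. f (x + k * a))"
  proof (rule sum.cong[OF refl])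
    fix a
    show "sum f {a * k..<a * k + k} = (\<Sum>x<k. f (x + k * a))"
      using sum.shift_bounds_nat_ivl[of f 0 "a * k" k] by (simp add: lessThan_atLeast0 add.commute mult.commute)
  qed
  finally show ?thesis by (simp add: mult.commute)
qed

text \<open>Positions count from zero, whereas sites count from one: site \<open>l\<close> reads
  digit \<open>l - 1\<close>, in agreement with \<open>multi_index\<close>.\<close>

definition digit :: "nat \<Rightarrow> nat \<Rightarrow> nat \<Rightarrow> nat" where "digit d l x = x div d ^ l mod d"

lemma digit_less: "0 < d \<Longrightarrow> digit d l x < d" by (simp add: digit_def)

lemma digit_top: "x < d ^ l \<Longrightarrow> a < d \<Longrightarrow> digit d l (x + d ^ l * a) = a"
  by (simp add: digit_def)

lemma digit_add_power:
  assumes "m < l" "0 < d" shows "digit d m (x + d ^ l * a) = digit d m x"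
proof -
  have "d ^ l = d ^ m * (d * d ^ (l - m - 1))"
    using assms(1) by (metis Suc_diff_Suc add_diff_inverse_nat diff_Suc_eq_diff_pred less_imp_not_less power_Suc power_add diff_diff_left plus_1_eq_Suc add.commute)
  then have "(x + d ^ l * a) div d ^ m = x div d ^ m + d * (d ^ (l - m - 1) * a)"
    using assms(2) by (simp add: mult.assoc)
  then show ?thesis by (simp add: digit_def)
qed

definition extend_train :: "nat \<Rightarrow> nat \<Rightarrow> nat \<Rightarrow> (nat \<Rightarrow> nat \<Rightarrow> nat \<Rightarrow> complex) \<Rightarrow>
    (nat \<Rightarrow> nat \<Rightarrow> nat \<Rightarrow> nat \<Rightarrow> complex) \<Rightarrow> nat \<Rightarrow> nat \<Rightarrow> nat \<Rightarrow> complex" where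
  "extend_train d R l T Y x y q = (\<Sum>p<R. T x y p * Y (digit d l x) (digit d l y) p q)"

text \<open>The partial product of the cores as a row vector of length \<open>R\<close>, started at
  the first unit vector; ranks below \<open>R\<close> are represented by zero entries. It is defined
  for all row and column numbers \<open>x\<close>, \<open>y\<close> but reads only their lowest
  \<open>l\<close> digits.\<close>

fun train :: "nat \<Rightarrow> nat \<Rightarrow> (nat \<Rightarrow> nat \<Rightarrow> nat \<Rightarrow> nat \<Rightarrow> nat \<Rightarrow> complex) \<Rightarrow> nat \<Rightarrow> nat \<Rightarrow> nat \<Rightarrow> nat \<Rightarrow> complex" where
  "train d R X 0 = (\<lambda>x y q. if q = 0 then 1 else 0)"
| "train d R X (Suc l) = extend_train d R l (train d R X l) (X (Suc l))"

text \<open>Read \<open>T\<close> as a linear map from vectors of length \<open>R\<close> to square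
  matrices of size \<open>d ^ l\<close>; this is the squared Frobenius norm of the image of
  \<open>v\<close>. Bounds valid for all \<open>v\<close> are bounds on an operator norm.\<close>

definition slice_norm_sq :: "nat \<Rightarrow> nat \<Rightarrow> nat \<Rightarrow> (nat \<Rightarrow> nat \<Rightarrow> nat \<Rightarrow> complex) \<Rightarrow> (nat \<Rightarrow> complex) \<Rightarrow> real" where
  "slice_norm_sq d R l T v = (\<Sum>x<d ^ l. \<Sum>y<d ^ l. (cmod (\<Sum>q<R. T x y q * v q))\<^sup>2)"

lemma slice_norm_sq_nonneg: "0 \<le> slice_norm_sq d R l T v" unfolding slice_norm_sq_def by (intro sum_nonneg) auto

lemma slice_norm_sq_L2: "sqrt (slice_norm_sq d R l T v) = L2_set (\<lambda>(x, y). cmod (\<Sum>q<R. T x y q * v q)) ({..<d ^ l} \<times> {..<d ^ l})"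
  by (simp add: slice_norm_sq_def L2_set_def sum.cartesian_product case_prod_beta)

lemma sqrt_slice_norm_sq_add_le:
  "sqrt (slice_norm_sq d R l (\<lambda>x y q. T x y q + T' x y q) v) \<le> sqrt (slice_norm_sq d R l T v) + sqrt (slice_norm_sq d R l T' v)"
proof -
  let ?D = "{..<d ^ l} \<times> {..<d ^ l}"
  have "sqrt (slice_norm_sq d R l (\<lambda>x y q. T x y q + T' x y q) v) \<le>
      L2_set (\<lambda>z. (case z of (x, y) \<Rightarrow> cmod (\<Sum>q<R. T x y q * v q)) + (case z of (x, y) \<Rightarrow> cmod (\<Sum>q<R. T' x y q * v q))) ?D"
    unfolding slice_norm_sq_L2 by (rule L2_set_mono) (auto simp: distrib_right sum.distrib norm_triangle_ineq)
  also have "\<dots> \<le> sqrt (slice_norm_sq d R l T v) + sqrt (slice_norm_sq d R l T' v)"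
    unfolding slice_norm_sq_L2 by (rule L2_set_triangle_ineq)
  finally show ?thesis .
qed

text \<open>The top digits \<open>a\<close>, \<open>b\<close> select the core matrix
  \<open>Y a b\<close>, and \<open>T\<close> sees only the lower digits. The image of
  \<open>v\<close> thus splits into blocks that are the images under \<open>T\<close> of the vectors
  \<open>Y a b\<close> applied to \<open>v\<close>.\<close>

lemma slice_norm_sq_extend_train:
  assumes "0 < d" and local: "\<And>x y a b. T (x + d ^ l * a) (y + d ^ l * b) = T x y"
  shows "slice_norm_sq d R (Suc l) (extend_train d R l T Y) v = (\<Sum>a<d. \<Sum>b<d. slice_norm_sq d R l T (mat_app R (Y a b) v))"
proof -
  have val: "(\<Sum>q<R. extend_train d R l T Y (x + d ^ l * a) (y + d ^ l * b) q * v q) =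
      (\<Sum>p<R. T x y p * mat_app R (Y a b) v p)" if "x < d ^ l" "y < d ^ l" "a < d" "b < d" for x y a b
  proof -
    have "(\<Sum>q<R. extend_train d R l T Y (x + d ^ l * a) (y + d ^ l * b) q * v q) =
        (\<Sum>q<R. \<Sum>p<R. T x y p * Y a b p q * v q)"
      using that by (simp add: extend_train_def local digit_top sum_distrib_right)
    also have "\<dots> = (\<Sum>p<R. \<Sum>q<R. T x y p * Y a b p q * v q)" by (rule sum.swap)
    finally show ?thesis by (simp add: mat_app_def sum_distrib_left mult.assoc)
  qed
  have "slice_norm_sq d R (Suc l) (extend_train d R l T Y) v =
      (\<Sum>a<d. \<Sum>x<d ^ l. \<Sum>b<d. \<Sum>y<d ^ l. (cmod (\<Sum>q<R. extend_train d R l T Y (x + d ^ l * a) (y + d ^ l * b) q * v q))\<^sup>2)"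
    unfolding slice_norm_sq_def power_Suc2 sum_radix ..
  also have "\<dots> = (\<Sum>a<d. \<Sum>x<d ^ l. \<Sum>b<d. \<Sum>y<d ^ l. (cmod (\<Sum>p<R. T x y p * mat_app R (Y a b) v p))\<^sup>2)"
    by (intro sum.cong refl) (simp add: val)
  also have "\<dots> = (\<Sum>a<d. \<Sum>b<d. slice_norm_sq d R l T (mat_app R (Y a b) v))"
    unfolding slice_norm_sq_def by (rule sum.cong[OF refl], rule sum.swap)
  finally show ?thesis .
qed

lemma train_local:
  assumes "0 < d" "m \<le> l"
  shows "train d R X m (x + d ^ l * a) (y + d ^ l * b) = train d R X m x y"
  using assms(2)
proof (induction m)
  case (Suc m)
  then show ?case using assms(1) by (auto simp: extend_train_def fun_eq_iff digit_add_power)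
qed (simp add: fun_eq_iff)

text \<open>\<open>Y\<close>, read as a matrix with rows \<open>(a, b, p)\<close> and columns \<open>q\<close>, has operator norm at most \<open>\<beta>\<close>.\<close>

definition op_bound :: "nat \<Rightarrow> nat \<Rightarrow> real \<Rightarrow> (nat \<Rightarrow> nat \<Rightarrow> nat \<Rightarrow> nat \<Rightarrow> complex) \<Rightarrow> bool" where
  "op_bound d R \<beta> Y \<longleftrightarrow> (\<forall>v. (\<Sum>a<d. \<Sum>b<d. sum_cmod_sq R (mat_app R (Y a b) v)) \<le> \<beta>\<^sup>2 * sum_cmod_sq R v)"

lemma slice_norm_sq_extend_train_le:
  assumes "0 < d" and local: "\<And>x y a b. T (x + d ^ l * a) (y + d ^ l * b) = T x y"
    and T: "\<And>w. slice_norm_sq d R l T w \<le> \<alpha>\<^sup>2 * sum_cmod_sq R w" and Y: "op_bound d R \<beta> Y"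
  shows "slice_norm_sq d R (Suc l) (extend_train d R l T Y) v \<le> (\<alpha> * \<beta>)\<^sup>2 * sum_cmod_sq R v"
proof -
  have "slice_norm_sq d R (Suc l) (extend_train d R l T Y) v \<le> (\<Sum>a<d. \<Sum>b<d. \<alpha>\<^sup>2 * sum_cmod_sq R (mat_app R (Y a b) v))"
    unfolding slice_norm_sq_extend_train[of d T l R Y v, OF assms(1) local] by (intro sum_mono T)
  also have "\<dots> = \<alpha>\<^sup>2 * (\<Sum>a<d. \<Sum>b<d. sum_cmod_sq R (mat_app R (Y a b) v))" by (simp add: sum_distrib_left)
  also have "\<dots> \<le> \<alpha>\<^sup>2 * (\<beta>\<^sup>2 * sum_cmod_sq R v)"
    using Y unfolding op_bound_def by (intro mult_left_mono) auto
  finally show ?thesis by (simp add: power_mult_distrib mult.assoc)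
qed

lemma slice_norm_sq_train_le:
  assumes "0 < d" and X: "\<And>k. 1 \<le> k \<Longrightarrow> k \<le> n \<Longrightarrow> op_bound d R 1 (X k)" and "l \<le> n" and R: "0 < R"
  shows "slice_norm_sq d R l (train d R X l) v \<le> 1\<^sup>2 * sum_cmod_sq R v"
  using assms(3)
proof (induction l arbitrary: v)
  case 0
  have "(\<Sum>q<R. (if q = 0 then 1 else 0) * v q) = v 0" using R by (subst sum_one_point[of 0]) auto
  then have "slice_norm_sq d R 0 (train d R X 0) v = (cmod (v 0))\<^sup>2" by (simp add: slice_norm_sq_def)
  also have "\<dots> \<le> sum_cmod_sq R v" unfolding sum_cmod_sq_def using R by (intro member_le_sum) auto
  finally show ?case by simp
next
  case (Suc l)
  then show ?case
    using slice_norm_sq_extend_train_le[of d "train d R X l" l R 1 1 "X (Suc l)" v] train_local[OF assms(1)] assms(1) X[of "Suc l"] by simp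
qed

text \<open>Telescoping over the sites: one summand carries the earlier difference through the last
  core of \<open>X\<close>, the other replaces only the last core. All remaining factors have
  operator norm at most one, so the errors add up to \<open>l * \<epsilon>\<close> instead of being
  amplified from site to site.\<close>

lemma slice_norm_sq_train_diff_le:
  assumes "0 < d" and R: "0 < R" and \<epsilon>: "0 \<le> \<epsilon>"
    and X: "\<And>k. 1 \<le> k \<Longrightarrow> k \<le> n \<Longrightarrow> op_bound d R 1 (X k)"
    and Y: "\<And>k. 1 \<le> k \<Longrightarrow> k \<le> n \<Longrightarrow> op_bound d R 1 (Y k)"
    and XY: "\<And>k. 1 \<le> k \<Longrightarrow> k \<le> n \<Longrightarrow> op_bound d R \<epsilon> (\<lambda>a b p q. X k a b p q - Y k a b p q)"
    and "l \<le> n"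
  shows "slice_norm_sq d R l (\<lambda>x y q. train d R X l x y q - train d R Y l x y q) v \<le> (real l * \<epsilon>)\<^sup>2 * sum_cmod_sq R v"
  using assms(7)
proof (induction l arbitrary: v)
  case 0
  then show ?case by (simp add: slice_norm_sq_def)
next
  case (Suc l)
  let ?D = "\<lambda>x y q. train d R X l x y q - train d R Y l x y q"
  let ?A = "extend_train d R l ?D (X (Suc l))"
  let ?B = "extend_train d R l (train d R Y l) (\<lambda>a b p q. X (Suc l) a b p q - Y (Suc l) a b p q)"
  have eq: "(\<lambda>x y q. train d R X (Suc l) x y q - train d R Y (Suc l) x y q) = (\<lambda>x y q. ?A x y q + ?B x y q)"
    by (simp add: fun_eq_iff extend_train_def algebra_simps sum_subtractf)
  have IH: "slice_norm_sq d R l ?D w \<le> (real l * \<epsilon>)\<^sup>2 * sum_cmod_sq R w" for w using Suc by simp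
  have "?D (x + d ^ l * a) (y + d ^ l * b) = ?D x y" for x y a b
    using train_local[OF assms(1), of l l R] by (simp add: fun_eq_iff)
  from slice_norm_sq_extend_train_le[of d ?D l R "real l * \<epsilon>" 1 "X (Suc l)" v, OF assms(1) this IH X[of "Suc l"]]
  have A: "slice_norm_sq d R (Suc l) ?A v \<le> (real l * \<epsilon>)\<^sup>2 * sum_cmod_sq R v" using Suc.prems by simp
  have TY: "slice_norm_sq d R l (train d R Y l) w \<le> 1\<^sup>2 * sum_cmod_sq R w" for w
    using Suc.prems by (intro slice_norm_sq_train_le[OF assms(1) Y _ R]) auto
  from slice_norm_sq_extend_train_le[of d "train d R Y l" l R 1 \<epsilon> _ v, OF assms(1) train_local[OF assms(1) order_refl] this XY[of "Suc l"]]
  have B: "slice_norm_sq d R (Suc l) ?B v \<le> \<epsilon>\<^sup>2 * sum_cmod_sq R v" using Suc.prems by simp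
  have "sqrt (slice_norm_sq d R (Suc l) (\<lambda>x y q. ?A x y q + ?B x y q) v) \<le> sqrt (slice_norm_sq d R (Suc l) ?A v) + sqrt (slice_norm_sq d R (Suc l) ?B v)"
    by (rule sqrt_slice_norm_sq_add_le)
  also have "\<dots> \<le> sqrt ((real l * \<epsilon>)\<^sup>2 * sum_cmod_sq R v) + sqrt (\<epsilon>\<^sup>2 * sum_cmod_sq R v)"
    by (intro add_mono real_sqrt_le_mono A B)
  also have "\<dots> = real (Suc l) * \<epsilon> * sqrt (sum_cmod_sq R v)"
    using \<epsilon> by (simp add: real_sqrt_mult algebra_simps)
  finally have "(sqrt (slice_norm_sq d R (Suc l) (\<lambda>x y q. ?A x y q + ?B x y q) v))\<^sup>2 \<le> (real (Suc l) * \<epsilon> * sqrt (sum_cmod_sq R v))\<^sup>2"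
    by (intro power_mono) (auto simp: slice_norm_sq_nonneg)
  then show ?case unfolding eq by (simp add: slice_norm_sq_nonneg power_mult_distrib sum_cmod_sq_nonneg)
qed

lemma slice_norm_sq_unit:
  assumes "0 < R" shows "slice_norm_sq d R l T (\<lambda>q. if q = 0 then 1 else 0) = (\<Sum>x<d ^ l. \<Sum>y<d ^ l. (cmod (T x y 0))\<^sup>2)"
proof -
  have "(\<Sum>q<R. T x y q * (if q = 0 then 1 else 0)) = T x y 0" for x y
    using assms by (subst sum_one_point[of 0]) auto
  then show ?thesis by (simp add: slice_norm_sq_def)
qed

lemma frob_sq_train_diff_le:
  assumes "0 < d" "0 < R" "0 \<le> \<epsilon>"
    and "\<And>k. 1 \<le> k \<Longrightarrow> k \<le> n \<Longrightarrow> op_bound d R 1 (X k)"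
    and "\<And>k. 1 \<le> k \<Longrightarrow> k \<le> n \<Longrightarrow> op_bound d R 1 (Y k)"
    and "\<And>k. 1 \<le> k \<Longrightarrow> k \<le> n \<Longrightarrow> op_bound d R \<epsilon> (\<lambda>a b p q. X k a b p q - Y k a b p q)"
  shows "frob_sq (d ^ n) (\<lambda>x y. train d R X n x y 0 - train d R Y n x y 0) \<le> (real n * \<epsilon>)\<^sup>2"
proof -
  have "sum_cmod_sq R (\<lambda>q. if q = 0 then 1 else 0) = 1"
    unfolding sum_cmod_sq_def using assms(2) by (subst sum_one_point[of 0]) auto
  then show ?thesis
    using slice_norm_sq_train_diff_le[where v = "\<lambda>q. if q = 0 then 1 else 0", OF assms order_refl]
    unfolding slice_norm_sq_unit[OF assms(2)] frob_sq_def by simp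
qed

text \<open>Padding with zero columns turns the identity Gram matrix of a left-orthogonal core into
  the projection onto the first \<open>s\<close> coordinates.\<close>

lemma gram_isometry:
  fixes Y :: "nat \<Rightarrow> nat \<Rightarrow> nat \<Rightarrow> nat \<Rightarrow> complex"
  assumes "s \<le> R"
    and gram: "\<And>q q'. q < R \<Longrightarrow> q' < R \<Longrightarrow>
      (\<Sum>a<d. \<Sum>b<d. \<Sum>p<R. cnj (Y a b p q) * Y a b p q') = (if q = q' \<and> q < s then 1 else 0)"
  shows "(\<Sum>a<d. \<Sum>b<d. sum_cmod_sq R (mat_app R (Y a b) v)) = sum_cmod_sq s v"
proof -
  have "complex_of_real (\<Sum>a<d. \<Sum>b<d. sum_cmod_sq R (mat_app R (Y a b) v)) =
      (\<Sum>a<d. \<Sum>b<d. \<Sum>p<R. \<Sum>q<R. \<Sum>q'<R. cnj (v q) * v q' * (cnj (Y a b p q) * Y a b p q'))"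
    unfolding sum_cmod_sq_def mat_app_def of_real_sum complex_norm_square
    by (simp add: sum_distrib_left sum_distrib_right mult_ac)
  also have "\<dots> = (\<Sum>q'<R. \<Sum>q<R. \<Sum>a<d. \<Sum>b<d. \<Sum>p<R. cnj (v q) * v q' * (cnj (Y a b p q) * Y a b p q'))"
  proof -
    have "(\<Sum>a<d. \<Sum>b<d. \<Sum>p<R. \<Sum>q<R. \<Sum>q'<R. f a b p q q') = (\<Sum>q'<R. \<Sum>q<R. \<Sum>a<d. \<Sum>b<d. \<Sum>p<R. f a b p q q')" for f :: "nat \<Rightarrow> nat \<Rightarrow> nat \<Rightarrow> nat \<Rightarrow> nat \<Rightarrow> complex"
      by (simp only: sum.cartesian_product)
        (rule sum.reindex_bij_witness[of _ "\<lambda>(q', q, a, b, p). (a, b, p, q, q')" "\<lambda>(a, b, p, q, q'). (q', q, a, b, p)"]; auto)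
    then show ?thesis .
  qed
  also have "\<dots> = (\<Sum>q'<R. \<Sum>q<R. cnj (v q) * v q' * (if q = q' \<and> q < s then 1 else 0))"
    by (intro sum.cong refl) (simp add: gram sum_distrib_left[symmetric])
  also have "\<dots> = (\<Sum>q'<R. if q' < s then cnj (v q') * v q' else 0)"
  proof (intro sum.cong refl)
    fix q' assume "q' \<in> {..<R}"
    then show "(\<Sum>q<R. cnj (v q) * v q' * (if q = q' \<and> q < s then 1 else 0)) = (if q' < s then cnj (v q') * v q' else 0)"
      by (subst sum_one_point[of q']) auto
  qed
  also have "\<dots> = (\<Sum>q'<s. cnj (v q') * v q')"
    using assms(1) by (intro sum.mono_neutral_cong_right) auto
  also have "\<dots> = complex_of_real (sum_cmod_sq s v)"
    unfolding sum_cmod_sq_def of_real_sum complex_norm_square by (simp add: mult.commute)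
  finally show ?thesis by (simp only: of_real_eq_iff)
qed

lemma sum_cmod_sq_mono: "s \<le> R \<Longrightarrow> sum_cmod_sq s v \<le> sum_cmod_sq R v"
  unfolding sum_cmod_sq_def by (intro sum_mono2) auto

text \<open>A core at site \<open>l\<close> outputs vectors supported on the first
  \<open>r (l - 1)\<close> coordinates, precisely where the preceding part of the train is
  isometric. For the last site and the first unit vector this yields the Frobenius norm of the whole
  operator.\<close>

lemma slice_norm_sq_train_isometry:
  assumes "0 < d" and R: "0 < R" and r0: "r 0 = 1"
    and supp: "\<And>l a b p q. 1 \<le> l \<Longrightarrow> l \<le> n \<Longrightarrow> r (l - 1) \<le> p \<Longrightarrow> X l a b p q = 0"
    and iso: "\<And>l v. 1 \<le> l \<Longrightarrow> l \<le> n \<Longrightarrow> (\<Sum>a<d. \<Sum>b<d. sum_cmod_sq R (mat_app R (X l a b) v)) = sum_cmod_sq (r l) v"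
    and rR: "\<And>l. l \<le> n \<Longrightarrow> r l \<le> R"
    and "l \<le> n"
  shows "slice_norm_sq d R l (train d R X l) v = sum_cmod_sq (r l) v"
  using assms(7)
proof (induction l arbitrary: v)
  case 0
  have "(\<Sum>q<R. (if q = 0 then 1 else 0) * v q) = v 0" using R by (subst sum_one_point[of 0]) auto
  then show ?case by (simp add: slice_norm_sq_def sum_cmod_sq_def r0)
next
  case (Suc l)
  have "slice_norm_sq d R (Suc l) (train d R X (Suc l)) v = (\<Sum>a<d. \<Sum>b<d. slice_norm_sq d R l (train d R X l) (mat_app R (X (Suc l) a b) v))"
    using slice_norm_sq_extend_train[of d "train d R X l" l, OF assms(1) train_local[OF assms(1) order_refl]] by simp
  also have "\<dots> = (\<Sum>a<d. \<Sum>b<d. sum_cmod_sq (r l) (mat_app R (X (Suc l) a b) v))" using Suc by simp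
  also have "\<dots> = (\<Sum>a<d. \<Sum>b<d. sum_cmod_sq R (mat_app R (X (Suc l) a b) v))"
  proof (intro sum.cong refl)
    fix a b
    have "mat_app R (X (Suc l) a b) v p = 0" if "r l \<le> p" for p
      using supp[of "Suc l" p] that Suc.prems by (simp add: mat_app_def)
    then show "sum_cmod_sq (r l) (mat_app R (X (Suc l) a b) v) = sum_cmod_sq R (mat_app R (X (Suc l) a b) v)"
      unfolding sum_cmod_sq_def using rR[of l] Suc.prems by (intro sum.mono_neutral_left) auto
  qed
  also have "\<dots> = sum_cmod_sq (r (Suc l)) v" using iso[of "Suc l"] Suc.prems by simp
  finally show ?case .
qed

section \<open>Matrix product operators as trains of padded cores\<close>

lemma sum_digits: "(\<Sum>l=1..n. d ^ (l - 1) * digit d (l - 1) x) = x mod d ^ n"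
proof (induction n)
  case (Suc n)
  have "x mod (d ^ n * d) = d ^ n * (x div d ^ n mod d) + x mod d ^ n" by (rule mod_mult2_eq)
  then show ?case using Suc by (simp add: digit_def mult.commute)
qed simp

text \<open>The interface to \<open>mpo_set\<close> for everything below: contractive cores on an
  index set that depends only on \<open>n\<close>, \<open>d\<close> and \<open>R\<close>, and unit
  Frobenius norm, which is what left-orthogonality at all sites amounts to.\<close>

lemma mpo_set_train:
  assumes \<rho>: "\<rho> \<in> mpo_set d n R" and n: "2 \<le> n" and d: "0 < d" and R: "0 < R"
  shows "\<exists>X. (\<forall>l. 1 \<le> l \<longrightarrow> l \<le> n \<longrightarrow> op_bound d R 1 (X l)) \<and>
    (\<forall>x<d ^ n. \<forall>y<d ^ n. \<rho> $$ (x, y) = train d R X n x y 0) \<and>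
    frob_sq (d ^ n) (\<lambda>x y. \<rho> $$ (x, y)) = 1"
proof -
  from \<rho> obtain r Xm where *: "r 0 = 1 \<and> r n = 1 \<and> (\<forall>l\<in>{1..n - 1}. 0 < r l) \<and> Max (r ` {1..n - 1}) = R \<and>
       (\<forall>l\<in>{1..n}. \<forall>a<d. \<forall>b<d. Xm l a b \<in> carrier_mat (r (l - 1)) (r l)) \<and>
       (\<forall>i j. (\<forall>l\<in>{1..n}. i l < d \<and> j l < d) \<longrightarrow>
          \<rho> $$ (multi_index d n i, multi_index d n j) = core_product Xm i j n $$ (0, 0)) \<and>
       (\<forall>l\<in>{1..n}. left_orthogonal d (r l) (Xm l))"
    unfolding mpo_set_def mem_Collect_eq by blast
  have r0: "r 0 = 1" and rn: "r n = 1" and rmax: "Max (r ` {1..n - 1}) = R" using * by blast+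
  have car: "Xm l a b \<in> carrier_mat (r (l - 1)) (r l)" if "l \<in> {1..n}" "a < d" "b < d" for l a b
    using * that by blast
  have val: "\<rho> $$ (multi_index d n i, multi_index d n j) = core_product Xm i j n $$ (0, 0)"
    if "\<forall>l\<in>{1..n}. i l < d \<and> j l < d" for i j using * that by blast
  have orth: "left_orthogonal d (r l) (Xm l)" if "l \<in> {1..n}" for l using * that by blast
  have rR: "r l \<le> R" if "l \<le> n" for l
  proof (cases "l \<in> {1..n - 1}")
    case True
    then show ?thesis unfolding rmax[symmetric] by (intro Max_ge) auto
  next
    case False
    then have "l = 0 \<or> l = n" using that by auto
    then show ?thesis using r0 rn R by auto
  qed
  \<comment> \<open>Padding all cores with zeros to size \<open>R \<times> R\<close> makes one index set serve every rank vector.\<close>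
  define X where "X l a b p q = (if p < r (l - 1) \<and> q < r l then Xm l a b $$ (p, q) else 0)" for l a b p q
  have gram: "(\<Sum>a<d. \<Sum>b<d. \<Sum>p<R. cnj (X l a b p q) * X l a b p q') = (if q = q' \<and> q < r l then 1 else 0)"
    if l: "1 \<le> l" "l \<le> n" for l q q'
  proof (cases "q < r l \<and> q' < r l")
    case True
    have "(mat_adjoint (Xm l a b) * Xm l a b) $$ (q, q') = (\<Sum>p<R. cnj (X l a b p q) * X l a b p q')"
      if "a < d" "b < d" for a b
    proof -
      have "(mat_adjoint (Xm l a b) * Xm l a b) $$ (q, q') =
          (\<Sum>p<r (l - 1). cnj (Xm l a b $$ (p, q)) * Xm l a b $$ (p, q'))"
        using car[of l a b] l that True
        by (auto simp: mat_adjoint_def mat_of_rows_def scalar_prod_def lessThan_atLeast0)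
      also have "\<dots> = (\<Sum>p<R. cnj (X l a b p q) * X l a b p q')"
        using rR[of "l - 1"] l True by (intro sum.mono_neutral_cong_left) (auto simp: X_def)
      finally show ?thesis .
    qed
    then have "(\<Sum>a<d. \<Sum>b<d. \<Sum>p<R. cnj (X l a b p q) * X l a b p q') =
        (\<Sum>a<d. \<Sum>b<d. (mat_adjoint (Xm l a b) * Xm l a b) $$ (q, q'))" by simp
    also have "\<dots> = 1\<^sub>m (r l) $$ (q, q')"
    proof -
      let ?G = "mat (r l) (r l) (\<lambda>pq. \<Sum>a<d. \<Sum>b<d. (mat_adjoint (Xm l a b) * Xm l a b) $$ pq)"
      have "?G $$ (q, q') = (\<Sum>a<d. \<Sum>b<d. (mat_adjoint (Xm l a b) * Xm l a b) $$ (q, q'))"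
        by (rule index_mat(1)) (use True in auto)
      moreover have "?G = 1\<^sub>m (r l)" using orth[of l] l unfolding left_orthogonal_def by auto
      ultimately show ?thesis by (simp only:)
    qed
    finally show ?thesis using True by auto
  next
    case False
    then show ?thesis by (auto simp: X_def)
  qed
  have iso: "(\<Sum>a<d. \<Sum>b<d. sum_cmod_sq R (mat_app R (X l a b) v)) = sum_cmod_sq (r l) v" if "1 \<le> l" "l \<le> n" for l v
    by (rule gram_isometry[OF rR[OF that(2)] gram[OF that]])
  have ob: "op_bound d R 1 (X l)" if "1 \<le> l" "l \<le> n" for l
    unfolding op_bound_def using iso[OF that] sum_cmod_sq_mono[OF rR[of l]] that by simp
  have core: "core_product Xm (\<lambda>l. digit d (l - 1) x) (\<lambda>l. digit d (l - 1) y) l \<in> carrier_mat 1 (r l) \<and>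
      (\<forall>q. train d R X l x y q = (if q < r l then core_product Xm (\<lambda>l. digit d (l - 1) x) (\<lambda>l. digit d (l - 1) y) l $$ (0, q) else 0))"
    if "l \<le> n" for l x y
    using that
  proof (induction l)
    case 0
    then show ?case by (auto simp: r0)
  next
    case (Suc l)
    let ?c = "core_product Xm (\<lambda>l. digit d (l - 1) x) (\<lambda>l. digit d (l - 1) y)"
    let ?Y = "Xm (Suc l) (digit d l x) (digit d l y)"
    have Y: "?Y \<in> carrier_mat (r l) (r (Suc l))"
      using car[of "Suc l" "digit d l x" "digit d l y"] Suc.prems d by (simp add: digit_less)
    have c: "?c l \<in> carrier_mat 1 (r l)" using Suc by simp
    have "train d R X (Suc l) x y q = (if q < r (Suc l) then ?c (Suc l) $$ (0, q) else 0)" for q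
    proof -
      have "train d R X (Suc l) x y q = (\<Sum>p<r l. ?c l $$ (0, p) * X (Suc l) (digit d l x) (digit d l y) p q)"
        using Suc rR[of l] by (auto simp: extend_train_def intro!: sum.mono_neutral_cong_right split: if_splits)
      also have "\<dots> = (if q < r (Suc l) then ?c (Suc l) $$ (0, q) else 0)"
        using Y c by (auto simp: X_def scalar_prod_def lessThan_atLeast0)
      finally show ?thesis .
    qed
    then show ?case using Y c by auto
  qed
  have entry: "\<rho> $$ (x, y) = train d R X n x y 0" if "x < d ^ n" "y < d ^ n" for x y
  proof -
    have "multi_index d n (\<lambda>l. digit d (l - 1) z) = z" if "z < d ^ n" for z
      using sum_digits[where d = d and n = n and x = z] that by (simp add: multi_index_def)
    then show ?thesis
      using val[of "\<lambda>l. digit d (l - 1) x" "\<lambda>l. digit d (l - 1) y"] core[of n x y] that d rn by (simp add: digit_less)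
  qed
  have "slice_norm_sq d R n (train d R X n) (\<lambda>q. if q = 0 then 1 else 0) = sum_cmod_sq (r n) (\<lambda>q. if q = 0 then 1 else 0)"
    by (rule slice_norm_sq_train_isometry[where r = r and X = X and n = n]) (auto simp: X_def d R r0 iso rR)
  then have "(\<Sum>x<d ^ n. \<Sum>y<d ^ n. (cmod (train d R X n x y 0))\<^sup>2) = 1"
    unfolding slice_norm_sq_unit[OF R] by (simp add: rn sum_cmod_sq_def)
  then have "frob_sq (d ^ n) (\<lambda>x y. \<rho> $$ (x, y)) = 1" by (simp add: frob_sq_def entry)
  then show ?thesis using ob entry by blast
qed

section \<open>Volumetric packing of the cores\<close>

lemma emeasure_lborel_affine:
  fixes t :: "'a::euclidean_space"
  assumes "c \<noteq> 0" "A \<in> sets borel"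
  shows "emeasure lborel ((\<lambda>x. t + c *\<^sub>R x) -` A) * ennreal (\<bar>c\<bar> ^ DIM('a)) = emeasure lborel A"
proof -
  have A: "A \<in> sets (distr lborel borel (\<lambda>x. t + c *\<^sub>R x))" using assms(2) by simp
  have "emeasure lborel A =
      emeasure (density (distr lborel borel (\<lambda>x. t + c *\<^sub>R x)) (\<lambda>_. ennreal (\<bar>c\<bar> ^ DIM('a)))) A"
    using lborel_affine[OF assms(1), of t] by simp
  also have "\<dots> = ennreal (\<bar>c\<bar> ^ DIM('a)) * emeasure (distr lborel borel (\<lambda>x. t + c *\<^sub>R x)) A"
    by (rule emeasure_density_const[OF A])
  also have "emeasure (distr lborel borel (\<lambda>x. t + c *\<^sub>R x)) A = emeasure lborel ((\<lambda>x. t + c *\<^sub>R x) -` A)"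
    using assms(2) by (subst emeasure_distr) auto
  finally show ?thesis by (simp add: mult.commute)
qed

text \<open>Each complex coordinate counts as two real ones, whence the exponent
  \<open>2 * card I\<close>. A product measure is determined by its values on boxes, where the claim
  factorises.\<close>

lemma emeasure_PiM_lborel_affine:
  fixes t :: "'i \<Rightarrow> complex" and c :: real
  defines "L \<equiv> \<lambda>I. \<Pi>\<^sub>M i\<in>I. (lborel :: complex measure)"
  assumes I: "finite I" and c: "0 < c" and A: "A \<in> sets (L I)"
  shows "emeasure (L I) {x \<in> space (L I). (\<lambda>i\<in>I. t i + c *\<^sub>R x i) \<in> A} * ennreal (c ^ (2 * card I)) = emeasure (L I) A"
proof -
  let ?T = "\<lambda>x. \<lambda>i\<in>I. t i + c *\<^sub>R x i"
  let ?M = "scale_measure (ennreal (c ^ (2 * card I))) (distr (L I) (L I) ?T)"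
  interpret product_sigma_finite "\<lambda>_::'i. lborel :: complex measure" by unfold_locales
  have T: "?T \<in> measurable (L I) (L I)"
    unfolding L_def by (intro measurable_restrict) auto
  have "?M = L I"
    unfolding L_def
  proof (rule PiM_eqI[OF I])
    fix A :: "'i \<Rightarrow> complex set" assume A: "\<And>i. i \<in> I \<Longrightarrow> A i \<in> sets lborel"
    have pre: "?T -` Pi\<^sub>E I A \<inter> space (L I) = Pi\<^sub>E I (\<lambda>i. (\<lambda>x. t i + c *\<^sub>R x) -` A i)"
      unfolding L_def by (auto simp: space_PiM PiE_iff extensional_def)
    have m: "(\<lambda>x. t i + c *\<^sub>R x) -` A i \<in> sets lborel" if "i \<in> I" for i
      using measurable_sets[of "\<lambda>x. t i + c *\<^sub>R x" lborel borel "A i"] A[OF that] by simp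
    have c_pow: "ennreal (c ^ (2 * card I)) = (\<Prod>i\<in>I. ennreal (c\<^sup>2))"
      using c by (simp add: ennreal_power power_mult)
    have "emeasure ?M (Pi\<^sub>E I A) = ennreal (c ^ (2 * card I)) * emeasure (L I) (?T -` Pi\<^sub>E I A \<inter> space (L I))"
      using T A I by (subst emeasure_scale_measure, subst emeasure_distr) (auto simp: L_def intro!: sets_PiM_I_finite)
    also have "emeasure (L I) (?T -` Pi\<^sub>E I A \<inter> space (L I)) = (\<Prod>i\<in>I. emeasure lborel ((\<lambda>x. t i + c *\<^sub>R x) -` A i))"
      unfolding pre unfolding L_def by (rule emeasure_PiM[OF I m])
    also have "ennreal (c ^ (2 * card I)) * (\<Prod>i\<in>I. emeasure lborel ((\<lambda>x. t i + c *\<^sub>R x) -` A i)) =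
        (\<Prod>i\<in>I. emeasure lborel (A i))"
      unfolding c_pow prod.distrib[symmetric]
    proof (rule prod.cong[OF refl])
      fix i assume "i \<in> I"
      then show "ennreal (c\<^sup>2) * emeasure lborel ((\<lambda>x. t i + c *\<^sub>R x) -` A i) = emeasure lborel (A i)"
        using emeasure_lborel_affine[of c "A i" "t i"] A[of i] c by (simp add: mult.commute)
    qed
    finally show "emeasure (scale_measure (ennreal (c ^ (2 * card I))) (distr (\<Pi>\<^sub>M i\<in>I. lborel) (\<Pi>\<^sub>M i\<in>I. lborel) ?T)) (Pi\<^sub>E I A) =
        (\<Prod>i\<in>I. emeasure lborel (A i))" unfolding L_def .
  qed (simp add: L_def)
  then have "emeasure (L I) A = emeasure ?M A" by simp
  also have "\<dots> = ennreal (c ^ (2 * card I)) * emeasure (L I) (?T -` A \<inter> space (L I))"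
    using T A by (simp add: emeasure_distr)
  also have "?T -` A \<inter> space (L I) = {x \<in> space (L I). ?T x \<in> A}" by auto
  finally show ?thesis by (simp add: mult.commute)
qed

text \<open>\<open>B c\<close> stands for the ball of radius \<open>c\<close> of a norm on the
  coordinates in \<open>I\<close>, given by its properties so that the dimension can be a variable.
  Balls of radius \<open>\<epsilon> / 2\<close> around the points of \<open>S\<close> are disjoint
  and lie in the ball of radius \<open>1 + \<epsilon> / 2\<close>; comparing volumes gives the
  bound. The assumptions \<open>bounded\<close> and \<open>small\<close> make the volume of the unit
  ball finite and positive.\<close>

lemma packing_card_le:
  fixes B :: "real \<Rightarrow> ('i \<Rightarrow> complex) \<Rightarrow> bool"
  defines "L \<equiv> \<lambda>I. \<Pi>\<^sub>M i\<in>I. (lborel :: complex measure)"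
  assumes I: "finite I"
    and meas: "\<And>c. 0 < c \<Longrightarrow> {x \<in> space (L I). B c x} \<in> sets (L I)"
    and local: "\<And>c x y. (\<And>i. i \<in> I \<Longrightarrow> x i = y i) \<Longrightarrow> B c x \<Longrightarrow> B c y"
    and scale: "\<And>c x. 0 < c \<Longrightarrow> B c (\<lambda>i. c *\<^sub>R x i) \<longleftrightarrow> B 1 x"
    and add: "\<And>c e x y. 0 < c \<Longrightarrow> 0 < e \<Longrightarrow> B c x \<Longrightarrow> B e y \<Longrightarrow> B (c + e) (\<lambda>i. x i + y i)"
    and neg: "\<And>c x. B c x \<Longrightarrow> B c (\<lambda>i. - x i)"
    and bounded: "\<And>x i. B 1 x \<Longrightarrow> i \<in> I \<Longrightarrow> cmod (x i) \<le> 1"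
    and small: "0 < \<eta>" "\<And>x. (\<And>i. i \<in> I \<Longrightarrow> cmod (x i) \<le> \<eta>) \<Longrightarrow> B 1 x"
    and S: "finite S" "\<And>x. x \<in> S \<Longrightarrow> B 1 x"
    and sep: "\<And>x y. x \<in> S \<Longrightarrow> y \<in> S \<Longrightarrow> x \<noteq> y \<Longrightarrow> \<not> B \<epsilon> (\<lambda>i. x i - y i)" and \<epsilon>: "0 < \<epsilon>"
  shows "real (card S) \<le> (1 + 2 / \<epsilon>) ^ (2 * card I)"
proof -
  interpret product_sigma_finite "\<lambda>_::'i. lborel :: complex measure" by unfold_locales
  let ?n = "2 * card I"
  define b where "b s c = {x \<in> space (L I). B c (\<lambda>i. x i - s i)}" for s c
  define V where "V = emeasure (L I) {x \<in> space (L I). B 1 x}"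
  have b: "b s c \<in> sets (L I)" "emeasure (L I) (b s c) = V * ennreal (c ^ ?n)" if c: "0 < c" for s c
  proof -
    have "(\<lambda>x. \<lambda>i\<in>I. x i - s i) \<in> measurable (L I) (L I)"
      unfolding L_def by (intro measurable_restrict) auto
    from measurable_sets[OF this meas[OF c]]
    have "(\<lambda>x. \<lambda>i\<in>I. x i - s i) -` {x \<in> space (L I). B c x} \<inter> space (L I) \<in> sets (L I)" .
    also have "(\<lambda>x. \<lambda>i\<in>I. x i - s i) -` {x \<in> space (L I). B c x} \<inter> space (L I) = b s c"
    proof -
      have "B c (\<lambda>i\<in>I. x i - s i) \<longleftrightarrow> B c (\<lambda>i. x i - s i)" for x
        by (intro iffI; erule local[rotated]) auto
      then show ?thesis unfolding b_def by (auto simp: L_def space_PiM)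
    qed
    finally show bs: "b s c \<in> sets (L I)" .
    have "{x \<in> space (L I). (\<lambda>i\<in>I. s i + c *\<^sub>R x i) \<in> b s c} = {x \<in> space (L I). B 1 x}"
    proof -
      have "B c (\<lambda>i. (\<lambda>i\<in>I. s i + c *\<^sub>R x i) i - s i) \<longleftrightarrow> B c (\<lambda>i. c *\<^sub>R x i)" for x
        by (intro iffI; erule local[rotated]) auto
      then show ?thesis using scale[OF c] unfolding b_def by (auto simp: L_def space_PiM)
    qed
    then show "emeasure (L I) (b s c) = V * ennreal (c ^ ?n)"
      using emeasure_PiM_lborel_affine[OF I c bs[unfolded L_def], of s] unfolding V_def L_def by simp
  qed
  have V_fin: "V < \<infinity>"
  proof -
    have "V \<le> emeasure (L I) (Pi\<^sub>E I (\<lambda>_. cball 0 1))"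
      unfolding V_def using bounded I
      by (intro emeasure_mono) (auto simp: L_def space_PiM PiE_iff dist_norm extensional_def intro!: sets_PiM_I_finite)
    also have "\<dots> = (\<Prod>i\<in>I. emeasure lborel (cball (0::complex) 1))"
      unfolding L_def by (rule emeasure_PiM[OF I]) auto
    also have "\<dots> < \<infinity>"
      using emeasure_lborel_cball_finite[of "0::complex" 1] by (auto simp: less_top[symmetric] power_eq_top_ennreal I)
    finally show ?thesis .
  qed
  have V_pos: "V \<noteq> 0"
  proof -
    have "emeasure lborel (cball (0::complex) \<eta>) \<noteq> 0"
    proof -
      have "0 < measure lborel (cball (0::complex) \<eta>)" using content_cball_pos[OF small(1), of "0::complex"] by simp
      then show ?thesis by (auto simp: measure_def)
    qed
    then have "0 < (\<Prod>i\<in>I. emeasure lborel (cball (0::complex) \<eta>))" by (simp add: I zero_less_iff_neq_zero)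
    also have "(\<Prod>i\<in>I. emeasure lborel (cball (0::complex) \<eta>)) = emeasure (L I) (Pi\<^sub>E I (\<lambda>_. cball 0 \<eta>))"
      unfolding L_def by (rule emeasure_PiM[OF I, symmetric]) auto
    also have "\<dots> \<le> V"
      unfolding V_def using small(2) meas[of 1]
      by (intro emeasure_mono) (auto simp: L_def space_PiM PiE_iff dist_norm)
    finally show ?thesis by simp
  qed
  have disj: "disjoint_family_on (\<lambda>s. b s (\<epsilon> / 2)) S"
    unfolding disjoint_family_on_def
  proof (intro ballI impI)
    fix s s' assume ss: "s \<in> S" "s' \<in> S" "s \<noteq> s'"
    show "b s (\<epsilon> / 2) \<inter> b s' (\<epsilon> / 2) = {}"
    proof (rule ccontr)
      assume "b s (\<epsilon> / 2) \<inter> b s' (\<epsilon> / 2) \<noteq> {}"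
      then obtain x where "B (\<epsilon> / 2) (\<lambda>i. x i - s i)" "B (\<epsilon> / 2) (\<lambda>i. x i - s' i)" by (auto simp: b_def)
      then have "B (\<epsilon> / 2 + \<epsilon> / 2) (\<lambda>i. (x i - s' i) + - (x i - s i))"
        using \<epsilon> by (intro add neg) auto
      then show False using sep[OF ss] by simp
    qed
  qed
  have sub: "(\<Union>s\<in>S. b s (\<epsilon> / 2)) \<subseteq> b (\<lambda>_. 0) (1 + \<epsilon> / 2)"
  proof
    fix x assume "x \<in> (\<Union>s\<in>S. b s (\<epsilon> / 2))"
    then obtain s where s: "s \<in> S" "x \<in> space (L I)" "B (\<epsilon> / 2) (\<lambda>i. x i - s i)" by (auto simp: b_def)
    then have "B (1 + \<epsilon> / 2) (\<lambda>i. s i + (x i - s i))" using \<epsilon> by (intro add S(2)) auto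
    then show "x \<in> b (\<lambda>_. 0) (1 + \<epsilon> / 2)" using s by (simp add: b_def)
  qed
  have "(\<Sum>s\<in>S. emeasure (L I) (b s (\<epsilon> / 2))) = emeasure (L I) (\<Union>s\<in>S. b s (\<epsilon> / 2))"
    using b(1)[of "\<epsilon> / 2"] \<epsilon> disj S(1) by (intro sum_emeasure) auto
  also have "\<dots> \<le> emeasure (L I) (b (\<lambda>_. 0) (1 + \<epsilon> / 2))"
    using sub b(1)[of "1 + \<epsilon> / 2"] \<epsilon> by (intro emeasure_mono) auto
  finally have "of_nat (card S) * (V * ennreal ((\<epsilon> / 2) ^ ?n)) \<le> V * ennreal ((1 + \<epsilon> / 2) ^ ?n)"
    using b(2)[of "\<epsilon> / 2"] b(2)[of "1 + \<epsilon> / 2"] \<epsilon> by simp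
  moreover have "V = ennreal (enn2real V)" using V_fin by (simp add: less_top)
  moreover have Vp: "0 < enn2real V" using V_fin V_pos by (simp add: enn2real_positive_iff less_top zero_less_iff_neq_zero)
  ultimately have "ennreal (real (card S) * (enn2real V * (\<epsilon> / 2) ^ ?n)) \<le> ennreal (enn2real V * (1 + \<epsilon> / 2) ^ ?n)"
    using \<epsilon> by (simp add: ennreal_mult ennreal_of_nat_eq_real_of_nat)
  then have "real (card S) * (enn2real V * (\<epsilon> / 2) ^ ?n) \<le> enn2real V * (1 + \<epsilon> / 2) ^ ?n"
    using Vp \<epsilon> by (subst (asm) ennreal_le_iff) auto
  then have "enn2real V * (real (card S) * (\<epsilon> / 2) ^ ?n) \<le> enn2real V * (1 + \<epsilon> / 2) ^ ?n" by (simp only: mult_ac)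
  then have "real (card S) * (\<epsilon> / 2) ^ ?n \<le> (1 + \<epsilon> / 2) ^ ?n" using Vp by simp
  then have "real (card S) \<le> (1 + \<epsilon> / 2) ^ ?n / (\<epsilon> / 2) ^ ?n" using \<epsilon> by (simp add: pos_le_divide_eq)
  also have "\<dots> = (1 + 2 / \<epsilon>) ^ ?n" using \<epsilon> by (simp add: power_divide[symmetric] add_divide_distrib add.commute)
  finally show ?thesis .
qed

text \<open>Both sides are continuous in the test vector. With a countable dense set of scalars this
  makes the ball of the operator norm a countable intersection, hence measurable.\<close>

lemma op_bound_dense:
  assumes D: "closure D = (UNIV :: complex set)"
    and le: "\<And>v. v \<in> ({..<R} \<rightarrow>\<^sub>E D) \<Longrightarrow> (\<Sum>a<d. \<Sum>b<d. sum_cmod_sq R (mat_app R (Y a b) v)) \<le> \<beta>\<^sup>2 * sum_cmod_sq R v"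
  shows "op_bound d R \<beta> Y"
  unfolding op_bound_def
proof
  fix v :: "nat \<Rightarrow> complex"
  have "\<exists>w. (\<forall>k. w k \<in> D) \<and> w \<longlonglongrightarrow> v q" for q
    using D closure_sequential[of "v q" D] by auto
  then obtain w where w: "\<And>q k. w q k \<in> D" "\<And>q. w q \<longlonglongrightarrow> v q" by metis
  let ?w = "\<lambda>k. \<lambda>q\<in>{..<R}. w q k"
  have lim: "(\<lambda>k. ?w k q) \<longlonglongrightarrow> v q" if "q < R" for q using w(2)[of q] that by simp
  have 1: "(\<lambda>k. \<Sum>a<d. \<Sum>b<d. sum_cmod_sq R (mat_app R (Y a b) (?w k))) \<longlonglongrightarrow> (\<Sum>a<d. \<Sum>b<d. sum_cmod_sq R (mat_app R (Y a b) v))"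
    unfolding sum_cmod_sq_def mat_app_def using lim
    by (intro tendsto_sum tendsto_power tendsto_norm tendsto_mult tendsto_const) auto
  have 2: "(\<lambda>k. \<beta>\<^sup>2 * sum_cmod_sq R (?w k)) \<longlonglongrightarrow> \<beta>\<^sup>2 * sum_cmod_sq R v"
    unfolding sum_cmod_sq_def using lim
    by (intro tendsto_sum tendsto_power tendsto_norm tendsto_mult tendsto_const) auto
  show "(\<Sum>a<d. \<Sum>b<d. sum_cmod_sq R (mat_app R (Y a b) v)) \<le> \<beta>\<^sup>2 * sum_cmod_sq R v"
    by (rule LIMSEQ_le[OF 1 2]) (use le w(1) in auto)
qed

section \<open>The operator norm of cores satisfies the requirements of the packing bound\<close>

lemma op_bound_cong:
  assumes "\<And>a b p q. a < d \<Longrightarrow> b < d \<Longrightarrow> p < R \<Longrightarrow> q < R \<Longrightarrow> Y a b p q = Z a b p q"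
  shows "op_bound d R \<beta> Y \<longleftrightarrow> op_bound d R \<beta> Z"
  using assms by (simp add: op_bound_def sum_cmod_sq_def mat_app_def)

lemma op_bound_scale:
  assumes "0 < c" shows "op_bound d R c (\<lambda>a b p q. c *\<^sub>R Y a b p q) \<longleftrightarrow> op_bound d R 1 Y"
proof -
  have "sum_cmod_sq R (mat_app R (\<lambda>p q. c *\<^sub>R Y a b p q) v) = c\<^sup>2 * sum_cmod_sq R (mat_app R (Y a b) v)" for a b v
    using assms by (simp add: sum_cmod_sq_def mat_app_def scaleR_sum_right[symmetric] power_mult_distrib sum_distrib_left)
  then show ?thesis
    using assms by (simp add: op_bound_def sum_distrib_left[symmetric])
qed

lemma op_bound_neg: "op_bound d R \<beta> (\<lambda>a b p q. - Y a b p q) \<longleftrightarrow> op_bound d R \<beta> Y"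
  by (simp add: op_bound_def sum_cmod_sq_def mat_app_def sum_negf)

lemma op_bound_add:
  assumes "0 \<le> \<beta>" "0 \<le> \<gamma>" "op_bound d R \<beta> Y" "op_bound d R \<gamma> Z"
  shows "op_bound d R (\<beta> + \<gamma>) (\<lambda>a b p q. Y a b p q + Z a b p q)"
  unfolding op_bound_def
proof
  fix v
  let ?D = "{..<d} \<times> {..<d} \<times> {..<R}"
  let ?f = "\<lambda>Y. \<lambda>(a, b, p). cmod (mat_app R (Y a b) v p)"
  have L2: "sqrt (\<Sum>a<d. \<Sum>b<d. sum_cmod_sq R (mat_app R (Y a b) v)) = L2_set (?f Y) ?D" for Y
    by (simp add: L2_set_def sum_cmod_sq_def sum.cartesian_product case_prod_beta)
  have "L2_set (?f (\<lambda>a b p q. Y a b p q + Z a b p q)) ?D \<le> L2_set (\<lambda>z. ?f Y z + ?f Z z) ?D"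
    by (rule L2_set_mono) (auto simp: mat_app_def distrib_right sum.distrib norm_triangle_ineq)
  also have "\<dots> \<le> L2_set (?f Y) ?D + L2_set (?f Z) ?D" by (rule L2_set_triangle_ineq)
  also have "L2_set (?f Y) ?D \<le> \<beta> * sqrt (sum_cmod_sq R v)"
  proof -
    have "sqrt (\<Sum>a<d. \<Sum>b<d. sum_cmod_sq R (mat_app R (Y a b) v)) \<le> sqrt (\<beta>\<^sup>2 * sum_cmod_sq R v)"
      using assms(3) unfolding op_bound_def by (intro real_sqrt_le_mono) auto
    then show ?thesis using assms(1) unfolding L2 by (simp add: real_sqrt_mult)
  qed
  also have "L2_set (?f Z) ?D \<le> \<gamma> * sqrt (sum_cmod_sq R v)"
  proof -
    have "sqrt (\<Sum>a<d. \<Sum>b<d. sum_cmod_sq R (mat_app R (Z a b) v)) \<le> sqrt (\<gamma>\<^sup>2 * sum_cmod_sq R v)"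
      using assms(4) unfolding op_bound_def by (intro real_sqrt_le_mono) auto
    then show ?thesis using assms(2) unfolding L2 by (simp add: real_sqrt_mult)
  qed
  finally have "(sqrt (\<Sum>a<d. \<Sum>b<d. sum_cmod_sq R (mat_app R (\<lambda>p q. Y a b p q + Z a b p q) v)))\<^sup>2 \<le> ((\<beta> + \<gamma>) * sqrt (sum_cmod_sq R v))\<^sup>2"
    unfolding L2 by (intro power_mono) (auto simp: distrib_right L2_set_nonneg)
  then show "(\<Sum>a<d. \<Sum>b<d. sum_cmod_sq R (mat_app R (\<lambda>p q. Y a b p q + Z a b p q) v)) \<le> (\<beta> + \<gamma>)\<^sup>2 * sum_cmod_sq R v"
    by (simp add: power_mult_distrib sum_cmod_sq_nonneg sum_nonneg)
qed

lemma op_bound_entry: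
  assumes "op_bound d R 1 Y" "a < d" "b < d" "p < R" "q < R" shows "cmod (Y a b p q) \<le> 1"
proof -
  let ?v = "\<lambda>k. if k = q then 1 else 0 :: complex"
  have mat_app: "mat_app R (Y a b) ?v p = Y a b p q" for a b p
    unfolding mat_app_def using assms by (subst sum_one_point[of q]) auto
  have "sum_cmod_sq R ?v = 1" unfolding sum_cmod_sq_def using assms by (subst sum_one_point[of q]) auto
  then have "(\<Sum>a<d. \<Sum>b<d. \<Sum>p<R. (cmod (Y a b p q))\<^sup>2) \<le> 1"
    using assms(1)[unfolded op_bound_def, rule_format, of ?v] unfolding sum_cmod_sq_def mat_app by simp
  moreover have "(cmod (Y a b p q))\<^sup>2 \<le> (\<Sum>p<R. (cmod (Y a b p q))\<^sup>2)"
    using assms by (intro member_le_sum[of p]) auto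
  moreover have "(\<Sum>p<R. (cmod (Y a b p q))\<^sup>2) \<le> (\<Sum>b<d. \<Sum>p<R. (cmod (Y a b p q))\<^sup>2)"
    using assms by (intro member_le_sum[of b]) (auto intro!: sum_nonneg)
  moreover have "(\<Sum>b<d. \<Sum>p<R. (cmod (Y a b p q))\<^sup>2) \<le> (\<Sum>a<d. \<Sum>b<d. \<Sum>p<R. (cmod (Y a b p q))\<^sup>2)"
    using assms by (intro member_le_sum[of a]) (auto intro!: sum_nonneg)
  ultimately have "(cmod (Y a b p q))\<^sup>2 \<le> 1\<^sup>2" by simp
  then show ?thesis by (rule power2_le_imp_le) simp
qed

text \<open>The Frobenius norm dominates the operator norm, and a core has
  \<open>d\<^sup>2 * R\<^sup>2\<close> entries.\<close>

lemma op_bound_small: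
  assumes "0 < d" "0 < R"
    and "\<And>a b p q. a < d \<Longrightarrow> b < d \<Longrightarrow> p < R \<Longrightarrow> q < R \<Longrightarrow> cmod (Y a b p q) \<le> 1 / (real d * real R)"
  shows "op_bound d R 1 Y"
  unfolding op_bound_def
proof
  fix v
  have "sum_cmod_sq R (mat_app R (Y a b) v) \<le> sum_cmod_sq R v / (real d)\<^sup>2" if "a < d" "b < d" for a b
  proof -
    have "frob_sq R (Y a b) \<le> (\<Sum>p<R. \<Sum>q<R. (1 / (real d * real R))\<^sup>2)"
      unfolding frob_sq_def using assms(3) that by (intro sum_mono power_mono) auto
    also have "\<dots> = 1 / (real d)\<^sup>2" using assms(2) by (simp add: power2_eq_square)
    finally have "frob_sq R (Y a b) * sum_cmod_sq R v \<le> 1 / (real d)\<^sup>2 * sum_cmod_sq R v"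
      by (intro mult_right_mono sum_cmod_sq_nonneg)
    then show ?thesis using norm_mat_app_squared_le[of R "Y a b" v] unfolding sum_cmod_sq_def by simp
  qed
  then have "(\<Sum>a<d. \<Sum>b<d. sum_cmod_sq R (mat_app R (Y a b) v)) \<le> (\<Sum>a<d. \<Sum>b<d. sum_cmod_sq R v / (real d)\<^sup>2)"
    by (intro sum_mono) auto
  also have "\<dots> = 1\<^sup>2 * sum_cmod_sq R v" using assms(1) by (simp add: power2_eq_square)
  finally show "(\<Sum>a<d. \<Sum>b<d. sum_cmod_sq R (mat_app R (Y a b) v)) \<le> 1\<^sup>2 * sum_cmod_sq R v" .
qed

type_synonym core_index = "nat \<times> nat \<times> nat \<times> nat \<times> nat"

text \<open>The ball of radius \<open>c\<close> for the maximum over the sites of the operator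
  norms, the norm in which a train is Lipschitz with constant \<open>n\<close>.\<close>

definition cores_bound :: "nat \<Rightarrow> nat \<Rightarrow> nat \<Rightarrow> real \<Rightarrow> (core_index \<Rightarrow> complex) \<Rightarrow> bool" where
  "cores_bound n d R c x \<longleftrightarrow> (\<forall>l\<in>{1..n}. op_bound d R c (\<lambda>a b p q. x (l, a, b, p, q)))"

lemma cores_packing_card_le:
  assumes d: "0 < d" and R: "0 < R" and S: "finite S" "\<And>x. x \<in> S \<Longrightarrow> cores_bound n d R 1 x"
    and sep: "\<And>x y. x \<in> S \<Longrightarrow> y \<in> S \<Longrightarrow> x \<noteq> y \<Longrightarrow> \<not> cores_bound n d R \<epsilon> (\<lambda>i. x i - y i)" and \<epsilon>: "0 < \<epsilon>"
  shows "real (card S) \<le> (1 + 2 / \<epsilon>) ^ (2 * (n * d\<^sup>2 * R\<^sup>2))"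
proof -
  let ?I = "{1..n} \<times> {..<d} \<times> {..<d} \<times> {..<R} \<times> {..<R} :: core_index set"
  have card: "card ?I = n * d\<^sup>2 * R\<^sup>2" by (simp add: card_cartesian_product power2_eq_square mult_ac)
  have "real (card S) \<le> (1 + 2 / \<epsilon>) ^ (2 * card ?I)"
  proof (rule packing_card_le[where B = "cores_bound n d R" and \<eta> = "1 / (real d * real R)"])
    fix c :: real assume "0 < c"
    let ?L = "\<Pi>\<^sub>M i\<in>?I. (lborel :: complex measure)"
    obtain D :: "complex set" where D0: "countable D" "\<And>X. open X \<Longrightarrow> X \<noteq> {} \<Longrightarrow> \<exists>d\<in>D. d \<in> X"
      by (rule countable_dense_setE) blast
    have "x \<in> closure D" for x unfolding closure_iff_nhds_not_empty using D0(2) by blast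
    then have D: "countable D" "closure D = UNIV" using D0(1) by auto
    have eq: "cores_bound n d R c x \<longleftrightarrow> (\<forall>l\<in>{1..n}. \<forall>v\<in>({..<R} \<rightarrow>\<^sub>E D).
        (\<Sum>a<d. \<Sum>b<d. sum_cmod_sq R (mat_app R (\<lambda>p q. x (l, a, b, p, q)) v)) \<le> c\<^sup>2 * sum_cmod_sq R v)" for x
    proof
      assume "cores_bound n d R c x"
      then show "\<forall>l\<in>{1..n}. \<forall>v\<in>({..<R} \<rightarrow>\<^sub>E D).
          (\<Sum>a<d. \<Sum>b<d. sum_cmod_sq R (mat_app R (\<lambda>p q. x (l, a, b, p, q)) v)) \<le> c\<^sup>2 * sum_cmod_sq R v"
        unfolding cores_bound_def op_bound_def by blast
    qed (auto simp: cores_bound_def intro: op_bound_dense[OF D(2)])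
    have cD: "countable ({..<R} \<rightarrow>\<^sub>E D)" using D(1) by (intro countable_PiE) auto
    have "(\<lambda>x. x (l, a, b, p, q)) \<in> borel_measurable ?L"
      if "l \<in> {1..n}" "a < d" "b < d" "p < R" "q < R" for l a b p q
      using measurable_component_singleton[of "(l, a, b, p, q)" ?I "\<lambda>_. lborel :: complex measure"] that by simp
    then have m: "(\<lambda>x. \<Sum>a<d. \<Sum>b<d. sum_cmod_sq R (mat_app R (\<lambda>p q. x (l, a, b, p, q)) v)) \<in> borel_measurable ?L"
      if "l \<in> {1..n}" for l v
      unfolding sum_cmod_sq_def mat_app_def using that
      by (intro borel_measurable_sum borel_measurable_power borel_measurable_norm borel_measurable_times borel_measurable_const) auto
    have "Measurable.pred ?L (\<lambda>x. \<forall>l\<in>{1..n}. \<forall>v\<in>({..<R} \<rightarrow>\<^sub>E D).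
        (\<Sum>a<d. \<Sum>b<d. sum_cmod_sq R (mat_app R (\<lambda>p q. x (l, a, b, p, q)) v)) \<le> c\<^sup>2 * sum_cmod_sq R v)"
      using m cD by (intro pred_intros_countable_bounded borel_measurable_pred_less borel_measurable_const pred_le_const) auto
    then show "{x \<in> space ?L. cores_bound n d R c x} \<in> sets ?L" unfolding eq by (rule predE)
  next
    fix c and x y :: "core_index \<Rightarrow> complex"
    assume "\<And>i. i \<in> ?I \<Longrightarrow> x i = y i" "cores_bound n d R c x"
    then show "cores_bound n d R c y"
      unfolding cores_bound_def using op_bound_cong[of d R "\<lambda>a b p q. x (_, a, b, p, q)" "\<lambda>a b p q. y (_, a, b, p, q)" c] by auto
  next
    fix c :: real and x :: "core_index \<Rightarrow> complex" assume "0 < c"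
    then show "cores_bound n d R c (\<lambda>i. c *\<^sub>R x i) = cores_bound n d R 1 x"
      by (simp only: cores_bound_def op_bound_scale)
  next
    fix c e :: real and x y :: "core_index \<Rightarrow> complex" assume "0 < c" "0 < e" "cores_bound n d R c x" "cores_bound n d R e y"
    then show "cores_bound n d R (c + e) (\<lambda>i. x i + y i)"
      unfolding cores_bound_def using op_bound_add[of c e] by simp
  next
    fix c and x :: "core_index \<Rightarrow> complex" assume "cores_bound n d R c x"
    then show "cores_bound n d R c (\<lambda>i. - x i)" by (simp only: cores_bound_def op_bound_neg)
  next
    fix x :: "core_index \<Rightarrow> complex" and i assume "cores_bound n d R 1 x" "i \<in> ?I"
    then show "cmod (x i) \<le> 1" unfolding cores_bound_def using op_bound_entry by fastforce
  next
    fix x :: "core_index \<Rightarrow> complex" assume "\<And>i. i \<in> ?I \<Longrightarrow> cmod (x i) \<le> 1 / (real d * real R)"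
    then show "cores_bound n d R 1 x"
      unfolding cores_bound_def by (intro ballI op_bound_small[OF d R]) auto
  qed (use S sep \<epsilon> d R in auto)
  then show ?thesis unfolding card .
qed

section \<open>Nets of matrix product operators\<close>

definition entries :: "complex mat \<Rightarrow> nat \<Rightarrow> nat \<Rightarrow> complex" where
  "entries A x y = A $$ (x, y)"

lemma hermitian_entries:
  assumes "A \<in> carrier_mat N N" "hermitian A" shows "hermitian_on N (entries A)"
  unfolding hermitian_on_def
proof (intro allI impI)
  fix i j assume ij: "i < N" "j < N"
  have "entries A j i = mat_adjoint A $$ (j, i)" using assms(2) by (simp add: hermitian_def entries_def)
  also have "\<dots> = cnj (entries A i j)"
    using assms(1) ij by (simp add: mat_adjoint_def mat_of_rows_def entries_def)
  finally show "entries A j i = cnj (entries A i j)" .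
qed

lemma mat_inner_col_proj:
  assumes A: "A \<in> carrier_mat N N" "hermitian A" and U: "U \<in> carrier_mat N N" and k: "k < N"
  shows "cmod (mat_inner (col_proj U k) A) = \<bar>qform N (entries A) (col_fun k U)\<bar>"
proof -
  let ?u = "col_fun k U"
  have P: "col_proj U k \<in> carrier_mat N N" using U by (auto simp: col_proj_def mat_adjoint_def)
  have proj: "col_proj U k $$ (p, q) = ?u p * cnj (?u q)" if "p < N" "q < N" for p q
    using U k that by (simp add: col_proj_def mat_adjoint_def mat_of_rows_def mat_of_cols_def scalar_prod_def col_fun_def)
  have "mat_inner (col_proj U k) A = (\<Sum>p<N. \<Sum>q<N. cnj (col_proj U k $$ (q, p)) * A $$ (q, p))"
    unfolding mat_inner_def mat_trace_def using P A(1)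
    by (simp add: mat_adjoint_def mat_of_rows_def scalar_prod_def lessThan_atLeast0)
  also have "\<dots> = (\<Sum>p<N. \<Sum>q<N. cnj (?u q) * (A $$ (q, p) * ?u p))"
    by (intro sum.cong refl) (simp add: proj)
  also have "\<dots> = (\<Sum>q<N. cnj (?u q) * mat_app N (entries A) ?u q)"
    unfolding mat_app_def sum_distrib_left entries_def by (rule sum.swap)
  finally have eq: "mat_inner (col_proj U k) A = (\<Sum>q<N. cnj (?u q) * mat_app N (entries A) ?u q)" .
  have "z = cnj z \<Longrightarrow> cmod z = \<bar>Re z\<bar>" for z by (simp add: complex_eq_iff cmod_def)
  then show ?thesis
    unfolding eq qform_def using hermitian_mat_app_swap[OF hermitian_entries[OF A], of ?u ?u] by blast
qed

lemma qform_add: "qform N (\<lambda>x y. G x y + H x y) v = qform N G v + qform N H v"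
proof -
  have "mat_app N (\<lambda>x y. G x y + H x y) v i = mat_app N G v i + mat_app N H v i" for i
    by (simp add: mat_app_def distrib_right sum.distrib)
  then show ?thesis unfolding qform_def by (simp only: distrib_left sum.distrib plus_complex.sel)
qed

lemma qform_diff: "qform N (\<lambda>x y. G x y - H x y) v = qform N G v - qform N H v"
  using qform_add[of N "\<lambda>x y. G x y - H x y" H v] by simp

lemma mean_abs_triangle:
  "mean_abs N K Q G \<Phi> \<le> mean_abs N K Q H \<Phi> + mean_abs N K Q (\<lambda>x y. H x y - G x y) \<Phi>"
proof -
  have "(\<Sum>i<Q. \<Sum>k<K. \<bar>qform N G (col_fun k (\<Phi> i))\<bar>) \<le>
      (\<Sum>i<Q. \<Sum>k<K. \<bar>qform N H (col_fun k (\<Phi> i))\<bar> + \<bar>qform N (\<lambda>x y. H x y - G x y) (col_fun k (\<Phi> i))\<bar>)"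
    by (intro sum_mono) (simp add: qform_diff)
  then show ?thesis
    unfolding mean_abs_def distrib_left[symmetric] sum.distrib[symmetric] by (intro mult_left_mono) auto
qed

text \<open>Holds for every outcome, but is larger by a factor of order \<open>N\<close> than what
  is typical for a traceless matrix. It closes the chain at its finest scale.\<close>

lemma mean_abs_le:
  assumes "0 < K" "K \<le> N" "0 < Q" "\<And>i. i < Q \<Longrightarrow> \<Phi> i \<in> unitary_group N"
  shows "mean_abs N K Q H \<Phi> \<le> real N * sqrt (frob_sq N H)"
proof -
  have "(\<Sum>i<Q. \<Sum>k<K. \<bar>qform N H (col_fun k (\<Phi> i))\<bar>) \<le> (\<Sum>i<Q. \<Sum>k<K. sqrt (frob_sq N H))"
  proof (intro sum_mono)
    fix i k assume "i \<in> {..<Q}" "k \<in> {..<K}"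
    then have "(\<Sum>p<N. (cmod (col_fun k (\<Phi> i) p))\<^sup>2) = 1"
      unfolding col_fun_def using assms by (intro unitary_group_norm) auto
    then show "\<bar>qform N H (col_fun k (\<Phi> i))\<bar> \<le> sqrt (frob_sq N H)"
      using abs_qform_le[of N H "col_fun k (\<Phi> i)"] by simp
  qed
  then have "mean_abs N K Q H \<Phi> \<le> real N / (real K * real Q) * (\<Sum>i<Q. \<Sum>k<K. sqrt (frob_sq N H))"
    unfolding mean_abs_def by (intro mult_left_mono) auto
  then show ?thesis using assms by simp
qed

text \<open>Cauchy-Schwarz on the diagonal; limits the number of trace classes in the counting
  below.\<close>

lemma abs_re_trace_le: "\<bar>re_trace N H\<bar> \<le> sqrt (real N) * sqrt (frob_sq N H)"
proof -
  have "\<bar>re_trace N H\<bar> \<le> cmod (\<Sum>i<N. 1 * H i i)" unfolding re_trace_def using abs_Re_le_cmod by (simp del: Re_sum)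
  also have "\<dots> = sqrt ((cmod (\<Sum>i<N. 1 * H i i))\<^sup>2)" by simp
  also have "\<dots> \<le> sqrt ((\<Sum>i<N. (cmod 1)\<^sup>2) * (\<Sum>i<N. (cmod (H i i))\<^sup>2))"
    by (intro real_sqrt_le_mono cmod_sum_mult_squared_le)
  also have "\<dots> \<le> sqrt (real N * frob_sq N H)"
    unfolding frob_sq_def by (auto intro!: mult_left_mono sum_mono member_le_sum)
  finally show ?thesis by (simp add: real_sqrt_mult)
qed

lemma re_trace_diff: "re_trace N (\<lambda>x y. G x y - H x y) = re_trace N G - re_trace N H"
  by (simp add: re_trace_def sum_subtractf)

lemma sqrt_frob_sq_triangle:
  "sqrt (frob_sq N (\<lambda>x y. G x y - H x y)) \<le> sqrt (frob_sq N (\<lambda>x y. G x y - F x y)) + sqrt (frob_sq N (\<lambda>x y. F x y - H x y))"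
proof -
  let ?D = "{..<N} \<times> {..<N}"
  have L2: "sqrt (frob_sq N A) = L2_set (\<lambda>(x, y). cmod (A x y)) ?D" for A
    by (simp add: frob_sq_def L2_set_def sum.cartesian_product case_prod_beta)
  have "sqrt (frob_sq N (\<lambda>x y. G x y - H x y)) \<le>
      L2_set (\<lambda>z. (case z of (x, y) \<Rightarrow> cmod (G x y - F x y)) + (case z of (x, y) \<Rightarrow> cmod (F x y - H x y))) ?D"
    unfolding L2 by (rule L2_set_mono) (auto intro: norm_diff_triangle_ineq[THEN order_trans] norm_diff_triangle_le)
  also have "\<dots> \<le> sqrt (frob_sq N (\<lambda>x y. G x y - F x y)) + sqrt (frob_sq N (\<lambda>x y. F x y - H x y))"
    unfolding L2 by (rule L2_set_triangle_ineq)
  finally show ?thesis .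
qed

lemma frob_sq_diff_commute: "frob_sq N (\<lambda>x y. G x y - H x y) = frob_sq N (\<lambda>x y. H x y - G x y)"
  by (simp add: frob_sq_def norm_minus_commute)

text \<open>The trace is controlled separately: it contributes to the size of the quadratic forms
  as much as the Frobenius norm does, while it may be larger by a factor \<open>sqrt N\<close>.\<close>

definition close :: "nat \<Rightarrow> real \<Rightarrow> complex mat \<Rightarrow> complex mat \<Rightarrow> bool" where
  "close N \<epsilon> A B \<longleftrightarrow> sqrt (frob_sq N (\<lambda>x y. entries A x y - entries B x y)) \<le> \<epsilon> \<and>
    \<bar>re_trace N (entries A) - re_trace N (entries B)\<bar> \<le> \<epsilon>"

lemma close_commute: "close N \<epsilon> A B \<longleftrightarrow> close N \<epsilon> B A"
  unfolding close_def by (simp add: frob_sq_diff_commute[of N "entries A"] abs_minus_commute)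

lemma close_refl: "0 \<le> \<epsilon> \<Longrightarrow> close N \<epsilon> A A"
  by (simp add: close_def frob_sq_def)

lemma close_trans: "close N \<epsilon> A B \<Longrightarrow> close N \<delta> B C \<Longrightarrow> close N (\<epsilon> + \<delta>) A C"
  unfolding close_def using sqrt_frob_sq_triangle[of N "entries A" "entries C" "entries B"] by linarith

lemma card_le_card_image_mult:
  assumes S: "finite S" and B: "finite B" "f ` S \<subseteq> B" and le: "\<And>b. real (card {x \<in> S. f x = b}) \<le> m"
  shows "real (card S) \<le> real (card B) * m"
proof -
  have "S = (\<Union>b\<in>B. {x \<in> S. f x = b})" using B by auto
  then have "card S \<le> (\<Sum>b\<in>B. card {x \<in> S. f x = b})"
    using card_UN_le[OF B(1), of "\<lambda>b. {x \<in> S. f x = b}"] by simp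
  then have "real (card S) \<le> (\<Sum>b\<in>B. real (card {x \<in> S. f x = b}))"
    by (simp flip: of_nat_sum)
  also have "\<dots> \<le> (\<Sum>b\<in>B. m)" by (intro sum_mono le)
  finally show ?thesis by simp
qed

text \<open>The first factor counts classes of matrices whose traces fall into the same interval of
  length \<epsilon>. Inside a class, separation must come from the Frobenius norm, so the cores are
  separated at scale \<open>\<epsilon> / n\<close> by the Lipschitz bound, and the packing bound
  applies to them.\<close>

lemma mpo_separated_card_le:
  assumes n: "2 \<le> n" and d: "0 < d" and R: "0 < R" and \<epsilon>: "0 < \<epsilon>"
    and S: "finite S" "S \<subseteq> mpo_set d n R"
    and sep: "\<And>A B. A \<in> S \<Longrightarrow> B \<in> S \<Longrightarrow> A \<noteq> B \<Longrightarrow> \<not> close (d ^ n) \<epsilon> A B"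
  shows "real (card S) \<le> (2 * sqrt (real (d ^ n)) / \<epsilon> + 2) * (1 + 2 * real n / \<epsilon>) ^ (2 * (n * d\<^sup>2 * R\<^sup>2))"
proof -
  let ?N = "d ^ n"
  define s where "s = sqrt (real ?N) / \<epsilon>"
  define bucket where "bucket A = \<lfloor>re_trace ?N (entries A) / \<epsilon>\<rfloor>" for A
  have "\<forall>A\<in>mpo_set d n R. \<exists>X. (\<forall>l. 1 \<le> l \<longrightarrow> l \<le> n \<longrightarrow> op_bound d R 1 (X l)) \<and>
    (\<forall>x<?N. \<forall>y<?N. A $$ (x, y) = train d R X n x y 0)"
    using mpo_set_train[OF _ n d R] by blast
  \<comment> \<open>One fixed choice of cores per matrix. Cores are not unique, but any choice
    works, since only the map from cores to matrices has to be Lipschitz.\<close>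
  then obtain par where par: "\<And>A l. A \<in> mpo_set d n R \<Longrightarrow> 1 \<le> l \<Longrightarrow> l \<le> n \<Longrightarrow> op_bound d R 1 (par A l)"
    "\<And>A x y. A \<in> mpo_set d n R \<Longrightarrow> x < ?N \<Longrightarrow> y < ?N \<Longrightarrow> A $$ (x, y) = train d R (par A) n x y 0"
    by metis
  define cores where "cores A = (\<lambda>(l, a, b, p, q). par A l a b p q)" for A
  have s0: "0 \<le> s" using \<epsilon> by (simp add: s_def)
  have re_trace_le: "\<bar>re_trace ?N (entries A) / \<epsilon>\<bar> \<le> s" if "A \<in> S" for A
  proof -
    have "frob_sq ?N (entries A) = 1" using mpo_set_train[OF _ n d R, of A] S that by (auto simp: entries_def[abs_def])
    then show ?thesis using abs_re_trace_le[of ?N "entries A"] \<epsilon> by (simp add: s_def divide_right_mono)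
  qed
  have buckets: "bucket ` S \<subseteq> {\<lfloor>- s\<rfloor>..\<lfloor>s\<rfloor>}"
  proof
    fix z assume "z \<in> bucket ` S"
    then obtain A where A: "A \<in> S" "z = bucket A" by blast
    have "- s \<le> re_trace ?N (entries A) / \<epsilon>" "re_trace ?N (entries A) / \<epsilon> \<le> s" using re_trace_le[OF A(1)] by linarith+
    then show "z \<in> {\<lfloor>- s\<rfloor>..\<lfloor>s\<rfloor>}" unfolding A(2) bucket_def by (auto intro: floor_mono)
  qed
  have card_buckets: "real (card {\<lfloor>- s\<rfloor>..\<lfloor>s\<rfloor>}) \<le> 2 * s + 2"
  proof -
    have "\<lfloor>- s\<rfloor> \<le> \<lfloor>s\<rfloor>" using s0 by (intro floor_mono) simp
    then have "real (card {\<lfloor>- s\<rfloor>..\<lfloor>s\<rfloor>}) = of_int \<lfloor>s\<rfloor> - of_int \<lfloor>- s\<rfloor> + 1" by simp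
    then show ?thesis by linarith
  qed
  have in_bucket: "real (card {A \<in> S. bucket A = b}) \<le> (1 + 2 / (\<epsilon> / real n)) ^ (2 * (n * d\<^sup>2 * R\<^sup>2))" for b
  proof -
    let ?S = "{A \<in> S. bucket A = b}"
    have far: "\<not> cores_bound n d R (\<epsilon> / real n) (\<lambda>i. cores A i - cores B i)"
      if AB: "A \<in> ?S" "B \<in> ?S" "A \<noteq> B" for A B
    proof
      assume "cores_bound n d R (\<epsilon> / real n) (\<lambda>i. cores A i - cores B i)"
      then have "op_bound d R (\<epsilon> / real n) (\<lambda>a b p q. par A k a b p q - par B k a b p q)" if "1 \<le> k" "k \<le> n" for k
        using that by (simp add: cores_bound_def cores_def)
      then have "frob_sq ?N (\<lambda>x y. train d R (par A) n x y 0 - train d R (par B) n x y 0) \<le> (real n * (\<epsilon> / real n))\<^sup>2"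
        using AB S \<epsilon> by (intro frob_sq_train_diff_le d R par) auto
      moreover have "frob_sq ?N (\<lambda>x y. entries A x y - entries B x y) =
          frob_sq ?N (\<lambda>x y. train d R (par A) n x y 0 - train d R (par B) n x y 0)"
      proof -
        have "A \<in> mpo_set d n R" "B \<in> mpo_set d n R" using AB S by auto
        then show ?thesis
          unfolding frob_sq_def entries_def by (intro sum.cong refl) (simp only: par(2) lessThan_iff)
      qed
      ultimately have "frob_sq ?N (\<lambda>x y. entries A x y - entries B x y) \<le> \<epsilon>\<^sup>2" using n by simp
      then have "sqrt (frob_sq ?N (\<lambda>x y. entries A x y - entries B x y)) \<le> \<epsilon>"
        using \<epsilon> by (intro real_le_lsqrt) auto
      moreover have "\<bar>re_trace ?N (entries A) - re_trace ?N (entries B)\<bar> \<le> \<epsilon>"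
      proof -
        have "\<lfloor>re_trace ?N (entries A) / \<epsilon>\<rfloor> = \<lfloor>re_trace ?N (entries B) / \<epsilon>\<rfloor>" using AB by (simp add: bucket_def)
        then have "\<bar>re_trace ?N (entries A) / \<epsilon> - re_trace ?N (entries B) / \<epsilon>\<bar> \<le> 1" by linarith
        then show ?thesis using \<epsilon> by (simp add: diff_divide_distrib[symmetric] abs_divide)
      qed
      ultimately show False using sep[of A B] AB by (auto simp: close_def)
    qed
    \<comment> \<open>A vanishing difference lies in every ball, so distinct members of a class
      cannot share their cores and the count is not lost in passing to cores.\<close>
    have "cores_bound n d R (\<epsilon> / real n) (\<lambda>i. 0)"
      unfolding cores_bound_def op_bound_def by (simp add: mat_app_def sum_cmod_sq_def sum_nonneg)
    then have inj: "inj_on cores ?S"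
      using far by (intro inj_onI) fastforce
    have "real (card (cores ` ?S)) \<le> (1 + 2 / (\<epsilon> / real n)) ^ (2 * (n * d\<^sup>2 * R\<^sup>2))"
    proof (rule cores_packing_card_le[OF d R])
      show "cores_bound n d R 1 x" if "x \<in> cores ` ?S" for x
        using that S par(1) by (auto simp: cores_bound_def cores_def)
      show "\<not> cores_bound n d R (\<epsilon> / real n) (\<lambda>i. x i - y i)"
        if "x \<in> cores ` ?S" "y \<in> cores ` ?S" "x \<noteq> y" for x y
        using that far by blast
    qed (use S \<epsilon> n in auto)
    then show ?thesis by (simp add: card_image[OF inj])
  qed
  have "real (card S) \<le> real (card {\<lfloor>- s\<rfloor>..\<lfloor>s\<rfloor>}) * (1 + 2 / (\<epsilon> / real n)) ^ (2 * (n * d\<^sup>2 * R\<^sup>2))"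
    by (rule card_le_card_image_mult[OF S(1) _ buckets in_bucket]) simp
  also have "\<dots> \<le> (2 * s + 2) * (1 + 2 / (\<epsilon> / real n)) ^ (2 * (n * d\<^sup>2 * R\<^sup>2))"
    using \<epsilon> by (intro mult_right_mono card_buckets) auto
  finally show ?thesis by (simp add: s_def)
qed

text \<open>A separated set of greatest cardinality is a net, since a point far from all its members
  could be added. The uniform bound on cardinalities makes a greatest one exist, and the net
  consists of points of \<open>T\<close> itself.\<close>

lemma maximal_separated_net:
  fixes T :: "'a set" and r :: "'a \<Rightarrow> 'a \<Rightarrow> bool"
  assumes refl: "\<And>x. r x x" and sym: "\<And>x y. r x y \<Longrightarrow> r y x"
    and card_le: "\<And>S. finite S \<Longrightarrow> S \<subseteq> T \<Longrightarrow> (\<And>x y. x \<in> S \<Longrightarrow> y \<in> S \<Longrightarrow> x \<noteq> y \<Longrightarrow> \<not> r x y) \<Longrightarrow> real (card S) \<le> m"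
  obtains S where "finite S" "S \<subseteq> T" "real (card S) \<le> m" "\<And>x. x \<in> T \<Longrightarrow> \<exists>y\<in>S. r x y"
proof -
  define P where "P S \<longleftrightarrow> finite S \<and> S \<subseteq> T \<and> (\<forall>x\<in>S. \<forall>y\<in>S. x \<noteq> y \<longrightarrow> \<not> r x y)" for S
  have P_le: "real (card S) \<le> m" if "P S" for S using that unfolding P_def by (intro card_le) auto
  have "\<exists>S. P S \<and> (\<forall>S'. P S' \<longrightarrow> card S' \<le> card S)"
  proof (rule ex_has_greatest_nat[of P "{}" card "Suc (nat \<lfloor>m\<rfloor>)"])
    show "P {}" by (simp add: P_def)
    show "\<forall>S. P S \<longrightarrow> card S < Suc (nat \<lfloor>m\<rfloor>)"
    proof (intro allI impI)
      fix S assume "P S"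
      then have "real (card S) \<le> m" by (rule P_le)
      then show "card S < Suc (nat \<lfloor>m\<rfloor>)" by linarith
    qed
  qed
  then obtain S where S: "P S" "\<And>S'. P S' \<Longrightarrow> card S' \<le> card S" by blast
  show ?thesis
  proof (rule that[of S])
    fix x assume x: "x \<in> T"
    show "\<exists>y\<in>S. r x y"
    proof (rule ccontr)
      assume no: "\<not> (\<exists>y\<in>S. r x y)"
      then have "x \<notin> S" using refl by blast
      moreover have "P (insert x S)" using S(1) no sym x unfolding P_def by blast
      ultimately show False using S(2)[of "insert x S"] S(1) by (simp add: P_def)
    qed
  qed (use S P_le in \<open>auto simp: P_def\<close>)
qed

text \<open>Brings the packing bound into the form
  \<open>exp (A * (18 + 6 * ln (1 / \<epsilon>)))\<close>, where \<open>A\<close> is the sample size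
  of the theorem without its constant. Every lower-order term is charged to
  \<open>A\<close>.\<close>

lemma mpo_net:
  assumes n: "2 \<le> n" and d: "2 \<le> d" and R: "1 \<le> R" and \<epsilon>: "0 < \<epsilon>" "\<epsilon> \<le> 1"
  obtains S where "finite S" "S \<subseteq> mpo_set d n R"
    "real (card S) \<le> exp (real n * (real d)\<^sup>2 * (real R)\<^sup>2 * ln (real n) * (18 + 6 * ln (1 / \<epsilon>)))"
    "\<And>A. A \<in> mpo_set d n R \<Longrightarrow> \<exists>B\<in>S. close (d ^ n) \<epsilon> A B"
proof -
  let ?m = "(2 * sqrt (real (d ^ n)) / \<epsilon> + 2) * (1 + 2 * real n / \<epsilon>) ^ (2 * (n * d\<^sup>2 * R\<^sup>2))"
  define D where "D = real n * (real d)\<^sup>2 * (real R)\<^sup>2"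
  define L where "L = ln (1 / \<epsilon>)"
  have L: "0 \<le> L" using \<epsilon> by (simp add: L_def)
  have d2: "1 \<le> (real d)\<^sup>2" and R2: "1 \<le> (real R)\<^sup>2" using d R by (auto simp: one_le_power)
  have nd: "real n * (real d)\<^sup>2 \<le> D"
    unfolding D_def using mult_left_mono[OF R2, of "real n * (real d)\<^sup>2"] by simp
  have n_le: "real n \<le> real n * (real d)\<^sup>2" using d2 by (simp add: mult_le_cancel_left1)
  have D1: "1 \<le> D" using nd n_le n by linarith
  have ln_n: "1 / 2 \<le> ln (real n)"
  proof -
    have "1 / 2 \<le> ln (2::real)" using ln2_ge_two_thirds by simp
    also have "\<dots> \<le> ln (real n)" using n by simp
    finally show ?thesis .
  qed
  have ln3: "ln (3::real) \<le> 2" and ln4: "ln (4::real) \<le> 3" using ln_le_minus_one[of 3] ln_le_minus_one[of 4] by auto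
  have pos: "0 < 1 + 2 * real n / \<epsilon>" using \<epsilon> by (simp add: add_pos_nonneg)
  have "ln (1 + 2 * real n / \<epsilon>) \<le> ln (3 * real n * (1 / \<epsilon>))"
  proof (rule ln_mono)
    have "1 \<le> real n / \<epsilon>" using \<epsilon> n by (simp add: field_simps)
    then show "1 + 2 * real n / \<epsilon> \<le> 3 * real n * (1 / \<epsilon>)" by simp
  qed (use pos in auto)
  also have "\<dots> = ln 3 + ln (real n) + L" using \<epsilon> n by (simp add: ln_mult ln_div L_def)
  finally have l1: "ln (1 + 2 * real n / \<epsilon>) \<le> 2 + ln (real n) + L" using ln3 by linarith
  have "ln (2 * sqrt (real (d ^ n)) / \<epsilon> + 2) \<le> ln (4 * sqrt (real (d ^ n)) * (1 / \<epsilon>))"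
  proof (rule ln_mono)
    have "1 \<le> sqrt (real (d ^ n))" using d by (simp add: one_le_power)
    then have "1 * \<epsilon> \<le> sqrt (real (d ^ n))" using \<epsilon> by linarith
    then have "1 \<le> sqrt (real (d ^ n)) / \<epsilon>" using \<epsilon> by (subst pos_le_divide_eq)
    then show "2 * sqrt (real (d ^ n)) / \<epsilon> + 2 \<le> 4 * sqrt (real (d ^ n)) * (1 / \<epsilon>)" by simp
  qed (use \<epsilon> in \<open>auto intro!: add_nonneg_pos\<close>)
  also have "\<dots> = ln 4 + real n * ln (real d) / 2 + L"
    using \<epsilon> d by (simp add: ln_mult ln_div ln_sqrt ln_realpow L_def)
  \<comment> \<open>The price of the trace classes, \<open>n * ln d / 2\<close>, is at most
    \<open>n * d\<^sup>2\<close> and so disappears in \<open>D\<close>.\<close>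
  also have "\<dots> \<le> 3 + D + L"
  proof -
    have "ln (real d) / 2 \<le> (real d)\<^sup>2"
    proof -
      have "ln (real d) \<le> real d" using ln_le_minus_one[of "real d"] d by simp
      also have "\<dots> \<le> (real d)\<^sup>2" using d by (simp add: power2_eq_square)
      finally show ?thesis using d2 by linarith
    qed
    then have "real n * (ln (real d) / 2) \<le> real n * (real d)\<^sup>2" by (intro mult_left_mono) auto
    then show ?thesis using nd ln4 by simp
  qed
  finally have l2: "ln (2 * sqrt (real (d ^ n)) / \<epsilon> + 2) \<le> 3 + D + L" .
  have pos2: "0 < 2 * sqrt (real (d ^ n)) / \<epsilon> + 2" using \<epsilon> by (simp add: add_nonneg_pos)
  have "ln ?m = ln (2 * sqrt (real (d ^ n)) / \<epsilon> + 2) + 2 * D * ln (1 + 2 * real n / \<epsilon>)"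
    using pos pos2 by (simp add: ln_mult ln_realpow D_def)
  also have "\<dots> \<le> (3 + D + L) + 2 * D * (2 + ln (real n) + L)"
    using l1 l2 D1 by (intro add_mono mult_left_mono) auto
  also have "\<dots> \<le> D * ln (real n) * (18 + 6 * L)"
  proof -
    have "3 + L \<le> D * (3 + L)" using D1 L by (simp add: mult_le_cancel_right1)
    then have "(3 + D + L) + 2 * D * (2 + ln (real n) + L) \<le> D * (8 + 2 * ln (real n) + 3 * L)"
      by (simp add: algebra_simps)
    also have "\<dots> \<le> D * (ln (real n) * (18 + 6 * L))"
    proof (rule mult_left_mono)
      \<comment> \<open>As \<open>n \<ge> 2\<close>, the logarithm of \<open>n\<close> is at least
        \<open>1 / 2\<close>, which trades the constants \<open>8 + 3 * L\<close> for a multiple of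
        it.\<close>
      have "1 / 2 * (16 + 6 * L) \<le> ln (real n) * (16 + 6 * L)" using L by (intro mult_right_mono ln_n) auto
      then show "8 + 2 * ln (real n) + 3 * L \<le> ln (real n) * (18 + 6 * L)" by (simp add: algebra_simps)
    qed (use D1 in simp)
    finally show ?thesis by (simp add: mult.assoc)
  qed
  finally have "?m \<le> exp (D * ln (real n) * (18 + 6 * L))"
    using pos pos2 by (simp add: ln_le_cancel_iff[symmetric] del: ln_le_cancel_iff)
  then have m: "?m \<le> exp (real n * (real d)\<^sup>2 * (real R)\<^sup>2 * ln (real n) * (18 + 6 * ln (1 / \<epsilon>)))"
    by (simp only: D_def L_def)
  obtain S where S: "finite S" "S \<subseteq> mpo_set d n R" "real (card S) \<le> ?m"
      "\<And>A. A \<in> mpo_set d n R \<Longrightarrow> \<exists>B\<in>S. close (d ^ n) \<epsilon> A B"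
  proof (rule maximal_separated_net[of "close (d ^ n) \<epsilon>" "mpo_set d n R" ?m])
    show "close (d ^ n) \<epsilon> A A" for A using \<epsilon> by (intro close_refl) simp
    show "close (d ^ n) \<epsilon> A B \<Longrightarrow> close (d ^ n) \<epsilon> B A" for A B by (simp add: close_commute)
    show "real (card S) \<le> ?m" if "finite S" "S \<subseteq> mpo_set d n R"
      "\<And>x y. x \<in> S \<Longrightarrow> y \<in> S \<Longrightarrow> x \<noteq> y \<Longrightarrow> \<not> close (d ^ n) \<epsilon> x y" for S
      using that n d R \<epsilon> by (intro mpo_separated_card_le) auto
  qed blast
  then show ?thesis using m that by (meson order_trans)
qed

section \<open>Chaining\<close>

text \<open>The allowances of the links: \<open>j + 4\<close> standard deviations, so to speak, at
  scale \<open>2 ^ (- j)\<close>. The full series has the value \<open>2 + 8\<close>.\<close>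

lemma sum_chaining_weights: "(\<Sum>j<J. (real j + 4) / 2 ^ j) \<le> 10"
proof -
  have "(\<Sum>j<J. (real j + 4) / 2 ^ j) = 10 - (2 * real J + 10) / 2 ^ J"
  proof (induction J)
    case (Suc J)
    have "(2 * real (Suc J) + 10) / 2 ^ Suc J = (real J + 6) / 2 ^ J" by (simp add: field_simps)
    then show ?case using Suc by (simp add: add_divide_distrib)
  qed simp
  then show ?thesis by simp
qed

text \<open>The constant of \<open>expectation_abs_qform_bounds\<close>, which is also the level in
  \<open>mean_abs_lower_tail\<close>.\<close>

definition lower_const :: real where "lower_const = 1 / 16384"
text \<open>The links of the chain lose at most 80 times this scale, a quarter of
  \<open>lower_const\<close>, and its end loses the scale once more, so more than half of
  \<open>lower_const\<close> survives.\<close>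

definition net_scale :: real where "net_scale = lower_const / 320"
text \<open>Two consecutive nets together have log-cardinality at most
  \<open>A * (36 + 6 * (2 * j + 1) + 12 * ln (1 / net_scale))\<close>; this is the value at
  \<open>j = 0\<close>, as \<open>36 + 6 = 42\<close>.\<close>

definition net_weight :: real where "net_weight = 42 + 12 * ln (1 / net_scale)"
text \<open>Chosen so that the entropy \<open>A * net_weight\<close> is at most
  \<open>lower_const\<^sup>2 / 8 * Q\<close>, half of the exponent in the lower tail bound.\<close>

definition sample_const :: real where "sample_const = 8 * net_weight / lower_const\<^sup>2"

lemma const_bounds:
  "0 < lower_const" "lower_const \<le> 1" "0 < net_scale" "net_scale \<le> 1" "0 \<le> ln (1 / net_scale)" "42 \<le> net_weight"
  "0 < sample_const"
proof -
  show c: "0 < lower_const" "lower_const \<le> 1" "0 < net_scale" "net_scale \<le> 1"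
    by (simp_all add: lower_const_def net_scale_def)
  show l: "0 \<le> ln (1 / net_scale)" by (simp add: lower_const_def net_scale_def)
  show w: "42 \<le> net_weight" using l by (simp add: net_weight_def)
  show "0 < sample_const" using w c by (simp add: sample_const_def)
qed

text \<open>\<open>E\<close> is the complement of finitely many bad events, each attached to a net
  point or to a pair of neighbouring net points. It is therefore measurable by construction, and the
  uniform bound on it is deterministic.\<close>

lemma mpo_mean_abs_event:
  fixes n d R Q K :: nat and \<mu> :: "complex mat measure"
  assumes n: "2 \<le> n" and d: "2 \<le> d" and R: "1 \<le> R" and Q0: "1 \<le> Q" and K: "1 \<le> K" "K \<le> d ^ n"
    and haar: "haar_unitary (d ^ n) \<mu>"
    and Q: "sample_const * real n * (real d)\<^sup>2 * (real R)\<^sup>2 * ln (real n) \<le> real Q"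
  obtains E where "E \<in> sets (\<Pi>\<^sub>M i\<in>{..<Q}. \<mu>)"
    "1 - exp (- (lower_const\<^sup>2 / 16) * real Q) \<le> measure (\<Pi>\<^sub>M i\<in>{..<Q}. \<mu>) E"
    "\<And>\<Phi> A. \<Phi> \<in> E \<Longrightarrow> A \<in> mpo_set d n R \<Longrightarrow> lower_const / 2 \<le> mean_abs (d ^ n) K Q (entries A) \<Phi>"
proof -
  let ?N = "d ^ n" and ?T = "mpo_set d n R" and ?P = "\<Pi>\<^sub>M i\<in>{..<Q}. \<mu>"
  let ?c = lower_const and ?e = net_scale and ?W = net_weight
  note cb = const_bounds
  interpret haar ?N \<mu> by unfold_locales (rule haar)
  interpret P: prob_space ?P by (intro prob_space_PiM prob_space_axioms)
  have K': "0 < K" "K \<le> ?N" and Q': "0 < Q" using K Q0 by auto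
  note meas [measurable] = measurable_mean_abs[OF K' Q']
  define A where "A = real n * (real d)\<^sup>2 * (real R)\<^sup>2 * ln (real n)"
  define \<epsilon> where "\<epsilon> j = ?e / 2 ^ j" for j :: nat
  have \<epsilon>: "0 < \<epsilon> j" "\<epsilon> j \<le> 1" "\<epsilon> (Suc j) \<le> \<epsilon> j" for j
  proof -
    have "(1::real) \<le> 2 ^ j" by simp
    then have "?e \<le> 2 ^ j" using cb(4) by linarith
    then show "0 < \<epsilon> j" "\<epsilon> j \<le> 1" "\<epsilon> (Suc j) \<le> \<epsilon> j" using cb(3) by (auto simp: \<epsilon>_def field_simps)
  qed
  have A1: "1 \<le> A"
  proof -
    have "1 \<le> real n * ln (real n)"
    proof -
      have "1 \<le> 2 * ln (2::real)" using ln2_ge_two_thirds by simp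
      also have "\<dots> \<le> real n * ln (real n)" using n by (intro mult_mono) auto
      finally show ?thesis .
    qed
    moreover have "1 \<le> (real d)\<^sup>2 * (real R)\<^sup>2" using d R by (simp add: one_le_power mult_ge1_I)
    ultimately have "1 * 1 \<le> (real n * ln (real n)) * ((real d)\<^sup>2 * (real R)\<^sup>2)" by (intro mult_mono) auto
    then show ?thesis by (simp add: A_def mult_ac)
  qed
  have AW: "A * ?W \<le> ?c\<^sup>2 / 8 * real Q"
  proof -
    have "sample_const * A \<le> real Q" using Q by (simp add: A_def mult.assoc)
    then have "?c\<^sup>2 / 8 * (sample_const * A) \<le> ?c\<^sup>2 / 8 * real Q" by (intro mult_left_mono) auto
    moreover have "?c\<^sup>2 / 8 * (sample_const * A) = A * ?W" using cb(1) by (simp add: sample_const_def)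
    ultimately show ?thesis by (simp only:)
  qed
  have c2: "?c\<^sup>2 \<le> 1" using cb by (simp add: power_le_one)
  have cQ: "42 \<le> ?c\<^sup>2 / 8 * real Q" using AW mult_mono[OF A1 cb(6)] A1 by simp
  have Q2: "42 \<le> real Q" using cQ mult_right_mono[OF c2, of "real Q"] by simp
  have AW2: "A * ?W \<le> real Q / 2" using AW mult_right_mono[OF c2, of "real Q"] by simp
  have "\<exists>S. finite S \<and> S \<subseteq> ?T \<and> real (card S) \<le> exp (A * (18 + 6 * ln (1 / \<epsilon> j))) \<and>
      (\<forall>B\<in>?T. \<exists>B'\<in>S. close ?N (\<epsilon> j) B B')" for j
    using mpo_net[OF n d R \<epsilon>(1,2)[of j]] unfolding A_def by metis
  then obtain S where S: "\<And>j. finite (S j)" "\<And>j. S j \<subseteq> ?T"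
      "\<And>j. real (card (S j)) \<le> exp (A * (18 + 6 * ln (1 / \<epsilon> j)))"
      "\<And>j B. B \<in> ?T \<Longrightarrow> \<exists>B'\<in>S j. close ?N (\<epsilon> j) B B'"
    by metis
  have ln_\<epsilon>: "ln (1 / \<epsilon> j) \<le> ln (1 / ?e) + real j" for j
  proof -
    have "ln (1 / \<epsilon> j) = ln (1 / ?e) + real j * ln 2"
      using cb(3) by (simp add: \<epsilon>_def ln_div ln_mult ln_realpow)
    also have "real j * ln 2 \<le> real j * 1" using ln_le_minus_one[of "2::real"] by (intro mult_left_mono) auto
    finally show ?thesis by simp
  qed
  \<comment> \<open>Approximations of the same matrix at levels \<open>j\<close> and
    \<open>j + 1\<close> are within \<open>2 * \<epsilon> j\<close> of each other, so the union
    bound can be confined to such pairs.\<close>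
  define pairs where "pairs j = {(B, B') \<in> S j \<times> S (Suc j). close ?N (2 * \<epsilon> j) B' B}" for j
  define bad0 where "bad0 = (\<Union>B\<in>S 0. {\<Phi> \<in> space ?P. mean_abs ?N K Q (entries B) \<Phi> \<le> ?c})"
  \<comment> \<open>The upper tail bound with \<open>\<kappa> = 2 * \<epsilon> j\<close> and
    \<open>s = j + 4\<close>: its base \<open>3 * exp (- s)\<close> is then at most
    \<open>exp (- (j + 2))\<close>, enough to beat the number of pairs.\<close>
  define bad where "bad j = (\<Union>p\<in>pairs j. {\<Phi> \<in> space ?P. 4 * (2 * \<epsilon> j) * (real j + 4) \<le>
      mean_abs ?N K Q (\<lambda>x y. entries (snd p) x y - entries (fst p) x y) \<Phi>})" for j
  have herm: "hermitian_on ?N (entries B)" if "B \<in> ?T" for B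
    using that by (intro hermitian_entries) (auto simp: mpo_set_def)
  have fro1: "frob_sq ?N (entries B) = 1" if "B \<in> ?T" for B
    using mpo_set_train[OF that n] d R by (auto simp: entries_def[abs_def])
  have fin_pairs: "finite (pairs j)" for j
    unfolding pairs_def using S(1) by (intro finite_subset[OF _ finite_cartesian_product[of "S j" "S (Suc j)"]]) auto
  have bad0_sets: "bad0 \<in> sets ?P" unfolding bad0_def using S(1) by (intro sets.finite_UN) auto
  have bad_sets: "bad j \<in> sets ?P" for j unfolding bad_def using fin_pairs by (intro sets.finite_UN) auto
  have p0: "P.prob bad0 \<le> exp (- (?c\<^sup>2 / 8) * real Q)"
  proof -
    have "P.prob bad0 \<le> (\<Sum>B\<in>S 0. P.prob {\<Phi> \<in> space ?P. mean_abs ?N K Q (entries B) \<Phi> \<le> ?c})"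
      unfolding bad0_def using S(1) by (intro P.finite_measure_subadditive_finite) auto
    also have "\<dots> \<le> (\<Sum>B\<in>S 0. exp (- ?c\<^sup>2 / 4 * real Q))"
    proof (rule sum_mono)
      fix B assume "B \<in> S 0"
      then have "B \<in> ?T" using S(2) by auto
      from mean_abs_lower_tail[OF K' Q' herm[OF this] fro1[OF this]]
      show "P.prob {\<Phi> \<in> space ?P. mean_abs ?N K Q (entries B) \<Phi> \<le> ?c} \<le> exp (- ?c\<^sup>2 / 4 * real Q)"
        by (simp add: lower_const_def)
    qed
    also have "\<dots> = real (card (S 0)) * exp (- ?c\<^sup>2 / 4 * real Q)" by simp
    also have "\<dots> \<le> exp (A * ?W) * exp (- ?c\<^sup>2 / 4 * real Q)"
    proof (rule mult_right_mono)
      have "18 + 6 * ln (1 / \<epsilon> 0) \<le> ?W" using cb(5) by (simp add: net_weight_def \<epsilon>_def)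
      then have "A * (18 + 6 * ln (1 / \<epsilon> 0)) \<le> A * ?W" using A1 by (intro mult_left_mono) auto
      then show "real (card (S 0)) \<le> exp (A * ?W)" using S(3)[of 0] by (meson exp_le_cancel_iff order_trans)
    qed simp
    also have "\<dots> = exp (A * ?W + - ?c\<^sup>2 / 4 * real Q)" by (rule exp_add[symmetric])
    also have "\<dots> \<le> exp (- (?c\<^sup>2 / 8) * real Q)" using AW by simp
    finally show ?thesis .
  qed
  have pj: "P.prob (bad j) \<le> exp (- real Q) * (1 / 2) ^ Suc j" for j
  proof -
    have "P.prob (bad j) \<le> (\<Sum>p\<in>pairs j. P.prob {\<Phi> \<in> space ?P. 4 * (2 * \<epsilon> j) * (real j + 4) \<le>
        mean_abs ?N K Q (\<lambda>x y. entries (snd p) x y - entries (fst p) x y) \<Phi>})"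
      unfolding bad_def using fin_pairs by (intro P.finite_measure_subadditive_finite) auto
    also have "\<dots> \<le> (\<Sum>p\<in>pairs j. exp (- (real j + 2) * real Q))"
    proof (rule sum_mono)
      fix p assume p: "p \<in> pairs j"
      let ?D = "\<lambda>x y. entries (snd p) x y - entries (fst p) x y"
      from p have T: "fst p \<in> ?T" "snd p \<in> ?T" and cl: "close ?N (2 * \<epsilon> j) (snd p) (fst p)"
        using S(2)[of j] S(2)[of "Suc j"] by (auto simp: pairs_def)
      have H: "hermitian_on ?N ?D"
        unfolding hermitian_on_def
      proof (intro allI impI)
        fix x y assume xy: "x < ?N" "y < ?N"
        have "entries (snd p) y x = cnj (entries (snd p) x y)" "entries (fst p) y x = cnj (entries (fst p) x y)"
          using herm[OF T(1)] herm[OF T(2)] xy unfolding hermitian_on_def by blast+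
        then show "?D y x = cnj (?D x y)" by simp
      qed
      have "frob_sq ?N ?D \<le> (2 * \<epsilon> j)\<^sup>2"
        using cl power_mono[of "sqrt (frob_sq ?N ?D)" "2 * \<epsilon> j" 2] by (simp add: close_def frob_sq_nonneg)
      moreover have "\<bar>re_trace ?N ?D\<bar> \<le> 2 * \<epsilon> j" using cl by (simp add: close_def re_trace_diff)
      ultimately have "P.prob {\<Phi> \<in> space ?P. 4 * (2 * \<epsilon> j) * (real j + 4) \<le> mean_abs ?N K Q ?D \<Phi>} \<le>
          (3 * exp (- (real j + 4))) ^ Q"
        using \<epsilon>(1)[of j] by (intro mean_abs_upper_tail[OF K' Q' H]) auto
      also have "\<dots> \<le> (exp 2 * exp (- (real j + 4))) ^ Q"
        using exp_ge_add_one_self[of 2] by (intro power_mono mult_right_mono) auto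
      also have "\<dots> = exp (- (real j + 2) * real Q)"
        by (simp add: exp_add[symmetric] exp_of_nat2_mult[symmetric])
      finally show "P.prob {\<Phi> \<in> space ?P. 4 * (2 * \<epsilon> j) * (real j + 4) \<le> mean_abs ?N K Q ?D \<Phi>} \<le> exp (- (real j + 2) * real Q)" .
    qed
    also have "\<dots> = real (card (pairs j)) * exp (- (real j + 2) * real Q)" by simp
    also have "\<dots> \<le> exp (real Q / 2 * (real j + 1)) * exp (- (real j + 2) * real Q)"
    proof (rule mult_right_mono)
      have "card (pairs j) \<le> card (S j \<times> S (Suc j))"
        using S(1) unfolding pairs_def by (intro card_mono) auto
      then have "real (card (pairs j)) \<le> real (card (S j)) * real (card (S (Suc j)))"
        by (simp add: card_cartesian_product flip: of_nat_mult)
      also have "\<dots> \<le> exp (A * (18 + 6 * ln (1 / \<epsilon> j))) * exp (A * (18 + 6 * ln (1 / \<epsilon> (Suc j))))"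
        by (intro mult_mono S(3)) auto
      also have "\<dots> = exp (A * (36 + 6 * ln (1 / \<epsilon> j) + 6 * ln (1 / \<epsilon> (Suc j))))"
        by (simp add: exp_add[symmetric] algebra_simps)
      \<comment> \<open>Halving the scale up to level \<open>j + 1\<close> adds at most
        \<open>12 * j\<close> to the weight, and \<open>42 \<le> net_weight\<close> absorbs this
        into the factor \<open>j + 1\<close>.\<close>
      also have "\<dots> \<le> exp (A * (?W * (real j + 1)))"
      proof -
        have "36 + 6 * ln (1 / \<epsilon> j) + 6 * ln (1 / \<epsilon> (Suc j)) \<le> ?W + 12 * real j"
          using ln_\<epsilon>[of j] ln_\<epsilon>[of "Suc j"] by (simp add: net_weight_def)
        also have "\<dots> \<le> ?W * (real j + 1)"
          using mult_right_mono[OF cb(6), of "real j"] by (simp add: algebra_simps)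
        finally show ?thesis using A1 by (simp add: mult_left_mono)
      qed
      also have "\<dots> \<le> exp (real Q / 2 * (real j + 1))"
        using mult_right_mono[OF AW2, of "real j + 1"] by (simp add: mult.assoc)
      finally show "real (card (pairs j)) \<le> exp (real Q / 2 * (real j + 1))" .
    qed simp
    \<comment> \<open>The exponents add up to \<open>- Q - (j + 1) * Q / 2\<close>; the second part
      makes the failure probabilities summable over the levels.\<close>
    also have "\<dots> = exp (- real Q) * exp (- (real Q / 2)) ^ Suc j"
      unfolding exp_add[symmetric] exp_of_nat_mult[symmetric]
      by (simp add: algebra_simps add_divide_distrib diff_divide_distrib)
    also have "\<dots> \<le> exp (- real Q) * (1 / 2) ^ Suc j"
    proof -
      have "exp (- (real Q / 2)) \<le> exp (- 1)" using Q2 by simp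
      also have "exp (- 1) \<le> (1 / 2 :: real)"
        using exp_ge_add_one_self[of 1] by (simp add: exp_minus field_simps)
      finally show ?thesis by (intro mult_left_mono power_mono) auto
    qed
    finally show ?thesis .
  qed
  \<comment> \<open>The chain may stop once \<open>2 ^ J\<close> reaches \<open>N\<close>. The
    generous choice \<open>J = N\<close> is harmless, because the failure bound is a geometric
    series whatever its length.\<close>
  define J where "J = ?N"
  define E where "E = space ?P - (bad0 \<union> (\<Union>j<J. bad j))"
  have UN_sets: "(\<Union>j<J. bad j) \<in> sets ?P" using bad_sets by (intro sets.finite_UN) auto
  show ?thesis
  proof (rule that[of E])
    show "E \<in> sets ?P" unfolding E_def using bad0_sets UN_sets by auto
    have "P.prob (\<Union>j<J. bad j) \<le> (\<Sum>j<J. P.prob (bad j))"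
      using bad_sets by (intro P.finite_measure_subadditive_finite) auto
    also have "\<dots> \<le> (\<Sum>j<J. exp (- real Q) * (1 / 2) ^ Suc j)" by (intro sum_mono pj)
    also have "\<dots> = exp (- real Q) * (1 - (1 / 2) ^ J)"
    proof -
      have "(\<Sum>j<J. (1 / 2 :: real) ^ Suc j) = 1 - (1 / 2) ^ J" by (induction J) simp_all
      then show ?thesis by (simp only: sum_distrib_left[symmetric])
    qed
    also have "\<dots> \<le> exp (- real Q) * 1" by (intro mult_left_mono) auto
    also have "\<dots> \<le> exp (- (?c\<^sup>2 / 8) * real Q)" using c2 mult_right_mono[of "?c\<^sup>2 / 8" 1 "real Q"] by simp
    finally have pU: "P.prob (\<Union>j<J. bad j) \<le> exp (- (?c\<^sup>2 / 8) * real Q)" .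
    have "P.prob (bad0 \<union> (\<Union>j<J. bad j)) \<le> P.prob bad0 + P.prob (\<Union>j<J. bad j)"
      using bad0_sets UN_sets by (rule measure_Un_le)
    also have "\<dots> \<le> 2 * exp (- (?c\<^sup>2 / 8) * real Q)" using p0 pU by simp
    \<comment> \<open>Half of the exponent is spent on the factor 2 from the two kinds of bad
      events, which is possible since \<open>Q\<close> is large by \<open>cQ\<close>.\<close>
    also have "\<dots> \<le> exp (?c\<^sup>2 / 16 * real Q) * exp (- (?c\<^sup>2 / 8) * real Q)"
    proof (rule mult_right_mono)
      show "2 \<le> exp (?c\<^sup>2 / 16 * real Q)" using exp_ge_add_one_self[of "?c\<^sup>2 / 16 * real Q"] cQ by linarith
    qed simp
    also have "\<dots> = exp (- (?c\<^sup>2 / 16) * real Q)" by (simp add: exp_add[symmetric])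
    finally show "1 - exp (- (?c\<^sup>2 / 16) * real Q) \<le> P.prob E"
      unfolding E_def using bad0_sets UN_sets by (subst P.prob_compl) auto
    fix \<Phi> B assume \<Phi>: "\<Phi> \<in> E" and B: "B \<in> ?T"
    obtain \<pi> where \<pi>: "\<And>j. \<pi> j \<in> S j" "\<And>j. close ?N (\<epsilon> j) B (\<pi> j)" using S(4)[OF B] by metis
    have sp: "\<Phi> \<in> space ?P" using \<Phi> by (simp add: E_def)
    have U: "\<Phi> i \<in> unitary_group ?N" if "i < Q" for i
      using sp that by (auto simp: space_PiM space_haar)
    have start: "?c < mean_abs ?N K Q (entries (\<pi> 0)) \<Phi>"
      using \<Phi> sp \<pi>(1)[of 0] by (auto simp: E_def bad0_def not_le)
    have link: "mean_abs ?N K Q (\<lambda>x y. entries (\<pi> (Suc j)) x y - entries (\<pi> j) x y) \<Phi> \<le> 8 * ?e * ((real j + 4) / 2 ^ j)"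
      if "j < J" for j
    proof -
      have "close ?N (\<epsilon> (Suc j) + \<epsilon> j) (\<pi> (Suc j)) (\<pi> j)"
        by (rule close_trans[OF _ \<pi>(2)]) (use \<pi>(2) close_commute in blast)
      then have "close ?N (2 * \<epsilon> j) (\<pi> (Suc j)) (\<pi> j)" using \<epsilon>(3)[of j] by (auto simp: close_def)
      then have "(\<pi> j, \<pi> (Suc j)) \<in> pairs j" using \<pi>(1) by (simp add: pairs_def)
      then have "\<not> 4 * (2 * \<epsilon> j) * (real j + 4) \<le> mean_abs ?N K Q (\<lambda>x y. entries (\<pi> (Suc j)) x y - entries (\<pi> j) x y) \<Phi>"
        using \<Phi> sp that by (fastforce simp: E_def bad_def)
      then show ?thesis by (simp add: \<epsilon>_def)
    qed
    have "mean_abs ?N K Q (entries (\<pi> 0)) \<Phi> \<le> mean_abs ?N K Q (entries (\<pi> j)) \<Phi> + 8 * ?e * (\<Sum>i<j. (real i + 4) / 2 ^ i)"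
      if "j \<le> J" for j
      using that
    proof (induction j)
      case (Suc j)
      have "mean_abs ?N K Q (entries (\<pi> j)) \<Phi> \<le> mean_abs ?N K Q (entries (\<pi> (Suc j))) \<Phi> + 8 * ?e * ((real j + 4) / 2 ^ j)"
        using mean_abs_triangle[of ?N K Q "entries (\<pi> j)" \<Phi> "entries (\<pi> (Suc j))"] link[of j] Suc.prems by simp
      then show ?case using Suc by (simp add: distrib_left)
    qed simp
    from this[of J] have "?c < mean_abs ?N K Q (entries (\<pi> J)) \<Phi> + 8 * ?e * (\<Sum>i<J. (real i + 4) / 2 ^ i)"
      using start by simp
    also have "8 * ?e * (\<Sum>i<J. (real i + 4) / 2 ^ i) \<le> 8 * ?e * 10"
      using cb(3) by (intro mult_left_mono sum_chaining_weights) auto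
    finally have 1: "?c < mean_abs ?N K Q (entries (\<pi> J)) \<Phi> + 80 * ?e" by simp
    \<comment> \<open>The step from the last net to \<open>B\<close> ranges over all of
      \<open>mpo_set\<close>, beyond the reach of a union bound. The deterministic bound loses a
      factor \<open>N\<close>, which the scale \<open>\<epsilon> J\<close> pays for.\<close>
    have "mean_abs ?N K Q (\<lambda>x y. entries B x y - entries (\<pi> J) x y) \<Phi> \<le> real ?N * sqrt (frob_sq ?N (\<lambda>x y. entries B x y - entries (\<pi> J) x y))"
      using U by (intro mean_abs_le K' Q')
    also have "\<dots> \<le> 2 ^ J * \<epsilon> J"
    proof (intro mult_mono)
      show "real ?N \<le> 2 ^ J" unfolding J_def by (metis less_exp less_imp_le of_nat_le_iff of_nat_numeral of_nat_power)
      show "sqrt (frob_sq ?N (\<lambda>x y. entries B x y - entries (\<pi> J) x y)) \<le> \<epsilon> J" using \<pi>(2)[of J] by (simp add: close_def)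
    qed (auto simp: frob_sq_nonneg)
    also have "\<dots> = ?e" by (simp add: \<epsilon>_def)
    finally have "mean_abs ?N K Q (entries (\<pi> J)) \<Phi> \<le> mean_abs ?N K Q (entries B) \<Phi> + ?e"
      using mean_abs_triangle[of ?N K Q "entries (\<pi> J)" \<Phi> "entries B"] by simp
    then show "?c / 2 \<le> mean_abs ?N K Q (entries B) \<Phi>"
      using 1 cb(1) by (simp add: net_scale_def)
  qed
qed

section \<open>Passage to the Euclidean norm of the measurements, and measurability of the uniform
  event\<close>

lemma vec_l2_norm_measurement_eq:
  assumes "0 < K" "K \<le> N" and A: "A \<in> carrier_mat N N" "hermitian A"
    and U: "\<And>i. i < Q \<Longrightarrow> \<Phi> i \<in> unitary_group N"
  shows "vec_l2_norm (measurement \<Phi> Q K A) = sqrt (\<Sum>i<Q. \<Sum>k<K. (qform N (entries A) (col_fun k (\<Phi> i)))\<^sup>2)"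
proof -
  have "(cmod (mat_inner (col_proj (\<Phi> i) k) A))\<^sup>2 = (qform N (entries A) (col_fun k (\<Phi> i)))\<^sup>2" if "i < Q" "k < K" for i k
    using mat_inner_col_proj[OF A, of "\<Phi> i" k] U[OF that(1)] that assms(2) by (simp add: unitary_group_def)
  then show ?thesis by (simp add: vec_l2_norm_measurement[OF assms(1)])
qed

lemma mean_abs_le_vec_l2_norm:
  assumes "0 < K" "K \<le> N" "0 < Q" and A: "A \<in> carrier_mat N N" "hermitian A"
    and U: "\<And>i. i < Q \<Longrightarrow> \<Phi> i \<in> unitary_group N"
  shows "mean_abs N K Q (entries A) \<Phi> * sqrt (real Q * real K) / real N \<le> vec_l2_norm (measurement \<Phi> Q K A)"
proof -
  let ?D = "{..<Q} \<times> {..<K}"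
  let ?q = "\<lambda>(i, k). \<bar>qform N (entries A) (col_fun k (\<Phi> i))\<bar>"
  have "vec_l2_norm (measurement \<Phi> Q K A) = sqrt (\<Sum>i<Q. \<Sum>k<K. (qform N (entries A) (col_fun k (\<Phi> i)))\<^sup>2)"
    by (rule vec_l2_norm_measurement_eq[OF assms(1,2) A]) (rule U)
  then have l2: "vec_l2_norm (measurement \<Phi> Q K A) = L2_set ?q ?D"
    by (simp add: L2_set_def sum.cartesian_product case_prod_beta)
  have "(\<Sum>i<Q. \<Sum>k<K. \<bar>qform N (entries A) (col_fun k (\<Phi> i))\<bar>) = (\<Sum>z\<in>?D. \<bar>1\<bar> * \<bar>?q z\<bar>)"
    by (simp add: sum.cartesian_product case_prod_beta)
  also have "\<dots> \<le> L2_set (\<lambda>_. 1) ?D * L2_set ?q ?D" by (rule L2_set_mult_ineq)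
  also have "L2_set (\<lambda>_. 1) ?D = sqrt (real Q * real K)" by (simp add: L2_set_def card_cartesian_product)
  finally have le: "(\<Sum>i<Q. \<Sum>k<K. \<bar>qform N (entries A) (col_fun k (\<Phi> i))\<bar>) \<le> sqrt (real Q * real K) * L2_set ?q ?D" .
  have "mean_abs N K Q (entries A) \<Phi> * sqrt (real Q * real K) / real N =
      (\<Sum>i<Q. \<Sum>k<K. \<bar>qform N (entries A) (col_fun k (\<Phi> i))\<bar>) * (sqrt (real Q * real K) / (real K * real Q))"
    using assms by (simp add: mean_abs_def)
  also have "\<dots> \<le> (sqrt (real Q * real K) * L2_set ?q ?D) * (sqrt (real Q * real K) / (real K * real Q))"
    by (intro mult_right_mono le) auto
  also have "\<dots> = L2_set ?q ?D * ((sqrt (real Q * real K) * sqrt (real Q * real K)) / (real K * real Q))"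
    by (simp only: times_divide_eq_right times_divide_eq_left mult_ac)
  also have "\<dots> = L2_set ?q ?D" using assms by (simp add: mult.commute)
  finally show ?thesis unfolding l2 .
qed

text \<open>A set that is not measurable has \<open>measure\<close> zero, so the probability bound
  includes this claim. The union of the nets of scales \<open>1 / (m + 1)\<close> is a countable
  dense subset of \<open>mpo_set\<close>, and for a fixed outcome the norm of the measurements is
  continuous in the matrix; the condition on this subset implies it everywhere.\<close>

lemma sets_mpo_lower_event:
  assumes n: "2 \<le> n" and d: "2 \<le> d" and R: "1 \<le> R" and K: "1 \<le> K" "K \<le> d ^ n" and haar: "haar_unitary (d ^ n) \<mu>"
  shows "{\<Phi> \<in> space (\<Pi>\<^sub>M i\<in>{..<Q}. \<mu>). \<forall>A\<in>mpo_set d n R. t \<le> vec_l2_norm (measurement \<Phi> Q K A)}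
    \<in> sets (\<Pi>\<^sub>M i\<in>{..<Q}. \<mu>)"
proof -
  let ?N = "d ^ n" and ?T = "mpo_set d n R" and ?P = "\<Pi>\<^sub>M i\<in>{..<Q}. \<mu>"
  interpret haar ?N \<mu> by unfold_locales (rule haar)
  define f where "f A \<Phi> = sqrt (\<Sum>i<Q. \<Sum>k<K. (qform ?N (entries A) (col_fun k (\<Phi> i)))\<^sup>2)" for A \<Phi>
  have U: "\<Phi> i \<in> unitary_group ?N" if "\<Phi> \<in> space ?P" "i < Q" for \<Phi> i
    using that by (auto simp: space_PiM space_haar)
  have f_eq: "vec_l2_norm (measurement \<Phi> Q K A) = f A \<Phi>" if "\<Phi> \<in> space ?P" "A \<in> ?T" for A \<Phi>
    unfolding f_def using that K U by (intro vec_l2_norm_measurement_eq) (auto simp: mpo_set_def)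
  have "(\<lambda>\<Phi>. qform ?N (entries A) (col_fun k (\<Phi> i))) \<in> borel_measurable ?P" if "i < Q" "k < K" for A i k
    using measurable_compose[OF measurable_component_singleton[of i "{..<Q}" "\<lambda>_. \<mu>"] measurable_qform_col[of k "entries A"]] that K
    by simp
  then have f_meas: "f A \<in> borel_measurable ?P" for A
    unfolding f_def[abs_def] by (intro borel_measurable_sqrt[THEN measurable_compose[rotated]] borel_measurable_sum borel_measurable_power) auto
  have "\<exists>S. finite S \<and> S \<subseteq> ?T \<and> (\<forall>B\<in>?T. \<exists>B'\<in>S. close ?N (1 / real (Suc m)) B B')" for m
  proof -
    have "0 < 1 / real (Suc m)" "1 / real (Suc m) \<le> 1" by auto
    from mpo_net[OF n d R this] show ?thesis by metis
  qed
  then obtain S where S: "\<And>m. finite (S m)" "\<And>m. S m \<subseteq> ?T"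
      "\<And>m B. B \<in> ?T \<Longrightarrow> \<exists>B'\<in>S m. close ?N (1 / real (Suc m)) B B'"
    by metis
  let ?S = "\<Union>m. S m"
  have dense: "t \<le> f B \<Phi>" if \<Phi>: "\<Phi> \<in> space ?P" and le: "\<forall>A\<in>?S. t \<le> f A \<Phi>" and B: "B \<in> ?T" for \<Phi> B
  proof -
    obtain \<pi> where \<pi>: "\<And>m. \<pi> m \<in> S m" "\<And>m. close ?N (1 / real (Suc m)) B (\<pi> m)" using S(3)[OF B] by metis
    have "(\<lambda>m. qform ?N (entries (\<pi> m)) (col_fun k (\<Phi> i))) \<longlonglongrightarrow> qform ?N (entries B) (col_fun k (\<Phi> i))"
      if "i < Q" "k < K" for i k
    proof (rule LIM_zero_cancel, rule tendsto_rabs_zero_cancel, rule tendsto_sandwich[OF _ _ tendsto_const])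
      show "(\<lambda>m. 1 / real (Suc m)) \<longlonglongrightarrow> 0" using LIMSEQ_inverse_real_of_nat by (simp add: inverse_eq_divide)
      have "\<bar>qform ?N (entries (\<pi> m)) (col_fun k (\<Phi> i)) - qform ?N (entries B) (col_fun k (\<Phi> i))\<bar> \<le> 1 / real (Suc m)" for m
      proof -
        have "(\<Sum>p<?N. (cmod (col_fun k (\<Phi> i) p))\<^sup>2) = 1"
          unfolding col_fun_def using U[OF \<Phi>] that K by (intro unitary_group_norm) auto
        then have "\<bar>qform ?N (\<lambda>x y. entries B x y - entries (\<pi> m) x y) (col_fun k (\<Phi> i))\<bar> \<le> sqrt (frob_sq ?N (\<lambda>x y. entries B x y - entries (\<pi> m) x y))"
          using abs_qform_le[of ?N "\<lambda>x y. entries B x y - entries (\<pi> m) x y" "col_fun k (\<Phi> i)"] by simp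
        also have "\<dots> \<le> 1 / real (Suc m)" using \<pi>(2)[of m] by (simp add: close_def)
        finally show ?thesis by (simp add: qform_diff abs_minus_commute)
      qed
      then show "\<forall>\<^sub>F m in sequentially. \<bar>qform ?N (entries (\<pi> m)) (col_fun k (\<Phi> i)) - qform ?N (entries B) (col_fun k (\<Phi> i))\<bar> \<le> 1 / real (Suc m)"
        by (intro always_eventually allI)
    qed auto
    then have "(\<lambda>m. f (\<pi> m) \<Phi>) \<longlonglongrightarrow> f B \<Phi>"
      unfolding f_def by (intro tendsto_real_sqrt tendsto_sum tendsto_power) auto
    then show ?thesis by (rule LIMSEQ_le_const) (use le \<pi>(1) in blast)
  qed
  have "{\<Phi> \<in> space ?P. \<forall>A\<in>?T. t \<le> vec_l2_norm (measurement \<Phi> Q K A)} = {\<Phi> \<in> space ?P. \<forall>A\<in>?S. t \<le> f A \<Phi>}"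
  proof (intro Collect_cong conj_cong refl iffI ballI)
    fix \<Phi> A assume "\<Phi> \<in> space ?P" "\<forall>A\<in>?T. t \<le> vec_l2_norm (measurement \<Phi> Q K A)" "A \<in> ?S"
    moreover from this have "A \<in> ?T" using S(2) by blast
    ultimately show "t \<le> f A \<Phi>" using f_eq by metis
  next
    fix \<Phi> A assume "\<Phi> \<in> space ?P" "\<forall>A\<in>?S. t \<le> f A \<Phi>" "A \<in> ?T"
    then show "t \<le> vec_l2_norm (measurement \<Phi> Q K A)" using dense f_eq by metis
  qed
  also have "\<dots> \<in> sets ?P"
  proof -
    note [measurable] = f_meas
    have "countable ?S" using S(1) by (intro countable_UN) (auto simp: countable_finite)
    moreover have "Measurable.pred ?P (\<lambda>\<Phi>. t \<le> f A \<Phi>)" for A by measurable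
    ultimately have "Measurable.pred ?P (\<lambda>\<Phi>. \<forall>A\<in>?S. t \<le> f A \<Phi>)"
      by (intro measurable_pred_countable(1))
    then show ?thesis by (rule predE)
  qed
  finally show ?thesis .
qed

theorem theorem4:
  shows "\<exists>(C::real) (c::real) (\<alpha>\<^sub>2::real). 0 < C \<and> 0 < c \<and> 0 < \<alpha>\<^sub>2 \<and>
    (\<forall>(n::nat) (d::nat) (rbar::nat) (Q::nat) (K::nat) (\<mu> :: complex mat measure).
       2 \<le> n \<and> 2 \<le> d \<and> 1 \<le> rbar \<and> 1 \<le> Q \<and> 1 \<le> K \<and> K \<le> d ^ n \<and>
       haar_unitary (d ^ n) \<mu> \<and>
       real Q \<ge> C * real n * (real d)\<^sup>2 * (real rbar)\<^sup>2 * ln (real n) \<longrightarrow>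
       measure (\<Pi>\<^sub>M i\<in>{..<Q}. \<mu>)
         {\<Phi> \<in> space (\<Pi>\<^sub>M i\<in>{..<Q}. \<mu>). \<forall>\<rho>\<in>mpo_set d n rbar.
            vec_l2_norm (measurement \<Phi> Q K \<rho>) \<ge> c * sqrt (real Q * real K) / real (d ^ n)}
       \<ge> 1 - exp (- \<alpha>\<^sub>2 * real Q))"
proof (rule exI[of _ sample_const], rule exI[of _ "lower_const / 2"], rule exI[of _ "lower_const\<^sup>2 / 16"],
    intro conjI allI impI)
  show "0 < sample_const" "0 < lower_const / 2" "0 < lower_const\<^sup>2 / 16" using const_bounds by auto
next
  fix n d R Q K :: nat and \<mu> :: "complex mat measure"
  assume *: "2 \<le> n \<and> 2 \<le> d \<and> 1 \<le> R \<and> 1 \<le> Q \<and> 1 \<le> K \<and> K \<le> d ^ n \<and> haar_unitary (d ^ n) \<mu> \<and>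
    sample_const * real n * (real d)\<^sup>2 * (real R)\<^sup>2 * ln (real n) \<le> real Q"
  then have n: "2 \<le> n" and d: "2 \<le> d" and R: "1 \<le> R" and Q0: "1 \<le> Q" and K: "1 \<le> K" "K \<le> d ^ n"
    and haar: "haar_unitary (d ^ n) \<mu>"
    and Q: "sample_const * real n * (real d)\<^sup>2 * (real R)\<^sup>2 * ln (real n) \<le> real Q"
    by blast+
  let ?N = "d ^ n" and ?P = "\<Pi>\<^sub>M i\<in>{..<Q}. \<mu>"
  let ?t = "lower_const / 2 * sqrt (real Q * real K) / real ?N"
  let ?F = "{\<Phi> \<in> space ?P. \<forall>\<rho>\<in>mpo_set d n R. ?t \<le> vec_l2_norm (measurement \<Phi> Q K \<rho>)}"
  interpret haar ?N \<mu> by unfold_locales (rule haar)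
  interpret P: prob_space ?P by (intro prob_space_PiM prob_space_axioms)
  obtain E where E: "E \<in> sets ?P" "1 - exp (- (lower_const\<^sup>2 / 16) * real Q) \<le> P.prob E"
      "\<And>\<Phi> A. \<Phi> \<in> E \<Longrightarrow> A \<in> mpo_set d n R \<Longrightarrow> lower_const / 2 \<le> mean_abs ?N K Q (entries A) \<Phi>"
    using mpo_mean_abs_event[OF n d R Q0 K haar Q] by blast
  \<comment> \<open>\<open>E\<close> bounds the averaged absolute values, \<open>?F\<close> is the
    event of the claim; the factor \<open>sqrt (Q * K) / N\<close> between them comes from
    Cauchy-Schwarz and the normalisation of \<open>mean_abs\<close>.\<close>
  have "E \<subseteq> ?F"
  proof
    fix \<Phi> assume \<Phi>: "\<Phi> \<in> E"
    then have sp: "\<Phi> \<in> space ?P" using E(1) sets.sets_into_space by blast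
    have "?t \<le> vec_l2_norm (measurement \<Phi> Q K A)" if A: "A \<in> mpo_set d n R" for A
    proof -
      have "?t \<le> mean_abs ?N K Q (entries A) \<Phi> * sqrt (real Q * real K) / real ?N"
        by (intro divide_right_mono mult_right_mono E(3)[OF \<Phi> A]) auto
      also have "\<dots> \<le> vec_l2_norm (measurement \<Phi> Q K A)"
        using A K Q0 sp by (intro mean_abs_le_vec_l2_norm) (auto simp: mpo_set_def space_PiM space_haar)
      finally show ?thesis .
    qed
    then show "\<Phi> \<in> ?F" using sp by blast
  qed
  then have "P.prob E \<le> P.prob ?F"
    using sets_mpo_lower_event[OF n d R K haar] by (intro P.finite_measure_mono) auto
  then show "1 - exp (- (lower_const\<^sup>2 / 16) * real Q) \<le> P.prob ?F" using E(2) by linarith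
qed

end
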